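(* Let $r,q,n$ be positive integers with $q\mid r$ and $\gcd(q,n)\le2$, and let $G=G(r,q,n)$. Then $s(G)\ge\Gamma_e(G)$, and $s(G)=\Gamma_e(G)$ if and only if $G$ is abelian.
   Context: $G(r,1,n)=\{(z_1,\dots,z_n;\sigma):z_i\in\mathbb{Z}_r,\sigma\in S_n\}$ with product $(z;\sigma)(z';\sigma')=(z_1+z'_{\sigma^{-1}(1)},\dots,z_n+z'_{\sigma^{-1}(n)};\sigma\sigma')$, and for $q\mid r$, $G(r,q,n)=\{(z_1,\dots,z_n;\sigma)\in G(r,1,n):\sum_i z_i\equiv0\pmod q\}$. For a finite group $G$, $s(G)$ is the sum of all entries of its complex character table and $\Gamma_e(G)$ is the sum of the degrees of its irreducible complex characters. *)

theory Defs
  imports "HOL-Algebra.Group" "Jordan_Normal_Form.Matrix" "HOL-Combinatorics.Permutations"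
begin

text \<open>Elements are pairs (z, sigma) with z : {1..n} -> Z_r (represented by residues 0..r-1,
  and z i = 0 outside {1..n}) and sigma a permutation of {1..n}.\<close>

type_synonym gelem = "(nat \<Rightarrow> nat) \<times> (nat \<Rightarrow> nat)"

definition Grqn_carrier :: "nat \<Rightarrow> nat \<Rightarrow> nat \<Rightarrow> gelem set" where
  "Grqn_carrier r q n = {(z, \<sigma>).
      (\<forall>i\<in>{1..n}. z i < r) \<and> (\<forall>i. i \<notin> {1..n} \<longrightarrow> z i = 0) \<and>
      \<sigma> permutes {1..n} \<and> q dvd (\<Sum>i=1..n. z i)}"

definition Grqn_mult :: "nat \<Rightarrow> nat \<Rightarrow> gelem \<Rightarrow> gelem \<Rightarrow> gelem" where
  "Grqn_mult r n x y = (case x of (z, \<sigma>) \<Rightarrow> case y of (z', \<sigma>') \<Rightarrow>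
      ((\<lambda>i. if i \<in> {1..n} then (z i + z' (inv_into UNIV \<sigma> i)) mod r else 0), \<sigma> \<circ> \<sigma>'))"

definition G_rqn :: "nat \<Rightarrow> nat \<Rightarrow> nat \<Rightarrow> gelem monoid" where
  "G_rqn r q n = \<lparr>carrier = Grqn_carrier r q n, mult = Grqn_mult r n, one = (\<lambda>_. 0, id)\<rparr>"

definition is_rep :: "('a, 'b) monoid_scheme \<Rightarrow> nat \<Rightarrow> ('a \<Rightarrow> complex mat) \<Rightarrow> bool" where
  "is_rep G d \<rho> \<longleftrightarrow>
     (\<forall>g\<in>carrier G. \<rho> g \<in> carrier_mat d d) \<and>
     (\<forall>g\<in>carrier G. \<forall>h\<in>carrier G. \<rho> (g \<otimes>\<^bsub>G\<^esub> h) = \<rho> g * \<rho> h) \<and>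
     \<rho> \<one>\<^bsub>G\<^esub> = 1\<^sub>m d"

definition invariant_subspace ::
  "('a, 'b) monoid_scheme \<Rightarrow> nat \<Rightarrow> ('a \<Rightarrow> complex mat) \<Rightarrow> complex vec set \<Rightarrow> bool" where
  "invariant_subspace G d \<rho> W \<longleftrightarrow>
     W \<subseteq> carrier_vec d \<and> 0\<^sub>v d \<in> W \<and>
     (\<forall>v\<in>W. \<forall>w\<in>W. v + w \<in> W) \<and> (\<forall>c. \<forall>v\<in>W. c \<cdot>\<^sub>v v \<in> W) \<and>
     (\<forall>g\<in>carrier G. \<forall>v\<in>W. \<rho> g *\<^sub>v v \<in> W)"

definition irr_rep :: "('a, 'b) monoid_scheme \<Rightarrow> nat \<Rightarrow> ('a \<Rightarrow> complex mat) \<Rightarrow> bool" where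
  "irr_rep G d \<rho> \<longleftrightarrow> d > 0 \<and> is_rep G d \<rho> \<and>
     (\<forall>W. invariant_subspace G d \<rho> W \<longrightarrow> W = {0\<^sub>v d} \<or> W = carrier_vec d)"

definition mtrace :: "complex mat \<Rightarrow> complex" where
  "mtrace A = (\<Sum>i<dim_row A. A $$ (i, i))"

definition Irr :: "('a, 'b) monoid_scheme \<Rightarrow> ('a \<Rightarrow> complex) set" where
  "Irr G = {\<chi>. \<exists>d \<rho>. irr_rep G d \<rho> \<and> \<chi> = (\<lambda>g\<in>carrier G. mtrace (\<rho> g))}"

definition conj_classes :: "('a, 'b) monoid_scheme \<Rightarrow> 'a set set" where
  "conj_classes G = {{h \<otimes>\<^bsub>G\<^esub> g \<otimes>\<^bsub>G\<^esub> inv\<^bsub>G\<^esub> h | h. h \<in> carrier G} | g. g \<in> carrier G}"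

definition s_char :: "('a, 'b) monoid_scheme \<Rightarrow> complex" where
  "s_char G = (\<Sum>\<chi>\<in>Irr G. \<Sum>C\<in>conj_classes G. \<chi> (SOME g. g \<in> C))"

definition Gamma_e :: "('a, 'b) monoid_scheme \<Rightarrow> complex" where
  "Gamma_e G = (\<Sum>\<chi>\<in>Irr G. \<chi> \<one>\<^bsub>G\<^esub>)"

end

theory Submission
  imports Defs "Jordan_Normal_Form.Spectral_Radius" "HOL-Combinatorics.Cycles"
begin

text \<open>
  View \<open>G(r,q,n)\<close> as a group of monomial matrices and let \<open>\<phi>\<close> be matrix transposition, an
  anti-automorphism of order two. The point is that, for every \<open>g\<close>, the sum of \<open>\<chi> g\<close> over all irreducible
  characters \<open>\<chi>\<close> is the number of solutions \<open>x\<close> of \<open>x \<otimes> inv (\<phi> x) = g\<close>. Hence \<open>s(G)\<close> is a sum of natural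
  numbers over the conjugacy classes, in which the class of the identity contributes \<open>\<Gamma>\<^sub>e(G)\<close>, and
  equality means that \<open>\<phi>\<close> is the identity, that is, that \<open>G\<close> is abelian.

  By a twisted Frobenius-Schur argument the character identity holds if every irreducible
  representation carries a symmetric (rather than skew) nondegenerate form for which \<open>\<phi>\<close> is the adjoint.
  This passes from a subgroup \<open>K\<close> to \<open>G\<close> as soon as every \<open>x\<close> in \<open>G\<close> is conjugate to \<open>\<phi> x\<close> by an element of \<open>K\<close>,
  and it is applied along the chain of the subgroups fixing the points \<open>k, \<dots>, n\<close>. The conjugating
  element reflects each cycle at a base point; its weights can be corrected modulo \<open>q\<close> by constants
  on the cycles, and since \<open>gcd(q,n) \<le> 2\<close> the only possible obstruction is a parity, which vanishes because
  the weights of \<open>x\<close> sum to zero modulo \<open>q\<close>.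
\<close>

section \<open>Matrices and subspaces\<close>

text \<open>Conjugacy of \<open>x\<close> and \<open>\<phi> x\<close> inside the group only yields a
  nondegenerate form. Schur's lemma leaves its sign open, and a skew form would count -1 instead of
  1 in the character identity. The sign is decided by descent: the form restricts to a nonzero form
  on an irreducible constituent for the subgroup \<open>K\<close>, and the restriction inherits the
  sign. At the bottom sits the trivial group, where the form is a 1 by 1 matrix. Two demands shape
  the conjugating elements. To lie in the next smaller subgroup they must fix one point more than
  \<open>x\<close> is known to fix, which is why a base point \<open>k\<close> can be prescribed.
  And their weights must sum to 0 modulo \<open>q\<close>. The subgroups of the chain restrict
  permutations only and keep all weights, so weights at all \<open>n\<close> points are available
  and the same condition on gcd(q,n) serves every step. Only the step from the diagonal subgroup
  down to the trivial group drops the weights, and diagonal elements are their own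
  transposes.\<close>

lemma mult_assoc_dim:
  assumes "dim_col A = dim_row B" "dim_col B = dim_row C"
  shows "(A * B) * C = A * (B * (C :: complex mat))"
  by (rule assoc_mult_mat[of A "dim_row A" "dim_row B" B "dim_row C" C "dim_col C"]) (use assms in auto)

lemma mult_mat_entry:
  assumes "A \<in> carrier_mat n m" "B \<in> carrier_mat m k" "i < n" "j < k"
  shows "(A * B) $$ (i, j) = (\<Sum>l<m. A $$ (i, l) * B $$ (l, j))"
  using assms by (auto simp: scalar_prod_def lessThan_atLeast0)

lemma mult_mat_vec_entry:
  assumes "A \<in> carrier_mat n m" "v \<in> carrier_vec m" "i < n"
  shows "(A *\<^sub>v v) $ i = (\<Sum>l<m. A $$ (i, l) * v $ l)"
  using assms by (auto simp: scalar_prod_def lessThan_atLeast0)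

lemma eq_matI_carrier:
  assumes "A \<in> carrier_mat n m" "B \<in> carrier_mat n m"
    and "\<And>i j. i < n \<Longrightarrow> j < m \<Longrightarrow> A $$ (i, j) = B $$ (i, j)"
  shows "A = B"
  using assms by (intro eq_matI) auto

lemma mtrace_carrier: "A \<in> carrier_mat n n \<Longrightarrow> mtrace A = (\<Sum>i<n. A $$ (i, i))"
  by (auto simp: mtrace_def)

lemma mtrace_mult_comm:
  assumes A: "A \<in> carrier_mat n m" and B: "B \<in> carrier_mat m n"
  shows "mtrace (A * B) = mtrace (B * A)"
proof -
  have "mtrace (A * B) = (\<Sum>i<n. \<Sum>l<m. A $$ (i, l) * B $$ (l, i))"
    using A B by (simp add: mtrace_carrier[of _ n] mult_mat_entry[OF A B] del: index_mult_mat(1))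
  also have "\<dots> = (\<Sum>l<m. \<Sum>i<n. B $$ (l, i) * A $$ (i, l))"
    by (subst sum.swap) (simp add: mult.commute)
  also have "\<dots> = mtrace (B * A)"
    using A B by (simp add: mtrace_carrier[of _ m] mult_mat_entry[OF B A] del: index_mult_mat(1))
  finally show ?thesis .
qed

lemma mtrace_one [simp]: "mtrace (1\<^sub>m d) = of_nat d"
  by (simp add: mtrace_def)

lemma mtrace_add:
  "A \<in> carrier_mat n n \<Longrightarrow> B \<in> carrier_mat n n \<Longrightarrow> mtrace (A + B) = mtrace A + mtrace B"
  by (auto simp: mtrace_def sum.distrib)

lemma mtrace_smult: "A \<in> carrier_mat n n \<Longrightarrow> mtrace (c \<cdot>\<^sub>m A) = c * mtrace A"
  by (auto simp: mtrace_def sum_distrib_left)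

section \<open>Entrywise sums of matrices over an index set, of prescribed shape\<close>

definition msum :: "nat \<Rightarrow> nat \<Rightarrow> ('a \<Rightarrow> complex mat) \<Rightarrow> 'a set \<Rightarrow> complex mat" where
  "msum n m F A = mat n m (\<lambda>(i, j). \<Sum>x\<in>A. F x $$ (i, j))"

lemma msum_carrier [simp, intro]: "msum n m F A \<in> carrier_mat n m"
  by (simp add: msum_def)

lemma msum_dim [simp]: "dim_row (msum n m F A) = n" "dim_col (msum n m F A) = m"
  by (simp_all add: msum_def)

lemma msum_entry [simp]: "i < n \<Longrightarrow> j < m \<Longrightarrow> msum n m F A $$ (i, j) = (\<Sum>x\<in>A. F x $$ (i, j))"
  by (simp add: msum_def)

lemma msum_cong: "(\<And>x. x \<in> A \<Longrightarrow> F x = G x) \<Longrightarrow> msum n m F A = msum n m G A"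
  unfolding msum_def by (intro cong_mat) (auto intro: sum.cong)

lemma mult_msum:
  assumes C: "C \<in> carrier_mat k n" and F: "\<And>x. x \<in> A \<Longrightarrow> F x \<in> carrier_mat n m"
  shows "C * msum n m F A = msum k m (\<lambda>x. C * F x) A"
proof (rule eq_matI_carrier[of _ k m])
  fix i j assume ij: "i < k" "j < m"
  have "(C * msum n m F A) $$ (i, j) = (\<Sum>l<n. \<Sum>x\<in>A. C $$ (i, l) * F x $$ (l, j))"
    using ij by (simp add: mult_mat_entry[OF C msum_carrier] sum_distrib_left del: index_mult_mat(1))
  also have "\<dots> = (\<Sum>x\<in>A. \<Sum>l<n. C $$ (i, l) * F x $$ (l, j))" by (rule sum.swap)
  also have "\<dots> = (\<Sum>x\<in>A. (C * F x) $$ (i, j))"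
    using ij by (intro sum.cong refl mult_mat_entry[OF C F, symmetric]) auto
  finally show "(C * msum n m F A) $$ (i, j) = msum k m (\<lambda>x. C * F x) A $$ (i, j)"
    using ij by simp
qed (use C in auto)

lemma msum_mult:
  assumes C: "C \<in> carrier_mat m k" and F: "\<And>x. x \<in> A \<Longrightarrow> F x \<in> carrier_mat n m"
  shows "msum n m F A * C = msum n k (\<lambda>x. F x * C) A"
proof (rule eq_matI_carrier[of _ n k])
  fix i j assume ij: "i < n" "j < k"
  have "(msum n m F A * C) $$ (i, j) = (\<Sum>l<m. \<Sum>x\<in>A. F x $$ (i, l) * C $$ (l, j))"
    using ij by (simp add: mult_mat_entry[OF msum_carrier C] sum_distrib_right del: index_mult_mat(1))
  also have "\<dots> = (\<Sum>x\<in>A. \<Sum>l<m. F x $$ (i, l) * C $$ (l, j))" by (rule sum.swap)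
  also have "\<dots> = (\<Sum>x\<in>A. (F x * C) $$ (i, j))"
    using ij by (intro sum.cong refl mult_mat_entry[OF F C, symmetric]) auto
  finally show "(msum n m F A * C) $$ (i, j) = msum n k (\<lambda>x. F x * C) A $$ (i, j)"
    using ij by simp
qed (use C in auto)

lemma mtrace_msum:
  assumes F: "\<And>x. x \<in> A \<Longrightarrow> F x \<in> carrier_mat n n"
  shows "mtrace (msum n n F A) = (\<Sum>x\<in>A. mtrace (F x))"
proof -
  have "mtrace (msum n n F A) = (\<Sum>i<n. \<Sum>x\<in>A. F x $$ (i, i))"
    by (simp add: mtrace_carrier[OF msum_carrier])
  also have "\<dots> = (\<Sum>x\<in>A. \<Sum>i<n. F x $$ (i, i))" by (rule sum.swap)
  also have "\<dots> = (\<Sum>x\<in>A. mtrace (F x))"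
    by (intro sum.cong refl mtrace_carrier[OF F, symmetric])
  finally show ?thesis .
qed

lemma msum_transpose:
  assumes F: "\<And>x. x \<in> A \<Longrightarrow> F x \<in> carrier_mat n m"
  shows "transpose_mat (msum n m F A) = msum m n (\<lambda>x. transpose_mat (F x)) A"
proof (rule eq_matI_carrier[of _ m n])
  fix i j assume ij: "i < m" "j < n"
  have "(\<Sum>x\<in>A. F x $$ (j, i)) = (\<Sum>x\<in>A. transpose_mat (F x) $$ (i, j))"
    using ij by (intro sum.cong refl) (auto dest!: F)
  then show "transpose_mat (msum n m F A) $$ (i, j) = msum m n (\<lambda>x. transpose_mat (F x)) A $$ (i, j)"
    using ij by simp
qed auto

lemma msum_reindex_bij:
  "bij_betw f A B \<Longrightarrow> msum n m F B = msum n m (\<lambda>x. F (f x)) A"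
  unfolding msum_def by (intro cong_mat) (auto simp: sum.reindex_bij_betw[symmetric])

text \<open>Sandwiching a matrix unit isolates a product of two single entries. Averaging such
  sandwiches over a group turns Schur's lemma into orthogonality relations for matrix
  coefficients.\<close>

lemma elementary_sandwich:
  assumes A: "A \<in> carrier_mat n d" and B: "B \<in> carrier_mat e m"
    and "j < d" "k < e" "i < n" "l < m"
  shows "(A * mat d e (\<lambda>(a, b). if a = j \<and> b = k then 1 else 0) * B) $$ (i, l) =
    A $$ (i, j) * (B $$ (k, l) :: complex)"
proof -
  let ?X = "mat d e (\<lambda>(a, b). if a = j \<and> b = k then 1 else 0 :: complex)"
  have X: "?X \<in> carrier_mat d e" by simp
  have AX: "(A * ?X) $$ (i, b) = (if b = k then A $$ (i, j) else 0)" if b: "b < e" for b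
  proof -
    have "(A * ?X) $$ (i, b) = (\<Sum>a<d. A $$ (i, a) * ?X $$ (a, b))"
      by (rule mult_mat_entry[OF A X]) (use assms b in auto)
    also have "\<dots> = (\<Sum>a<d. if a = j then (if b = k then A $$ (i, j) else 0) else 0)"
      using b by (intro sum.cong) auto
    finally show ?thesis using assms by simp
  qed
  have "(A * ?X * B) $$ (i, l) = (\<Sum>b<e. (A * ?X) $$ (i, b) * B $$ (b, l))"
    by (rule mult_mat_entry[OF mult_carrier_mat[OF A X] B]) (use assms in auto)
  also have "\<dots> = (\<Sum>b<e. if b = k then A $$ (i, j) * B $$ (k, l) else 0)"
    using AX by (intro sum.cong) (auto simp del: index_mult_mat(1))
  finally show ?thesis using assms by simp
qed

lemma sum_sum_list: "(\<Sum>x\<in>A. \<Sum>\<chi>\<leftarrow>L. F x \<chi>) = (\<Sum>\<chi>\<leftarrow>L. \<Sum>x\<in>A. F x \<chi> :: complex)"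
  by (induction L) (auto simp: sum.distrib)

text \<open>If \<open>d < k\<close>, padding with zeros to square size keeps the product equal to 1,
  so the inverse becomes two-sided; but row \<open>d\<close> of the padded \<open>P\<close>
  vanishes. This bounds the size of a basis.\<close>

lemma left_inverse_imp_le:
  fixes P R :: "complex mat"
  assumes P: "P \<in> carrier_mat d k" and R: "R \<in> carrier_mat k d" and RP: "R * P = 1\<^sub>m k"
  shows "k \<le> d"
proof (rule ccontr)
  assume "\<not> k \<le> d"
  then have dk: "d < k" by simp
  define P' where "P' = mat k k (\<lambda>(i, j). if i < d then P $$ (i, j) else 0)"
  define R' where "R' = mat k k (\<lambda>(i, j). if j < d then R $$ (i, j) else 0)"
  have P': "P' \<in> carrier_mat k k" and R': "R' \<in> carrier_mat k k" by (simp_all add: P'_def R'_def)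
  have "R' * P' = 1\<^sub>m k"
  proof (rule eq_matI_carrier[of _ k k])
    fix i j assume ij: "i < k" "j < k"
    have "(R' * P') $$ (i, j) = (\<Sum>l<k. R' $$ (i, l) * P' $$ (l, j))"
      by (rule mult_mat_entry[OF R' P' ij])
    also have "\<dots> = (\<Sum>l<d. R' $$ (i, l) * P' $$ (l, j))"
      using dk ij by (intro sum.mono_neutral_right) (auto simp: R'_def)
    also have "\<dots> = (\<Sum>l<d. R $$ (i, l) * P $$ (l, j))"
      using dk ij by (intro sum.cong) (auto simp: R'_def P'_def)
    also have "\<dots> = (R * P) $$ (i, j)" by (rule mult_mat_entry[OF R P ij, symmetric])
    finally show "(R' * P') $$ (i, j) = 1\<^sub>m k $$ (i, j)" by (simp add: RP)
  qed (use P' R' in auto)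
  then have one: "P' * R' = 1\<^sub>m k" by (rule mat_mult_left_right_inverse[OF R' P'])
  have "(P' * R') $$ (d, d) = 0"
    using dk by (simp add: mult_mat_entry[OF P' R'] del: index_mult_mat(1)) (simp add: P'_def)
  with dk show False by (simp add: one)
qed

section \<open>Bases and complements of subspaces\<close>

definition vec_subspace :: "nat \<Rightarrow> complex vec set \<Rightarrow> bool" where
  "vec_subspace d W \<longleftrightarrow> W \<subseteq> carrier_vec d \<and> 0\<^sub>v d \<in> W \<and>
     (\<forall>v\<in>W. \<forall>w\<in>W. v + w \<in> W) \<and> (\<forall>c. \<forall>v\<in>W. c \<cdot>\<^sub>v v \<in> W)"

text \<open>Independent vectors are stored as the columns of \<open>P\<close>, together with a left
  inverse \<open>R\<close> that reads off coordinates; both grow by one.\<close>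

lemma vec_subspace_basis_extend:
  fixes P R :: "complex mat"
  assumes W: "vec_subspace d W"
    and P: "P \<in> carrier_mat d k" and R: "R \<in> carrier_mat k d" and RP: "R * P = 1\<^sub>m k"
    and sub: "\<And>v. v \<in> carrier_vec k \<Longrightarrow> P *\<^sub>v v \<in> W"
    and w: "w \<in> W" "\<And>v. v \<in> carrier_vec k \<Longrightarrow> w \<noteq> P *\<^sub>v v"
  obtains P' R' where "P' \<in> carrier_mat d (Suc k)" "R' \<in> carrier_mat (Suc k) d"
    "R' * P' = 1\<^sub>m (Suc k)" "\<And>v. v \<in> carrier_vec (Suc k) \<Longrightarrow> P' *\<^sub>v v \<in> W"
proof -
  have wc: "w \<in> carrier_vec d" using W w by (auto simp: vec_subspace_def)
  \<comment> \<open>The part of \<open>w\<close> outside the columns of \<open>P\<close>. Since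
    \<open>R\<close> kills it, it can become a new column without disturbing the old rows of
    \<open>R\<close>.\<close>
  define u where "u = w + (-1) \<cdot>\<^sub>v (P *\<^sub>v (R *\<^sub>v w))"
  have uW: "u \<in> W" unfolding u_def
    using W w sub[of "R *\<^sub>v w"] R wc by (auto simp: vec_subspace_def)
  have uc: "u \<in> carrier_vec d" using W uW by (auto simp: vec_subspace_def)
  have RPv: "R *\<^sub>v (P *\<^sub>v v) = v" if "v \<in> carrier_vec k" for v
    using assoc_mult_mat_vec[OF R P that] RP that by simp
  have Ru: "R *\<^sub>v u = 0\<^sub>v k"
  proof -
    have "R *\<^sub>v u = R *\<^sub>v w + (-1) \<cdot>\<^sub>v (R *\<^sub>v (P *\<^sub>v (R *\<^sub>v w)))"
      unfolding u_def using R P wc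
      by (subst mult_add_distrib_mat_vec[of _ k d]) (auto simp: mult_mat_vec[of _ k d])
    also have "\<dots> = 0\<^sub>v k" using RPv[of "R *\<^sub>v w"] R wc by auto
    finally show ?thesis .
  qed
  have "u \<noteq> 0\<^sub>v d"
  proof
    assume u0: "u = 0\<^sub>v d"
    have "w = P *\<^sub>v (R *\<^sub>v w)"
    proof (rule eq_vecI)
      fix i assume "i < dim_vec (P *\<^sub>v (R *\<^sub>v w))"
      then have i: "i < d" using P by simp
      have "u $ i = w $ i - (P *\<^sub>v (R *\<^sub>v w)) $ i"
        unfolding u_def using i P R wc by simp
      then show "w $ i = (P *\<^sub>v (R *\<^sub>v w)) $ i" using i by (simp add: u0)
    qed (use P wc in auto)
    then show False using w(2)[of "R *\<^sub>v w"] R wc by auto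
  qed
  then obtain i0 where i0: "i0 < d" "u $ i0 \<noteq> 0" using uc by (metis eq_vecI carrier_vecD index_zero_vec)
  have PR: "P * R \<in> carrier_mat d d" using P R by auto
  \<comment> \<open>Row \<open>i0\<close> of \<open>1 - P * R\<close>, scaled. It annihilates the
    columns of \<open>P\<close>, and it takes the value 1 at \<open>u\<close> because
    \<open>P * R\<close> kills \<open>u\<close>.\<close>
  define r where "r = (\<lambda>j. ((if j = i0 then 1 else 0) - (P * R) $$ (i0, j)) / u $ i0)"
  have r_sum: "(\<Sum>l<d. r l * y l) = (y i0 - (\<Sum>l<d. (P * R) $$ (i0, l) * y l)) / u $ i0" for y
  proof -
    have "(\<Sum>l<d. r l * y l) =
        (\<Sum>l<d. (if l = i0 then y i0 else 0) - (P * R) $$ (i0, l) * y l) / u $ i0"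
      unfolding sum_divide_distrib by (intro sum.cong) (auto simp: r_def left_diff_distrib)
    then show ?thesis using i0 by (simp add: sum_subtractf del: index_mult_mat(1))
  qed
  have PRP: "P * R * P = P" using P R RP by (simp add: mult_assoc_dim)
  have rP: "(\<Sum>l<d. r l * P $$ (l, j)) = 0" if j: "j < k" for j
  proof -
    have "(\<Sum>l<d. r l * P $$ (l, j)) =
      (P $$ (i0, j) - (\<Sum>l<d. (P * R) $$ (i0, l) * P $$ (l, j))) / u $ i0"
      by (rule r_sum)
    also have "(\<Sum>l<d. (P * R) $$ (i0, l) * P $$ (l, j)) = (P * R * P) $$ (i0, j)"
      by (rule mult_mat_entry[OF PR P i0(1) j, symmetric])
    finally show ?thesis by (simp add: PRP)
  qed
  have ru: "(\<Sum>l<d. r l * u $ l) = 1"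
  proof -
    have "(\<Sum>l<d. r l * u $ l) = (u $ i0 - (\<Sum>l<d. (P * R) $$ (i0, l) * u $ l)) / u $ i0"
      by (rule r_sum)
    also have "(\<Sum>l<d. (P * R) $$ (i0, l) * u $ l) = ((P * R) *\<^sub>v u) $ i0"
      by (rule mult_mat_vec_entry[OF PR uc i0(1), symmetric])
    also have "(P * R) *\<^sub>v u = P *\<^sub>v 0\<^sub>v k" using assoc_mult_mat_vec[OF P R uc] Ru by simp
    also have "(P *\<^sub>v 0\<^sub>v k) $ i0 = 0" using P i0 by simp
    finally show ?thesis using i0 by simp
  qed
  define P' where "P' = mat d (Suc k) (\<lambda>(i, j). if j < k then P $$ (i, j) else u $ i)"
  define R' where "R' = mat (Suc k) d (\<lambda>(i, j). if i < k then R $$ (i, j) else r j)"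
  have P': "P' \<in> carrier_mat d (Suc k)" and R': "R' \<in> carrier_mat (Suc k) d"
    by (simp_all add: P'_def R'_def)
  have "R' * P' = 1\<^sub>m (Suc k)"
  proof (rule eq_matI_carrier[of _ "Suc k" "Suc k"])
    fix i j assume ij: "i < Suc k" "j < Suc k"
    have e: "(R' * P') $$ (i, j) = (\<Sum>l<d. R' $$ (i, l) * P' $$ (l, j))"
      by (rule mult_mat_entry[OF R' P' ij])
    consider "i < k" "j < k" | "i < k" "j = k" | "i = k" "j < k" | "i = k" "j = k"
      using ij by linarith
    then show "(R' * P') $$ (i, j) = 1\<^sub>m (Suc k) $$ (i, j)"
    proof cases
      case 1
      then have "(R' * P') $$ (i, j) = (R * P) $$ (i, j)"
        unfolding e mult_mat_entry[OF R P 1] by (intro sum.cong) (auto simp: R'_def P'_def)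
      then show ?thesis using 1 by (simp add: RP)
    next
      case 2
      then have "(R' * P') $$ (i, j) = (R *\<^sub>v u) $ i"
        unfolding e mult_mat_vec_entry[OF R uc 2(1)] by (intro sum.cong) (auto simp: R'_def P'_def)
      then show ?thesis using 2 by (simp add: Ru)
    next
      case 3
      then have "(R' * P') $$ (i, j) = (\<Sum>l<d. r l * P $$ (l, j))"
        unfolding e by (intro sum.cong) (auto simp: R'_def P'_def)
      then show ?thesis using 3 by (simp add: rP)
    next
      case 4
      then have "(R' * P') $$ (i, j) = (\<Sum>l<d. r l * u $ l)"
        unfolding e by (intro sum.cong) (auto simp: R'_def P'_def)
      then show ?thesis using 4 by (simp add: ru)
    qed
  qed (use P' R' in auto)
  moreover have "P' *\<^sub>v v \<in> W" if v: "v \<in> carrier_vec (Suc k)" for v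
  proof -
    let ?v = "vec k (\<lambda>i. v $ i)"
    have "P' *\<^sub>v v = P *\<^sub>v ?v + v $ k \<cdot>\<^sub>v u"
    proof (rule eq_vecI)
      fix i assume "i < dim_vec (P *\<^sub>v ?v + v $ k \<cdot>\<^sub>v u)"
      then have i: "i < d" using P uc by simp
      have "(P' *\<^sub>v v) $ i = (\<Sum>l<Suc k. P' $$ (i, l) * v $ l)"
        by (rule mult_mat_vec_entry[OF P' v i])
      also have "\<dots> = (\<Sum>l<k. P $$ (i, l) * ?v $ l) + u $ i * v $ k"
        using i by (simp add: P'_def)
      also have "(\<Sum>l<k. P $$ (i, l) * ?v $ l) = (P *\<^sub>v ?v) $ i"
        by (rule mult_mat_vec_entry[OF P _ i, symmetric]) simp
      finally show "(P' *\<^sub>v v) $ i = (P *\<^sub>v ?v + v $ k \<cdot>\<^sub>v u) $ i"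
        using i P uc by (simp add: mult.commute)
    qed (use P' P uc in auto)
    then show ?thesis using W uW sub[of ?v] by (auto simp: vec_subspace_def)
  qed
  ultimately show ?thesis using that P' R' by blast
qed

lemma vec_subspace_basis:
  assumes W: "vec_subspace d W"
  obtains k P R where "P \<in> carrier_mat d k" "R \<in> carrier_mat k d" "R * P = 1\<^sub>m k"
    "W = (\<lambda>v. P *\<^sub>v v) ` carrier_vec k"
proof -
  define good where "good = (\<lambda>k. \<exists>P R. P \<in> carrier_mat d k \<and> R \<in> carrier_mat k d \<and> R * P = 1\<^sub>m k \<and>
    (\<forall>v\<in>carrier_vec k. P *\<^sub>v v \<in> W))"
  have bound: "k \<le> d" if "good k" for k using that left_inverse_imp_le unfolding good_def by blast
  have "good 0" unfolding good_def
  proof (intro exI conjI ballI)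
    show "0\<^sub>m d 0 \<in> carrier_mat d 0" "0\<^sub>m 0 d \<in> carrier_mat 0 d" by auto
    show "0\<^sub>m 0 d * 0\<^sub>m d 0 = (1\<^sub>m 0 :: complex mat)" by (intro eq_matI) auto
    fix v :: "complex vec" assume v: "v \<in> carrier_vec 0"
    then have "0\<^sub>m d 0 *\<^sub>v v = 0\<^sub>v d" by (intro eq_vecI) (auto simp: scalar_prod_def)
    then show "0\<^sub>m d 0 *\<^sub>v v \<in> W" using W by (simp add: vec_subspace_def)
  qed
  \<comment> \<open>A largest \<open>k\<close> exists by \<open>left_inverse_imp_le\<close>; a
    vector of \<open>W\<close> outside the column space would let
    \<open>vec_subspace_basis_extend\<close> exceed it.\<close>
  define k where "k = (GREATEST k. good k)"
  have gk: "good k" unfolding k_def by (rule GreatestI_nat[of good 0 d]) (use bound \<open>good 0\<close> in auto)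
  then obtain P R where PR: "P \<in> carrier_mat d k" "R \<in> carrier_mat k d" "R * P = 1\<^sub>m k"
    and sub: "\<And>v. v \<in> carrier_vec k \<Longrightarrow> P *\<^sub>v v \<in> W" unfolding good_def by blast
  have "w \<in> (\<lambda>v. P *\<^sub>v v) ` carrier_vec k" if w: "w \<in> W" for w
  proof (rule ccontr)
    assume "\<not> ?thesis"
    then have nw: "\<And>v. v \<in> carrier_vec k \<Longrightarrow> w \<noteq> P *\<^sub>v v" by blast
    obtain P' R' where "P' \<in> carrier_mat d (Suc k)" "R' \<in> carrier_mat (Suc k) d"
      "R' * P' = 1\<^sub>m (Suc k)" "\<And>v. v \<in> carrier_vec (Suc k) \<Longrightarrow> P' *\<^sub>v v \<in> W"
      using vec_subspace_basis_extend[OF W PR sub w nw] by blast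
    then have "good (Suc k)" unfolding good_def by blast
    then have "Suc k \<le> k" unfolding k_def using bound by (intro Greatest_le_nat[of good _ d]) auto
    then show False by simp
  qed
  then have "W = (\<lambda>v. P *\<^sub>v v) ` carrier_vec k" using sub by blast
  then show ?thesis using that PR by blast
qed

lemma mat_eq_by_vec:
  fixes A B :: "complex mat"
  assumes A: "A \<in> carrier_mat n m" and B: "B \<in> carrier_mat n m"
    and eq: "\<And>v. v \<in> carrier_vec m \<Longrightarrow> A *\<^sub>v v = B *\<^sub>v v"
  shows "A = B"
proof (rule eq_matI_carrier[OF A B])
  fix i j assume ij: "i < n" "j < m"
  have *: "(C *\<^sub>v unit_vec m j) $ i = C $$ (i, j)" if C: "C \<in> carrier_mat n m" for C :: "complex mat"
    using ij by (subst mult_mat_vec_entry[OF C]) (auto simp: unit_vec_def if_distrib cong: if_cong)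
  show "A $$ (i, j) = B $$ (i, j)" using *[OF A] *[OF B] eq[of "unit_vec m j"] by simp
qed

section \<open>Representations and Schur's lemma\<close>

lemma zero_mat_mult_vec [simp]: "v \<in> carrier_vec k \<Longrightarrow> 0\<^sub>m l k *\<^sub>v v = (0\<^sub>v l :: complex vec)"
  by (intro eq_vecI) (auto simp: scalar_prod_def)

text \<open>The complement is the image of the projection \<open>Q = 1 - P * R\<close>. Its basis
  \<open>P'\<close> comes with some left inverse \<open>R0\<close>, replaced by
  \<open>R0 * Q\<close> in order to kill \<open>P\<close>. Taking traces in the resulting
  decomposition of the identity gives \<open>k + l = d\<close>.\<close>

lemma vec_subspace_split:
  assumes W: "vec_subspace d W"
  obtains k l P R P' R' where
    "P \<in> carrier_mat d k" "R \<in> carrier_mat k d" "P' \<in> carrier_mat d l" "R' \<in> carrier_mat l d"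
    "R * P = 1\<^sub>m k" "R' * P' = 1\<^sub>m l" "R' * P = 0\<^sub>m l k" "P * R + P' * R' = 1\<^sub>m d"
    "W = (\<lambda>v. P *\<^sub>v v) ` carrier_vec k" "k + l = d"
proof -
  obtain k P R where P: "P \<in> carrier_mat d k" and R: "R \<in> carrier_mat k d" and RP: "R * P = 1\<^sub>m k"
    and WP: "W = (\<lambda>v. P *\<^sub>v v) ` carrier_vec k" using vec_subspace_basis[OF W] .
  define Q where "Q = 1\<^sub>m d - P * R"
  have PR: "P * R \<in> carrier_mat d d" using P R by auto
  have Q: "Q \<in> carrier_mat d d" using P R by (auto simp: Q_def)
  have QP: "Q * P = 0\<^sub>m d k"
    unfolding Q_def using P R RP PR by (subst minus_mult_distrib_mat[of _ d d]) (auto simp: mult_assoc_dim)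
  have QQ: "Q * Q = Q"
  proof -
    have "Q * Q = Q * 1\<^sub>m d - Q * (P * R)"
      using mult_minus_distrib_mat[OF Q one_carrier_mat PR] by (simp add: Q_def)
    also have "Q * (P * R) = 0\<^sub>m d d" using Q P R QP by (simp add: mult_assoc_dim[symmetric])
    finally show ?thesis using Q by (auto intro!: eq_matI)
  qed
  define V where "V = (\<lambda>v. Q *\<^sub>v v) ` carrier_vec d"
  have V: "vec_subspace d V" unfolding vec_subspace_def V_def
  proof (intro conjI ballI allI)
    show "(\<lambda>v. Q *\<^sub>v v) ` carrier_vec d \<subseteq> carrier_vec d" using Q by auto
    show "0\<^sub>v d \<in> (\<lambda>v. Q *\<^sub>v v) ` carrier_vec d" using Q by (intro image_eqI[of _ _ "0\<^sub>v d"]) auto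
  next
    fix v w assume "v \<in> (\<lambda>v. Q *\<^sub>v v) ` carrier_vec d" "w \<in> (\<lambda>v. Q *\<^sub>v v) ` carrier_vec d"
    then obtain a b where "v = Q *\<^sub>v a" "w = Q *\<^sub>v b" "a \<in> carrier_vec d" "b \<in> carrier_vec d" by auto
    then show "v + w \<in> (\<lambda>v. Q *\<^sub>v v) ` carrier_vec d"
      using Q by (intro image_eqI[of _ _ "a + b"]) (auto simp: mult_add_distrib_mat_vec[of _ d d])
  next
    fix c v assume "v \<in> (\<lambda>v. Q *\<^sub>v v) ` carrier_vec d"
    then obtain a where "v = Q *\<^sub>v a" "a \<in> carrier_vec d" by auto
    then show "c \<cdot>\<^sub>v v \<in> (\<lambda>v. Q *\<^sub>v v) ` carrier_vec d"
      using Q by (intro image_eqI[of _ _ "c \<cdot>\<^sub>v a"]) (auto simp: mult_mat_vec[of _ d d])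
  qed
  obtain l P' R0 where P': "P' \<in> carrier_mat d l" and R0: "R0 \<in> carrier_mat l d" and RP': "R0 * P' = 1\<^sub>m l"
    and VP: "V = (\<lambda>v. P' *\<^sub>v v) ` carrier_vec l" using vec_subspace_basis[OF V] .
  define R' where "R' = R0 * Q"
  have R': "R' \<in> carrier_mat l d" using R0 Q by (auto simp: R'_def)
  have QP': "Q * P' = P'"
  proof (rule mat_eq_by_vec[of _ d l])
    fix v :: "complex vec" assume v: "v \<in> carrier_vec l"
    then obtain a where a: "P' *\<^sub>v v = Q *\<^sub>v a" "a \<in> carrier_vec d"
      using VP V_def by (metis (no_types, lifting) image_iff)
    have "(Q * P') *\<^sub>v v = Q *\<^sub>v (Q *\<^sub>v a)" using assoc_mult_mat_vec[OF Q P' v] a by simp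
    also have "\<dots> = Q *\<^sub>v a" using assoc_mult_mat_vec[OF Q Q a(2)] QQ by simp
    finally show "(Q * P') *\<^sub>v v = P' *\<^sub>v v" using a by simp
  qed (use Q P' in auto)
  have 1: "R' * P' = 1\<^sub>m l"
    unfolding R'_def using R0 Q P' QP' RP' by (simp add: mult_assoc_dim)
  have 2: "R' * P = 0\<^sub>m l k"
    unfolding R'_def using R0 Q P QP by (simp add: mult_assoc_dim)
  have PRQ: "P' * R' = Q"
  proof (rule mat_eq_by_vec[of _ d d])
    fix v :: "complex vec" assume v: "v \<in> carrier_vec d"
    have "Q *\<^sub>v v \<in> V" using v by (auto simp: V_def)
    then obtain a where a: "Q *\<^sub>v v = P' *\<^sub>v a" "a \<in> carrier_vec l" using VP by auto
    have "(P' * R') *\<^sub>v v = P' *\<^sub>v (R0 *\<^sub>v (Q *\<^sub>v v))"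
      unfolding R'_def using P' R0 Q v by (simp add: assoc_mult_mat_vec[of _ d l _ d] assoc_mult_mat_vec[of _ l d _ d])
    also have "R0 *\<^sub>v (Q *\<^sub>v v) = a"
      using a assoc_mult_mat_vec[OF R0 P' a(2)] RP' by simp
    finally show "(P' * R') *\<^sub>v v = Q *\<^sub>v v" using a by simp
  qed (use Q P' R' in auto)
  have 3: "P * R + P' * R' = 1\<^sub>m d" unfolding PRQ Q_def
    by (rule eq_matI_carrier[of _ d d]) (use P R in \<open>auto simp del: index_mult_mat(1)\<close>)
  have "of_nat d = mtrace (P * R + P' * R')" by (simp add: 3)
  also have "\<dots> = mtrace (P * R) + mtrace (P' * R')" using P R P' R' by (intro mtrace_add[of _ d]) auto
  also have "\<dots> = mtrace (R * P) + mtrace (R' * P')"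
    using mtrace_mult_comm[OF P R] mtrace_mult_comm[OF P' R'] by simp
  finally have "of_nat d = (of_nat (k + l) :: complex)" by (simp add: RP 1)
  then have "k + l = d" by (metis of_nat_eq_iff)
  then show ?thesis using that[OF P R P' R' RP 1 2 3 WP] by blast
qed

lemma invariant_subspace_imp_vec_subspace: "invariant_subspace G d \<rho> W \<Longrightarrow> vec_subspace d W"
  by (auto simp: invariant_subspace_def vec_subspace_def)

lemma is_rep_carrier: "is_rep G d \<rho> \<Longrightarrow> g \<in> carrier G \<Longrightarrow> \<rho> g \<in> carrier_mat d d"
  by (simp add: is_rep_def)

lemma is_rep_dim:
  "is_rep G d \<rho> \<Longrightarrow> g \<in> carrier G \<Longrightarrow> dim_row (\<rho> g) = d"
  "is_rep G d \<rho> \<Longrightarrow> g \<in> carrier G \<Longrightarrow> dim_col (\<rho> g) = d"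
  by (auto dest: is_rep_carrier)

lemma is_rep_mult:
  "is_rep G d \<rho> \<Longrightarrow> g \<in> carrier G \<Longrightarrow> h \<in> carrier G \<Longrightarrow> \<rho> (g \<otimes>\<^bsub>G\<^esub> h) = \<rho> g * \<rho> h"
  by (simp add: is_rep_def)

lemma is_rep_one: "is_rep G d \<rho> \<Longrightarrow> \<rho> \<one>\<^bsub>G\<^esub> = 1\<^sub>m d"
  by (simp add: is_rep_def)

lemma irr_rep_is_rep: "irr_rep G d \<rho> \<Longrightarrow> is_rep G d \<rho>"
  by (simp add: irr_rep_def)

text \<open>In the basis formed by the columns of \<open>P\<close> and its complement the
  representation is block triangular: \<open>\<alpha>\<close> is the restriction to \<open>W\<close>
  and \<open>\<gamma>\<close> the action on the quotient. Traces add up in any case, so no invariant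
  complement is constructed.\<close>

lemma rep_split:
  fixes G (structure)
  assumes "group G" and rep: "is_rep G d \<rho>" and inv: "invariant_subspace G d \<rho> W"
  obtains k l P R \<alpha> \<gamma> where
    "P \<in> carrier_mat d k" "R \<in> carrier_mat k d" "R * P = 1\<^sub>m k" "k + l = d"
    "W = (\<lambda>v. P *\<^sub>v v) ` carrier_vec k" "is_rep G k \<alpha>" "is_rep G l \<gamma>"
    "\<And>g. g \<in> carrier G \<Longrightarrow> \<rho> g * P = P * \<alpha> g"
    "\<And>g. g \<in> carrier G \<Longrightarrow> mtrace (\<rho> g) = mtrace (\<alpha> g) + mtrace (\<gamma> g)"
proof -
  interpret group G by fact
  obtain k l P R P' R' where P: "P \<in> carrier_mat d k" and R: "R \<in> carrier_mat k d"
    and P': "P' \<in> carrier_mat d l" and R': "R' \<in> carrier_mat l d"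
    and RP: "R * P = 1\<^sub>m k" and RP': "R' * P' = 1\<^sub>m l" and R'P: "R' * P = 0\<^sub>m l k"
    and one: "P * R + P' * R' = 1\<^sub>m d"
    and W: "W = (\<lambda>v. P *\<^sub>v v) ` carrier_vec k" and kl: "k + l = d"
    using vec_subspace_split[OF invariant_subspace_imp_vec_subspace[OF inv]] .
  note dims [simp] = is_rep_dim[OF rep] P[THEN carrier_matD(1)] P[THEN carrier_matD(2)]
    R[THEN carrier_matD(1)] R[THEN carrier_matD(2)] P'[THEN carrier_matD(1)] P'[THEN carrier_matD(2)]
    R'[THEN carrier_matD(1)] R'[THEN carrier_matD(2)]
  note rc = is_rep_carrier[OF rep]
  define \<alpha> where "\<alpha> = (\<lambda>g. R * (\<rho> g * P))"
  define \<gamma> where "\<gamma> = (\<lambda>g. R' * (\<rho> g * P'))"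
  have ident: "P * (R * M) + P' * (R' * M) = M" if M: "M \<in> carrier_mat d m" for M m
  proof -
    have "P * (R * M) + P' * (R' * M) = (P * R) * M + (P' * R') * M"
      using M by (simp add: mult_assoc_dim)
    also have "\<dots> = (P * R + P' * R') * M"
      by (rule add_mult_distrib_mat[OF mult_carrier_mat[OF P R] mult_carrier_mat[OF P' R'] M, symmetric])
    finally show ?thesis using M one by simp
  qed
  have R'\<rho>P: "R' * (\<rho> g * P) = 0\<^sub>m l k" if g: "g \<in> carrier G" for g
  proof (rule mat_eq_by_vec[of _ l k])
    fix v :: "complex vec" assume v: "v \<in> carrier_vec k"
    have "P *\<^sub>v v \<in> W" using v W by auto
    then have "\<rho> g *\<^sub>v (P *\<^sub>v v) \<in> W" using inv g by (simp add: invariant_subspace_def)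
    then obtain a where a: "\<rho> g *\<^sub>v (P *\<^sub>v v) = P *\<^sub>v a" "a \<in> carrier_vec k" using W by auto
    have "(R' * (\<rho> g * P)) *\<^sub>v v = R' *\<^sub>v (\<rho> g *\<^sub>v (P *\<^sub>v v))"
      using assoc_mult_mat_vec[OF R' mult_carrier_mat[OF rc[OF g] P] v]
        assoc_mult_mat_vec[OF rc[OF g] P v] by simp
    also have "\<dots> = (R' * P) *\<^sub>v a" using assoc_mult_mat_vec[OF R' P a(2)] a(1) by simp
    also have "\<dots> = 0\<^sub>m l k *\<^sub>v v" using a v by (simp add: R'P)
    finally show "(R' * (\<rho> g * P)) *\<^sub>v v = 0\<^sub>m l k *\<^sub>v v" .
  qed (use R' P rc[OF g] in auto)
  have \<rho>P: "\<rho> g * P = P * \<alpha> g" if g: "g \<in> carrier G" for g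
  proof -
    have "\<rho> g * P = P * \<alpha> g + P' * (R' * (\<rho> g * P))"
      using ident[of "\<rho> g * P" k] rc[OF g] P by (simp add: \<alpha>_def)
    also have "\<dots> = P * \<alpha> g" using R'\<rho>P[OF g] P P' R rc[OF g] by (auto simp: \<alpha>_def)
    finally show ?thesis .
  qed
  have R\<rho>: "R' * \<rho> g = \<gamma> g * R'" if g: "g \<in> carrier G" for g
  proof -
    have "R' * \<rho> g = R' * \<rho> g * (P * R + P' * R')" using one R' rc[OF g] by simp
    also have "\<dots> = R' * \<rho> g * (P * R) + R' * \<rho> g * (P' * R')"
      by (rule mult_add_distrib_mat[OF mult_carrier_mat[OF R' rc[OF g]]
            mult_carrier_mat[OF P R] mult_carrier_mat[OF P' R']])
    also have "R' * \<rho> g * (P * R) = R' * (\<rho> g * P) * R" using g by (simp add: mult_assoc_dim)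
    also have "R' * \<rho> g * (P' * R') = \<gamma> g * R'" using g by (simp add: mult_assoc_dim \<gamma>_def)
    also have "R' * (\<rho> g * P) * R = 0\<^sub>m l d" using R'\<rho>P[OF g] R by simp
    also have "0\<^sub>m l d + \<gamma> g * R' = \<gamma> g * R'"
      by (intro left_add_zero_mat carrier_matI) (simp_all add: \<gamma>_def)
    finally show ?thesis .
  qed
  have "is_rep G k \<alpha>" unfolding is_rep_def
  proof (intro conjI ballI)
    fix g h assume gh: "g \<in> carrier G" "h \<in> carrier G"
    have "\<alpha> (g \<otimes> h) = R * (\<rho> g * (\<rho> h * P))"
      using gh by (simp add: \<alpha>_def is_rep_mult[OF rep] mult_assoc_dim)
    also have "\<dots> = \<alpha> g * \<alpha> h" using gh by (simp add: \<rho>P mult_assoc_dim) (simp add: \<alpha>_def mult_assoc_dim)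
    finally show "\<alpha> (g \<otimes> h) = \<alpha> g * \<alpha> h" .
  next
    show "\<alpha> g \<in> carrier_mat k k" if "g \<in> carrier G" for g
      using that by (intro carrier_matI) (simp_all add: \<alpha>_def)
    show "\<alpha> \<one> = 1\<^sub>m k" by (simp add: \<alpha>_def is_rep_one[OF rep] left_mult_one_mat[OF P] RP)
  qed
  moreover have "is_rep G l \<gamma>" unfolding is_rep_def
  proof (intro conjI ballI)
    fix g h assume gh: "g \<in> carrier G" "h \<in> carrier G"
    have "\<gamma> (g \<otimes> h) = (R' * \<rho> g) * (\<rho> h * P')"
      using gh by (simp add: \<gamma>_def is_rep_mult[OF rep] mult_assoc_dim)
    also have "\<dots> = \<gamma> g * \<gamma> h" using gh by (simp add: R\<rho>) (simp add: \<gamma>_def mult_assoc_dim)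
    finally show "\<gamma> (g \<otimes> h) = \<gamma> g * \<gamma> h" .
  next
    show "\<gamma> g \<in> carrier_mat l l" if "g \<in> carrier G" for g
      using that by (intro carrier_matI) (simp_all add: \<gamma>_def)
    show "\<gamma> \<one> = 1\<^sub>m l" by (simp add: \<gamma>_def is_rep_one[OF rep] left_mult_one_mat[OF P'] RP')
  qed
  moreover have "mtrace (\<rho> g) = mtrace (\<alpha> g) + mtrace (\<gamma> g)" if g: "g \<in> carrier G" for g
  proof -
    have "mtrace (\<rho> g) = mtrace (P * (R * \<rho> g) + P' * (R' * \<rho> g))" using ident[OF rc[OF g]] by simp
    also have "\<dots> = mtrace (P * (R * \<rho> g)) + mtrace (P' * (R' * \<rho> g))"
      using g by (intro mtrace_add[of _ d] carrier_matI) simp_all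
    also have "mtrace (P * (R * \<rho> g)) = mtrace (R * \<rho> g * P)"
      using g by (intro mtrace_mult_comm[of _ d k] carrier_matI) simp_all
    also have "mtrace (P' * (R' * \<rho> g)) = mtrace (R' * \<rho> g * P')"
      using g by (intro mtrace_mult_comm[of _ d l] carrier_matI) simp_all
    finally show ?thesis using g by (simp add: \<alpha>_def \<gamma>_def mult_assoc_dim)
  qed
  ultimately show ?thesis using that[OF P R RP kl W _ _ \<rho>P] by blast
qed

lemma not_irr_rep_split:
  assumes "group G" and rep: "is_rep G d \<rho>" and "d > 0" and "\<not> irr_rep G d \<rho>"
  obtains k l P R \<alpha> \<gamma> where
    "P \<in> carrier_mat d k" "R \<in> carrier_mat k d" "R * P = 1\<^sub>m k" "k + l = d" "0 < k" "0 < l"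
    "is_rep G k \<alpha>" "is_rep G l \<gamma>"
    "\<And>g. g \<in> carrier G \<Longrightarrow> \<rho> g * P = P * \<alpha> g"
    "\<And>g. g \<in> carrier G \<Longrightarrow> mtrace (\<rho> g) = mtrace (\<alpha> g) + mtrace (\<gamma> g)"
proof -
  obtain W where inv: "invariant_subspace G d \<rho> W" and W: "W \<noteq> {0\<^sub>v d}" "W \<noteq> carrier_vec d"
    using assms by (auto simp: irr_rep_def)
  obtain k l P R \<alpha> \<gamma> where *: "P \<in> carrier_mat d k" "R \<in> carrier_mat k d" "R * P = 1\<^sub>m k" "k + l = d"
    "W = (\<lambda>v. P *\<^sub>v v) ` carrier_vec k" "is_rep G k \<alpha>" "is_rep G l \<gamma>"
    "\<And>g. g \<in> carrier G \<Longrightarrow> \<rho> g * P = P * \<alpha> g"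
    "\<And>g. g \<in> carrier G \<Longrightarrow> mtrace (\<rho> g) = mtrace (\<alpha> g) + mtrace (\<gamma> g)"
    using rep_split[OF \<open>group G\<close> rep inv] by metis
  have "k \<noteq> 0"
  proof
    assume k: "k = 0"
    have "W = {0\<^sub>v d}"
    proof -
      have "P *\<^sub>v v = 0\<^sub>v d" if "v \<in> carrier_vec k" for v
        using that * k by (intro eq_vecI) (auto simp: scalar_prod_def)
      moreover have "0\<^sub>v d \<in> W" using inv by (simp add: invariant_subspace_def)
      ultimately show ?thesis using * by auto
    qed
    then show False using W by simp
  qed
  moreover have "l \<noteq> 0"
  proof
    assume "l = 0"
    then have kd: "k = d" using * by simp
    have P: "P \<in> carrier_mat d d" and R: "R \<in> carrier_mat d d" using * kd by auto
    have PR: "P * R = 1\<^sub>m d" using mat_mult_left_right_inverse[OF R P] * kd by simp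
    have "v \<in> W" if v: "v \<in> carrier_vec d" for v
    proof -
      have "v = P *\<^sub>v (R *\<^sub>v v)" using assoc_mult_mat_vec[OF P R v] PR v by simp
      then show ?thesis using * kd R v by (metis image_eqI mult_mat_vec_carrier)
    qed
    then have "W = carrier_vec d" using inv by (auto simp: invariant_subspace_def)
    then show False using W by simp
  qed
  ultimately show ?thesis using that * by blast
qed

text \<open>Here \<open>R\<close> is only a linear left inverse of the inclusion \<open>P\<close>;
  an equivariant one is obtained by averaging where it is needed.\<close>

lemma exists_irr_subrep:
  assumes G: "group G" and "is_rep G d \<rho>" and "d > 0"
  shows "\<exists>k P R \<alpha>. P \<in> carrier_mat d k \<and> R \<in> carrier_mat k d \<and> R * P = 1\<^sub>m k \<and> irr_rep G k \<alpha> \<and>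
    (\<forall>g\<in>carrier G. \<rho> g * P = P * \<alpha> g)"
  using assms(2,3)
proof (induction d arbitrary: \<rho> rule: less_induct)
  case (less d)
  show ?case
  proof (cases "irr_rep G d \<rho>")
    case True
    then show ?thesis using left_mult_one_mat[OF is_rep_carrier[OF less.prems(1)]]
        right_mult_one_mat[OF is_rep_carrier[OF less.prems(1)]]
      by (intro exI[of _ d] exI[of _ "1\<^sub>m d"] exI[of _ \<rho>]) auto
  next
    case False
    obtain k l P R \<alpha> where *: "P \<in> carrier_mat d k" "R \<in> carrier_mat k d" "R * P = 1\<^sub>m k"
      "k + l = d" "0 < k" "0 < l" "is_rep G k \<alpha>" "\<And>g. g \<in> carrier G \<Longrightarrow> \<rho> g * P = P * \<alpha> g"
      using not_irr_rep_split[OF G less.prems False] by metis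
    obtain k' P' R' \<beta> where **: "P' \<in> carrier_mat k k'" "R' \<in> carrier_mat k' k" "R' * P' = 1\<^sub>m k'"
      "irr_rep G k' \<beta>" "\<And>g. g \<in> carrier G \<Longrightarrow> \<alpha> g * P' = P' * \<beta> g"
      using less.IH[of k \<alpha>] * by auto
    have "(R' * R) * (P * P') = R' * ((R * P) * P')"
      using *(1,2) **(1,2) by (simp add: mult_assoc_dim)
    also have "(R * P) * P' = P'" using * ** by (metis left_mult_one_mat)
    also have "R' * P' = 1\<^sub>m k'" by fact
    finally have 1: "(R' * R) * (P * P') = 1\<^sub>m k'" .
    have "\<rho> g * (P * P') = (P * P') * \<beta> g" if g: "g \<in> carrier G" for g
    proof -
      note d = is_rep_dim[OF less.prems(1) g] is_rep_dim[OF *(7) g]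
        is_rep_dim[OF irr_rep_is_rep[OF **(4)] g]
      have "\<rho> g * (P * P') = (\<rho> g * P) * P'" using * ** d by (simp add: mult_assoc_dim)
      also have "\<dots> = P * (\<alpha> g * P')" using * ** d g by (simp add: mult_assoc_dim)
      also have "\<dots> = (P * P') * \<beta> g" using * ** d g by (simp add: mult_assoc_dim)
      finally show ?thesis .
    qed
    then show ?thesis using 1 * ** by (intro exI[of _ k'] exI[of _ "P * P'"] exI[of _ "R' * R"] exI[of _ \<beta>]) auto
  qed
qed

lemma Irr_I: "irr_rep G d \<rho> \<Longrightarrow> (\<lambda>g\<in>carrier G. mtrace (\<rho> g)) \<in> Irr G"
  by (auto simp: Irr_def)

text \<open>Induction through restriction and quotient. The constituents form a list because they
  may repeat.\<close>

lemma character_decomposition: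
  assumes G: "group G" and "is_rep G d \<rho>"
  shows "\<exists>L. set L \<subseteq> Irr G \<and> (\<forall>g\<in>carrier G. mtrace (\<rho> g) = (\<Sum>\<chi>\<leftarrow>L. \<chi> g))"
  using assms(2)
proof (induction d arbitrary: \<rho> rule: less_induct)
  case (less d)
  consider "d = 0" | "irr_rep G d \<rho>" | "d > 0" "\<not> irr_rep G d \<rho>" by blast
  then show ?case
  proof cases
    case 1
    then have "mtrace (\<rho> g) = 0" if "g \<in> carrier G" for g
      using is_rep_dim[OF less.prems that] by (simp add: mtrace_def)
    then show ?thesis by (intro exI[of _ "[]"]) simp
  next
    case 2
    then show ?thesis by (intro exI[of _ "[\<lambda>g\<in>carrier G. mtrace (\<rho> g)]"]) (simp add: Irr_I)
  next
    case 3
    obtain k l \<alpha> \<gamma> where *: "k + l = d" "0 < k" "0 < l" "is_rep G k \<alpha>" "is_rep G l \<gamma>"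
      "\<And>g. g \<in> carrier G \<Longrightarrow> mtrace (\<rho> g) = mtrace (\<alpha> g) + mtrace (\<gamma> g)"
      using not_irr_rep_split[OF G less.prems 3] by metis
    obtain L1 where "set L1 \<subseteq> Irr G" "\<forall>g\<in>carrier G. mtrace (\<alpha> g) = (\<Sum>\<chi>\<leftarrow>L1. \<chi> g)"
      using less.IH[of k \<alpha>] * by auto
    moreover obtain L2 where "set L2 \<subseteq> Irr G" "\<forall>g\<in>carrier G. mtrace (\<gamma> g) = (\<Sum>\<chi>\<leftarrow>L2. \<chi> g)"
      using less.IH[of l \<gamma>] * by auto
    ultimately show ?thesis using * by (intro exI[of _ "L1 @ L2"]) auto
  qed
qed

text \<open>The kernel of \<open>T\<close> is invariant as soon as each
  \<open>T * \<alpha> g\<close> factors as some \<open>B * T\<close>. The matrices \<open>B\<close>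
  need not form a representation, so the lemma serves forms, where transposes appear, as well as
  Schur's lemma.\<close>

lemma irr_rep_intertwiner_inj:
  assumes irr: "irr_rep G d \<alpha>" and T: "T \<in> carrier_mat e d"
    and int: "\<And>g. g \<in> carrier G \<Longrightarrow> \<exists>B\<in>carrier_mat e e. T * \<alpha> g = B * T"
    and "T \<noteq> 0\<^sub>m e d" and v: "v \<in> carrier_vec d" "T *\<^sub>v v = 0\<^sub>v e"
  shows "v = 0\<^sub>v d"
proof -
  define W where "W = {v \<in> carrier_vec d. T *\<^sub>v v = 0\<^sub>v e}"
  have rep: "is_rep G d \<alpha>" using irr by (rule irr_rep_is_rep)
  have "invariant_subspace G d \<alpha> W" unfolding invariant_subspace_def
  proof (intro conjI ballI allI)
    fix g w assume g: "g \<in> carrier G" and w: "w \<in> W"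
    note \<alpha> = is_rep_carrier[OF rep g]
    obtain B where B: "B \<in> carrier_mat e e" "T * \<alpha> g = B * T" using int[OF g] by auto
    have wc: "w \<in> carrier_vec d" and w0: "T *\<^sub>v w = 0\<^sub>v e" using w by (auto simp: W_def)
    have "T *\<^sub>v (\<alpha> g *\<^sub>v w) = B *\<^sub>v (T *\<^sub>v w)"
      using assoc_mult_mat_vec[OF T \<alpha> wc] assoc_mult_mat_vec[OF B(1) T wc] B by simp
    then show "\<alpha> g *\<^sub>v w \<in> W" using w0 B \<alpha> wc by (auto simp: W_def)
  qed (use T in \<open>auto simp: W_def mult_add_distrib_mat_vec[of _ e d] mult_mat_vec[of _ e d]\<close>)
  then consider "W = {0\<^sub>v d}" | "W = carrier_vec d" using irr by (auto simp: irr_rep_def)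
  then show ?thesis
  proof cases
    case 1
    then show ?thesis using v by (auto simp: W_def)
  next
    case 2
    have "T = 0\<^sub>m e d"
    proof (rule mat_eq_by_vec[OF T])
      fix v :: "complex vec" assume v: "v \<in> carrier_vec d"
      then have "v \<in> W" by (simp add: 2)
      then show "T *\<^sub>v v = 0\<^sub>m e d *\<^sub>v v" using v by (simp add: W_def)
    qed simp
    then show ?thesis using assms by simp
  qed
qed

lemma schur_inverse:
  assumes \<alpha>: "irr_rep G d \<alpha>" and \<beta>: "irr_rep G e \<beta>" and T: "T \<in> carrier_mat e d"
    and int: "\<And>g. g \<in> carrier G \<Longrightarrow> T * \<alpha> g = \<beta> g * T" and "T \<noteq> 0\<^sub>m e d"
  shows "\<exists>R\<in>carrier_mat d e. T * R = 1\<^sub>m e \<and> R * T = 1\<^sub>m d"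
proof -
  note \<alpha>r = irr_rep_is_rep[OF \<alpha>] and \<beta>r = irr_rep_is_rep[OF \<beta>]
  have inj: "v = 0\<^sub>v d" if "v \<in> carrier_vec d" "T *\<^sub>v v = 0\<^sub>v e" for v
    using irr_rep_intertwiner_inj[OF \<alpha> T _ \<open>T \<noteq> 0\<^sub>m e d\<close> that] int is_rep_carrier[OF \<beta>r] by metis
  define W where "W = (\<lambda>v. T *\<^sub>v v) ` carrier_vec d"
  have "invariant_subspace G e \<beta> W" unfolding invariant_subspace_def
  proof (intro conjI ballI allI)
    show "W \<subseteq> carrier_vec e" using T by (auto simp: W_def)
    show "0\<^sub>v e \<in> W" unfolding W_def using T by (intro image_eqI[of _ _ "0\<^sub>v d"]) auto
  next
    fix v w assume "v \<in> W" "w \<in> W"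
    then obtain a b where "v = T *\<^sub>v a" "w = T *\<^sub>v b" "a \<in> carrier_vec d" "b \<in> carrier_vec d"
      by (auto simp: W_def)
    then show "v + w \<in> W" unfolding W_def
      using T by (intro image_eqI[of _ _ "a + b"]) (auto simp: mult_add_distrib_mat_vec[of _ e d])
  next
    fix c v assume "v \<in> W"
    then obtain a where "v = T *\<^sub>v a" "a \<in> carrier_vec d" by (auto simp: W_def)
    then show "c \<cdot>\<^sub>v v \<in> W" unfolding W_def
      using T by (intro image_eqI[of _ _ "c \<cdot>\<^sub>v a"]) (auto simp: mult_mat_vec[of _ e d])
  next
    fix g v assume g: "g \<in> carrier G" and "v \<in> W"
    then obtain a where a: "v = T *\<^sub>v a" "a \<in> carrier_vec d" by (auto simp: W_def)
    have "\<beta> g *\<^sub>v v = T *\<^sub>v (\<alpha> g *\<^sub>v a)"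
      using assoc_mult_mat_vec[OF T is_rep_carrier[OF \<alpha>r g] a(2)]
        assoc_mult_mat_vec[OF is_rep_carrier[OF \<beta>r g] T a(2)] int[OF g] a by simp
    then show "\<beta> g *\<^sub>v v \<in> W" unfolding W_def using a is_rep_carrier[OF \<alpha>r g] by auto
  qed
  moreover have "W \<noteq> {0\<^sub>v e}"
  proof
    assume W0: "W = {0\<^sub>v e}"
    have "T = 0\<^sub>m e d"
    proof (rule mat_eq_by_vec[OF T])
      fix v :: "complex vec" assume v: "v \<in> carrier_vec d"
      then have "T *\<^sub>v v \<in> W" by (auto simp: W_def)
      then show "T *\<^sub>v v = 0\<^sub>m e d *\<^sub>v v" using v by (simp add: W0)
    qed simp
    then show False using assms by simp
  qed
  ultimately have surj: "W = carrier_vec e" using \<beta> by (auto simp: irr_rep_def)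
  have "\<exists>a. a \<in> carrier_vec d \<and> T *\<^sub>v a = unit_vec e j" for j
  proof -
    have "unit_vec e j \<in> W" unfolding surj by simp
    then show ?thesis unfolding W_def by force
  qed
  then obtain a where a: "\<And>j. a j \<in> carrier_vec d" "\<And>j. T *\<^sub>v a j = unit_vec e j" by metis
  define R where "R = mat d e (\<lambda>(i, j). a j $ i)"
  have R: "R \<in> carrier_mat d e" by (simp add: R_def)
  have TR: "T * R = 1\<^sub>m e"
  proof (rule eq_matI_carrier[of _ e e])
    fix i j assume ij: "i < e" "j < e"
    have "(T * R) $$ (i, j) = (\<Sum>l<d. T $$ (i, l) * R $$ (l, j))" by (rule mult_mat_entry[OF T R ij])
    also have "\<dots> = (\<Sum>l<d. T $$ (i, l) * a j $ l)" using ij by (intro sum.cong) (auto simp: R_def)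
    also have "\<dots> = (T *\<^sub>v a j) $ i" by (rule mult_mat_vec_entry[OF T a(1) ij(1), symmetric])
    finally show "(T * R) $$ (i, j) = 1\<^sub>m e $$ (i, j)" using a ij by (simp add: unit_vec_def)
  qed (use T R in auto)
  moreover have "R * T = 1\<^sub>m d"
  proof (rule mat_eq_by_vec[of _ d d])
    fix v :: "complex vec" assume v: "v \<in> carrier_vec d"
    let ?u = "(R * T) *\<^sub>v v - v"
    have RTv: "(R * T) *\<^sub>v v \<in> carrier_vec d" using R T v by auto
    have "T *\<^sub>v ((R * T) *\<^sub>v v) = (T * (R * T)) *\<^sub>v v"
      using T R v by (subst assoc_mult_mat_vec[of _ e d _ d]) auto
    also have "T * (R * T) = T" using T R TR by (simp add: mult_assoc_dim[symmetric])
    finally have "T *\<^sub>v ?u = 0\<^sub>v e"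
      using T RTv v by (subst mult_minus_distrib_mat_vec[of _ e d]) auto
    then have u0: "?u = 0\<^sub>v d" using inj RTv v by auto
    show "(R * T) *\<^sub>v v = 1\<^sub>m d *\<^sub>v v"
    proof (rule eq_vecI)
      fix i assume "i < dim_vec (1\<^sub>m d *\<^sub>v v)"
      then have i: "i < d" by simp
      have "?u $ i = ((R * T) *\<^sub>v v) $ i - v $ i" using i v by (intro index_minus_vec) auto
      then show "((R * T) *\<^sub>v v) $ i = (1\<^sub>m d *\<^sub>v v) $ i" using u0 i v by simp
    qed (use R in auto)
  qed (use T R in auto)
  ultimately show ?thesis using R by blast
qed

text \<open>Subtracting an eigenvalue leaves an intertwiner with a nonzero kernel vector, which must
  therefore vanish.\<close>

lemma schur_scalar:
  assumes \<alpha>: "irr_rep G d \<alpha>" and T: "T \<in> carrier_mat d d"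
    and int: "\<And>g. g \<in> carrier G \<Longrightarrow> T * \<alpha> g = \<alpha> g * T"
  obtains c where "T = c \<cdot>\<^sub>m 1\<^sub>m d"
proof -
  note \<alpha>r = irr_rep_is_rep[OF \<alpha>]
  have d: "d > 0" using \<alpha> by (simp add: irr_rep_def)
  obtain c where "c \<in> spectrum T" using spectrum_non_empty[OF T d] by blast
  then obtain v where v: "v \<in> carrier_vec d" "v \<noteq> 0\<^sub>v d" "T *\<^sub>v v = c \<cdot>\<^sub>v v"
    using T by (auto simp: spectrum_def eigenvalue_def eigenvector_def)
  define U where "U = T - c \<cdot>\<^sub>m 1\<^sub>m d"
  have U: "U \<in> carrier_mat d d" unfolding U_def using T by (intro minus_carrier_mat) auto
  have Uv: "U *\<^sub>v v = 0\<^sub>v d"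
    unfolding U_def using T v by (subst minus_mult_distrib_mat_vec[of _ d d]) auto
  have "U = 0\<^sub>m d d"
  proof (rule ccontr)
    assume U0: "U \<noteq> 0\<^sub>m d d"
    have "\<exists>B\<in>carrier_mat d d. U * \<alpha> g = B * U" if g: "g \<in> carrier G" for g
    proof
      note c = is_rep_carrier[OF \<alpha>r g]
      show "U * \<alpha> g = \<alpha> g * U" unfolding U_def using T c int[OF g]
        by (simp add: minus_mult_distrib_mat[of _ d d] mult_minus_distrib_mat[of _ d d]
            mult_smult_distrib[OF c one_carrier_mat] mult_smult_assoc_mat[of _ d d])
      show "\<alpha> g \<in> carrier_mat d d" by (rule c)
    qed
    then have "v = 0\<^sub>v d" using irr_rep_intertwiner_inj[OF \<alpha> U _ U0 v(1) Uv] by blast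
    then show False using v by simp
  qed
  then have "T = c \<cdot>\<^sub>m 1\<^sub>m d"
  proof -
    assume U0: "U = 0\<^sub>m d d"
    show ?thesis
    proof (rule eq_matI_carrier[OF T])
      fix i j assume ij: "i < d" "j < d"
      have "U $$ (i, j) = T $$ (i, j) - (c \<cdot>\<^sub>m 1\<^sub>m d) $$ (i, j)" using ij by (simp add: U_def)
      then show "T $$ (i, j) = (c \<cdot>\<^sub>m 1\<^sub>m d) $$ (i, j)" using ij U0 by simp
    qed simp
  qed
  then show ?thesis using that by blast
qed

section \<open>Characters of finite groups\<close>

locale fin_group = group G for G (structure) +
  assumes finite_carrier: "finite (carrier G)"
begin

lemma card_carrier_nz: "(of_nat (card (carrier G)) :: complex) \<noteq> 0"
  using finite_carrier one_closed by (simp add: card_eq_0_iff) blast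

lemma bij_betw_mult_left: "g \<in> carrier G \<Longrightarrow> bij_betw (\<lambda>x. g \<otimes> x) (carrier G) (carrier G)"
  by (intro bij_betw_byWitness[where f' = "\<lambda>x. inv g \<otimes> x"]) (auto simp: m_assoc[symmetric])

lemma bij_betw_mult_right: "g \<in> carrier G \<Longrightarrow> bij_betw (\<lambda>x. x \<otimes> g) (carrier G) (carrier G)"
  by (intro bij_betw_byWitness[where f' = "\<lambda>x. x \<otimes> inv g"]) (auto simp: m_assoc)

lemma bij_betw_inv: "bij_betw (\<lambda>x. inv x) (carrier G) (carrier G)"
  by (intro bij_betw_byWitness[where f' = "\<lambda>x. inv x"]) auto

lemma bij_betw_conj:
  "g \<in> carrier G \<Longrightarrow> bij_betw (\<lambda>x. g \<otimes> x \<otimes> inv g) (carrier G) (carrier G)"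
  using bij_betw_trans[OF bij_betw_mult_left[of g] bij_betw_mult_right[of "inv g"]] by (simp add: comp_def)

lemma mtrace_conj:
  assumes rep: "is_rep G d \<rho>" and g: "g \<in> carrier G" and h: "h \<in> carrier G"
  shows "mtrace (\<rho> (h \<otimes> g \<otimes> inv h)) = mtrace (\<rho> g)"
proof -
  have "mtrace (\<rho> (h \<otimes> g \<otimes> inv h)) = mtrace ((\<rho> h * \<rho> g) * \<rho> (inv h))"
    using g h by (simp add: is_rep_mult[OF rep])
  also have "\<dots> = mtrace (\<rho> (inv h) * (\<rho> h * \<rho> g))"
    using g h by (intro mtrace_mult_comm[of _ d d] carrier_matI) (simp_all add: is_rep_dim[OF rep])
  also have "\<rho> (inv h) * (\<rho> h * \<rho> g) = \<rho> (inv h \<otimes> (h \<otimes> g))"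
    using g h by (simp add: is_rep_mult[OF rep])
  finally show ?thesis using g h by (simp add: m_assoc[symmetric])
qed

section \<open>Averaging over the group and orthogonality\<close>

lemma averaging_intertwines:
  assumes \<alpha>: "is_rep G d \<alpha>" and \<beta>: "is_rep G e \<beta>" and X: "X \<in> carrier_mat d e" and g: "g \<in> carrier G"
  defines "Y \<equiv> msum d e (\<lambda>x. \<alpha> x * X * \<beta> (inv x)) (carrier G)"
  shows "\<alpha> g * Y = Y * \<beta> g"
proof -
  note ac = is_rep_carrier[OF \<alpha>] and bc = is_rep_carrier[OF \<beta>]
  note dims = is_rep_dim[OF \<alpha>] is_rep_dim[OF \<beta>] X[THEN carrier_matD(1)] X[THEN carrier_matD(2)]
  have c: "\<alpha> x * X * \<beta> (inv x) \<in> carrier_mat d e" if "x \<in> carrier G" for x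
    using that ac X bc by (meson inv_closed mult_carrier_mat)
  have "\<alpha> g * Y = msum d e (\<lambda>x. \<alpha> g * (\<alpha> x * X * \<beta> (inv x))) (carrier G)"
    unfolding Y_def using c by (intro mult_msum[OF ac[OF g]]) auto
  also have "\<dots> = msum d e (\<lambda>x. \<alpha> (g \<otimes> x) * X * \<beta> (inv (g \<otimes> x)) * \<beta> g) (carrier G)"
  proof (rule msum_cong)
    fix x assume x: "x \<in> carrier G"
    have "\<beta> (inv x) = \<beta> (inv (g \<otimes> x)) * \<beta> g"
      using g x by (simp add: is_rep_mult[OF \<beta>, symmetric] inv_mult_group m_assoc)
    then show "\<alpha> g * (\<alpha> x * X * \<beta> (inv x)) = \<alpha> (g \<otimes> x) * X * \<beta> (inv (g \<otimes> x)) * \<beta> g"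
      using g x by (simp add: is_rep_mult[OF \<alpha>] mult_assoc_dim dims)
  qed
  also have "\<dots> = msum d e (\<lambda>x. \<alpha> x * X * \<beta> (inv x) * \<beta> g) (carrier G)"
    by (rule msum_reindex_bij[OF bij_betw_mult_left[OF g], symmetric])
  also have "\<dots> = Y * \<beta> g"
    unfolding Y_def using c by (intro msum_mult[OF bc[OF g], symmetric]) auto
  finally show ?thesis .
qed

text \<open>The sum of the conjugates of a matrix unit commutes with \<open>\<rho>\<close>, hence is
  a scalar matrix; its trace is \<open>card (carrier G)\<close> times that of the matrix unit and
  determines the scalar.\<close>

lemma coefficient_orthogonality:
  assumes \<rho>: "irr_rep G d \<rho>" and ijkl: "i < d" "j < d" "k < d" "l < d"
  shows "(\<Sum>x\<in>carrier G. \<rho> x $$ (i, j) * \<rho> (inv x) $$ (k, l)) =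
    (if i = l \<and> j = k then of_nat (card (carrier G)) / of_nat d else 0)"
proof -
  note rep = irr_rep_is_rep[OF \<rho>]
  have d: "(of_nat d :: complex) \<noteq> 0" using \<rho> by (simp add: irr_rep_def)
  let ?X = "mat d d (\<lambda>(a, b). if a = j \<and> b = k then 1 else 0 :: complex)"
  have X: "?X \<in> carrier_mat d d" by simp
  define Y where "Y = msum d d (\<lambda>x. \<rho> x * ?X * \<rho> (inv x)) (carrier G)"
  have Y: "Y \<in> carrier_mat d d" by (simp add: Y_def)
  have "Y * \<rho> g = \<rho> g * Y" if "g \<in> carrier G" for g
    using averaging_intertwines[OF rep rep X that] by (simp add: Y_def)
  then obtain c where c: "Y = c \<cdot>\<^sub>m 1\<^sub>m d" using schur_scalar[OF \<rho> Y] by blast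
  have Yc: "\<rho> x * ?X * \<rho> (inv x) \<in> carrier_mat d d" if "x \<in> carrier G" for x
    using that X is_rep_carrier[OF rep] by (meson inv_closed mult_carrier_mat)
  have "c * of_nat d = mtrace Y" unfolding c by (simp add: mtrace_smult[of _ d])
  also have "\<dots> = (\<Sum>x\<in>carrier G. mtrace (\<rho> x * ?X * \<rho> (inv x)))"
    unfolding Y_def using Yc by (rule mtrace_msum)
  also have "\<dots> = (\<Sum>x\<in>carrier G. mtrace ?X)"
  proof (rule sum.cong[OF refl])
    fix x assume x: "x \<in> carrier G"
    have "mtrace (\<rho> x * ?X * \<rho> (inv x)) = mtrace (\<rho> (inv x) * (\<rho> x * ?X))"
      using x by (intro mtrace_mult_comm[of _ d d] carrier_matI) (simp_all add: is_rep_dim[OF rep])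
    also have "\<rho> (inv x) * (\<rho> x * ?X) = (\<rho> (inv x) * \<rho> x) * ?X"
      using x by (simp add: mult_assoc_dim is_rep_dim[OF rep])
    also have "\<rho> (inv x) * \<rho> x = 1\<^sub>m d"
      using x by (simp add: is_rep_mult[OF rep, symmetric] is_rep_one[OF rep])
    finally show "mtrace (\<rho> x * ?X * \<rho> (inv x)) = mtrace ?X" by (simp add: left_mult_one_mat[OF X])
  qed
  also have "mtrace ?X = (\<Sum>a<d. if a = j then (if j = k then 1 else 0) else 0)"
    unfolding mtrace_carrier[OF X] by (intro sum.cong) auto
  also have "\<dots> = (if j = k then 1 else 0)" using ijkl by simp
  finally have c': "c = (if j = k then of_nat (card (carrier G)) / of_nat d else 0)"
    using d by (auto simp: field_simps split: if_splits)
  have "(\<Sum>x\<in>carrier G. \<rho> x $$ (i, j) * \<rho> (inv x) $$ (k, l)) = Y $$ (i, l)"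
    using ijkl unfolding Y_def
    by (simp add: elementary_sandwich[OF is_rep_carrier[OF rep] is_rep_carrier[OF rep]] del: index_mult_mat(1))
  also have "\<dots> = (if i = l then c else 0)" unfolding c using ijkl by simp
  finally show ?thesis unfolding c' by simp
qed

lemma mtrace_orthogonality_eq:
  assumes \<rho>: "irr_rep G d \<rho>"
  shows "(\<Sum>x\<in>carrier G. mtrace (\<rho> x) * mtrace (\<rho> (inv x))) = of_nat (card (carrier G))"
proof -
  note rep = irr_rep_is_rep[OF \<rho>]
  have d: "(of_nat d :: complex) \<noteq> 0" using \<rho> by (simp add: irr_rep_def)
  have "(\<Sum>x\<in>carrier G. mtrace (\<rho> x) * mtrace (\<rho> (inv x))) =
      (\<Sum>x\<in>carrier G. \<Sum>i<d. \<Sum>k<d. \<rho> x $$ (i, i) * \<rho> (inv x) $$ (k, k))"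
    by (intro sum.cong refl)
      (simp add: mtrace_carrier[OF is_rep_carrier[OF rep]] sum_product)
  also have "\<dots> = (\<Sum>i<d. \<Sum>x\<in>carrier G. \<Sum>k<d. \<rho> x $$ (i, i) * \<rho> (inv x) $$ (k, k))"
    by (rule sum.swap)
  also have "\<dots> = (\<Sum>i<d. \<Sum>k<d. \<Sum>x\<in>carrier G. \<rho> x $$ (i, i) * \<rho> (inv x) $$ (k, k))"
    by (intro sum.cong refl sum.swap)
  also have "\<dots> = (\<Sum>i<d. \<Sum>k<d. if i = k then of_nat (card (carrier G)) / of_nat d else 0)"
    by (intro sum.cong refl) (simp add: coefficient_orthogonality[OF \<rho>])
  also have "\<dots> = of_nat (card (carrier G))" using d by simp
  finally show ?thesis .
qed

text \<open>Distinct traces stand in for non-isomorphism: a nonzero average of a matrix unit would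
  be an invertible intertwiner and force equal traces. So already the matrix coefficients are
  orthogonal.\<close>

lemma mtrace_orthogonality_neq:
  assumes \<alpha>: "irr_rep G d \<alpha>" and \<beta>: "irr_rep G e \<beta>"
    and neq: "g0 \<in> carrier G" "mtrace (\<alpha> g0) \<noteq> mtrace (\<beta> g0)"
  shows "(\<Sum>x\<in>carrier G. mtrace (\<alpha> x) * mtrace (\<beta> (inv x))) = 0"
proof -
  note ar = irr_rep_is_rep[OF \<alpha>] and br = irr_rep_is_rep[OF \<beta>]
  have zero: "(\<Sum>x\<in>carrier G. \<alpha> x $$ (i, j) * \<beta> (inv x) $$ (k, l)) = 0"
    if ijkl: "i < d" "j < d" "k < e" "l < e" for i j k l
  proof -
    let ?X = "mat d e (\<lambda>(a, b). if a = j \<and> b = k then 1 else 0 :: complex)"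
    have X: "?X \<in> carrier_mat d e" by simp
    define Y where "Y = msum d e (\<lambda>x. \<alpha> x * ?X * \<beta> (inv x)) (carrier G)"
    have Y: "Y \<in> carrier_mat d e" by (simp add: Y_def)
    have int: "Y * \<beta> g = \<alpha> g * Y" if "g \<in> carrier G" for g
      using averaging_intertwines[OF ar br X that] by (simp add: Y_def)
    have "Y = 0\<^sub>m d e"
    proof (rule ccontr)
      assume "Y \<noteq> 0\<^sub>m d e"
      then obtain R where R: "R \<in> carrier_mat e d" "Y * R = 1\<^sub>m d" "R * Y = 1\<^sub>m e"
        using schur_inverse[OF \<beta> \<alpha> Y int] by blast
      note dims = is_rep_dim[OF ar neq(1)] is_rep_dim[OF br neq(1)] Y[THEN carrier_matD(1)]
        Y[THEN carrier_matD(2)] R(1)[THEN carrier_matD(1)] R(1)[THEN carrier_matD(2)]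
      have "mtrace (\<alpha> g0) = mtrace (\<alpha> g0 * (Y * R))" using R is_rep_carrier[OF ar neq(1)] by simp
      also have "\<alpha> g0 * (Y * R) = Y * (\<beta> g0 * R)"
        using int[OF neq(1)] dims by (metis mult_assoc_dim)
      also have "mtrace \<dots> = mtrace (\<beta> g0 * R * Y)"
        using dims by (intro mtrace_mult_comm[of _ d e] carrier_matI) simp_all
      also have "\<beta> g0 * R * Y = \<beta> g0 * (R * Y)" using dims by (simp add: mult_assoc_dim)
      also have "\<dots> = \<beta> g0" using R is_rep_carrier[OF br neq(1)] by simp
      finally show False using neq by simp
    qed
    then have "Y $$ (i, l) = 0" using ijkl by simp
    then show ?thesis using ijkl unfolding Y_def
      by (simp add: elementary_sandwich[OF is_rep_carrier[OF ar] is_rep_carrier[OF br]] del: index_mult_mat(1))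
  qed
  have "(\<Sum>x\<in>carrier G. mtrace (\<alpha> x) * mtrace (\<beta> (inv x))) =
      (\<Sum>x\<in>carrier G. \<Sum>i<d. \<Sum>k<e. \<alpha> x $$ (i, i) * \<beta> (inv x) $$ (k, k))"
    by (intro sum.cong refl)
      (simp add: mtrace_carrier[OF is_rep_carrier[OF ar]] mtrace_carrier[OF is_rep_carrier[OF br]] sum_product)
  also have "\<dots> = (\<Sum>i<d. \<Sum>x\<in>carrier G. \<Sum>k<e. \<alpha> x $$ (i, i) * \<beta> (inv x) $$ (k, k))"
    by (rule sum.swap)
  also have "\<dots> = (\<Sum>i<d. \<Sum>k<e. \<Sum>x\<in>carrier G. \<alpha> x $$ (i, i) * \<beta> (inv x) $$ (k, k))"
    by (intro sum.cong refl sum.swap)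
  also have "\<dots> = 0" by (simp add: zero)
  finally show ?thesis .
qed

lemma IrrE:
  assumes "\<chi> \<in> Irr G"
  obtains d \<rho> where "irr_rep G d \<rho>" "\<And>g. g \<in> carrier G \<Longrightarrow> \<chi> g = mtrace (\<rho> g)"
    "\<chi> = (\<lambda>g\<in>carrier G. mtrace (\<rho> g))"
  using assms by (force simp: Irr_def)

lemma Irr_orthogonality:
  assumes "\<chi> \<in> Irr G" "\<psi> \<in> Irr G"
  shows "(\<Sum>x\<in>carrier G. \<chi> x * \<psi> (inv x)) = (if \<chi> = \<psi> then of_nat (card (carrier G)) else 0)"
proof -
  obtain d \<alpha> where \<alpha>: "irr_rep G d \<alpha>" "\<And>g. g \<in> carrier G \<Longrightarrow> \<chi> g = mtrace (\<alpha> g)"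
    "\<chi> = (\<lambda>g\<in>carrier G. mtrace (\<alpha> g))" by (rule IrrE[OF assms(1)]) blast
  obtain e \<beta> where \<beta>: "irr_rep G e \<beta>" "\<And>g. g \<in> carrier G \<Longrightarrow> \<psi> g = mtrace (\<beta> g)"
    "\<psi> = (\<lambda>g\<in>carrier G. mtrace (\<beta> g))" by (rule IrrE[OF assms(2)]) blast
  show ?thesis
  proof (cases "\<chi> = \<psi>")
    case True
    have "(\<Sum>x\<in>carrier G. \<chi> x * \<psi> (inv x)) = (\<Sum>x\<in>carrier G. mtrace (\<alpha> x) * mtrace (\<alpha> (inv x)))"
      using True \<alpha> by (intro sum.cong) auto
    then show ?thesis using True mtrace_orthogonality_eq[OF \<alpha>(1)] by simp
  next
    case False
    then obtain g where g: "g \<in> carrier G" "mtrace (\<alpha> g) \<noteq> mtrace (\<beta> g)"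
      using \<alpha>(3) \<beta>(3) by (metis (no_types, lifting) restrict_ext)
    have "(\<Sum>x\<in>carrier G. \<chi> x * \<psi> (inv x)) = (\<Sum>x\<in>carrier G. mtrace (\<alpha> x) * mtrace (\<beta> (inv x)))"
      using \<alpha> \<beta> by (intro sum.cong) auto
    then show ?thesis using False mtrace_orthogonality_neq[OF \<alpha>(1) \<beta>(1) g] by simp
  qed
qed

section \<open>The regular character and completeness of the irreducible characters\<close>

lemma regular_rep:
  obtains \<rho> where "is_rep G (card (carrier G)) \<rho>"
    "\<And>g. g \<in> carrier G \<Longrightarrow> mtrace (\<rho> g) = (if g = \<one> then of_nat (card (carrier G)) else 0)"
proof -
  define N where "N = card (carrier G)"
  obtain e where e: "bij_betw e {..<N} (carrier G)"
    using ex_bij_betw_nat_finite[OF finite_carrier] by (auto simp: N_def lessThan_atLeast0)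
  have eG: "e i \<in> carrier G" if "i < N" for i using e that by (auto dest: bij_betwE)
  have einj: "e i = e j \<longleftrightarrow> i = j" if "i < N" "j < N" for i j
    using e that by (auto simp: bij_betw_def inj_on_def)
  define \<rho> where "\<rho> = (\<lambda>g. mat N N (\<lambda>(i, j). if e i = g \<otimes> e j then 1 else 0 :: complex))"
  have "is_rep G N \<rho>" unfolding is_rep_def
  proof (intro conjI ballI)
    fix g h assume gh: "g \<in> carrier G" "h \<in> carrier G"
    show "\<rho> (g \<otimes> h) = \<rho> g * \<rho> h"
    proof (rule eq_matI_carrier[of _ N N])
      fix i j assume ij: "i < N" "j < N"
      have "h \<otimes> e j \<in> e ` {..<N}" using e gh eG[OF ij(2)] by (simp add: bij_betw_def)
      then obtain m where m: "m < N" "e m = h \<otimes> e j" by auto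
      have "(\<rho> g * \<rho> h) $$ (i, j) = (\<Sum>l<N. \<rho> g $$ (i, l) * \<rho> h $$ (l, j))"
        by (rule mult_mat_entry[of _ N N]) (auto simp: \<rho>_def ij)
      also have "\<dots> = (\<Sum>l<N. if l = m then \<rho> g $$ (i, m) else 0)"
        using ij m by (intro sum.cong) (auto simp: \<rho>_def einj m(2)[symmetric])
      also have "\<dots> = \<rho> g $$ (i, m)" using m by simp
      also have "\<dots> = \<rho> (g \<otimes> h) $$ (i, j)" using ij m gh eG by (simp add: \<rho>_def m_assoc)
      finally show "\<rho> (g \<otimes> h) $$ (i, j) = (\<rho> g * \<rho> h) $$ (i, j)" by simp
    qed (auto simp: \<rho>_def)
  next
    show "\<rho> \<one> = 1\<^sub>m N" by (intro eq_matI) (auto simp: \<rho>_def eG einj)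
  qed (simp add: \<rho>_def)
  moreover have "mtrace (\<rho> g) = (if g = \<one> then of_nat N else 0)" if g: "g \<in> carrier G" for g
  proof -
    have "mtrace (\<rho> g) = (\<Sum>i<N. if g = \<one> then 1 else 0)"
      unfolding mtrace_def using g eG by (intro sum.cong) (auto simp: \<rho>_def)
    then show ?thesis by simp
  qed
  ultimately show ?thesis using that unfolding N_def by blast
qed

lemma regular_character:
  obtains L where "set L \<subseteq> Irr G"
    "\<And>g. g \<in> carrier G \<Longrightarrow> (\<Sum>\<chi>\<leftarrow>L. \<chi> g) = (if g = \<one> then of_nat (card (carrier G)) else 0)"
proof -
  obtain \<rho> where \<rho>: "is_rep G (card (carrier G)) \<rho>"
    "\<And>g. g \<in> carrier G \<Longrightarrow> mtrace (\<rho> g) = (if g = \<one> then of_nat (card (carrier G)) else 0)"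
    by (rule regular_rep) blast
  show ?thesis using character_decomposition[OF is_group \<rho>(1)] \<rho>(2) that by metis
qed

lemma Irr_one_nz: "\<chi> \<in> Irr G \<Longrightarrow> \<chi> \<one> \<noteq> 0"
  by (auto simp: Irr_def irr_rep_def is_rep_one)

text \<open>Every irreducible character occurs in the regular one: pairing the regular character
  with \<open>\<psi>\<close> gives \<open>card (carrier G)\<close> times the degree, which is
  nonzero, whereas a \<open>\<psi>\<close> missing from \<open>L\<close> is orthogonal to all of
  \<open>L\<close>.\<close>

lemma finite_Irr: "finite (Irr G)"
proof -
  obtain L where L: "set L \<subseteq> Irr G"
    "\<And>g. g \<in> carrier G \<Longrightarrow> (\<Sum>\<chi>\<leftarrow>L. \<chi> g) = (if g = \<one> then of_nat (card (carrier G)) else 0)"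
    by (rule regular_character) blast
  have "\<psi> \<in> set L" if \<psi>: "\<psi> \<in> Irr G" for \<psi>
  proof (rule ccontr)
    assume n: "\<psi> \<notin> set L"
    have "(\<Sum>x\<in>carrier G. (\<Sum>\<chi>\<leftarrow>L. \<chi> x) * \<psi> (inv x)) =
        (\<Sum>x\<in>carrier G. if x = \<one> then of_nat (card (carrier G)) * \<psi> \<one> else 0)"
      by (intro sum.cong) (auto simp: L)
    also have "\<dots> \<noteq> 0" using finite_carrier card_carrier_nz Irr_one_nz[OF \<psi>] by simp
    also have "(\<Sum>x\<in>carrier G. (\<Sum>\<chi>\<leftarrow>L. \<chi> x) * \<psi> (inv x)) =
        (\<Sum>\<chi>\<leftarrow>L. \<Sum>x\<in>carrier G. \<chi> x * \<psi> (inv x))"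
      by (simp add: sum_list_mult_const[symmetric] sum_sum_list)
    also have "\<dots> = (\<Sum>\<chi>\<leftarrow>L. 0)"
      using L(1) n \<psi> by (intro arg_cong[where f = sum_list] map_cong) (auto simp: Irr_orthogonality)
    finally show False by simp
  qed
  then show ?thesis by (meson finite_set finite_subset subsetI)
qed

text \<open>The central element of the group algebra with coefficients \<open>u\<close> acts on an
  irreducible representation as a scalar whose trace is the pairing with the character, hence as 0.
  Summing over the constituents of the regular character, which vanishes off the identity, isolates
  \<open>u h\<close>.\<close>

lemma class_function_eq_zero:
  fixes u :: "'a \<Rightarrow> complex"
  assumes cls: "\<And>g h. g \<in> carrier G \<Longrightarrow> h \<in> carrier G \<Longrightarrow> u (h \<otimes> g \<otimes> inv h) = u g"
    and orth: "\<And>\<chi>. \<chi> \<in> Irr G \<Longrightarrow> (\<Sum>x\<in>carrier G. u x * \<chi> (inv x)) = 0"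
    and h: "h \<in> carrier G"
  shows "u h = 0"
proof -
  obtain L where L: "set L \<subseteq> Irr G"
    "\<And>g. g \<in> carrier G \<Longrightarrow> (\<Sum>\<chi>\<leftarrow>L. \<chi> g) = (if g = \<one> then of_nat (card (carrier G)) else 0)"
    by (rule regular_character) blast
  have vanish: "(\<Sum>x\<in>carrier G. u x * \<chi> (inv x \<otimes> h)) = 0" if \<chi>: "\<chi> \<in> Irr G" for \<chi>
  proof -
    obtain d \<rho> where \<rho>: "irr_rep G d \<rho>" "\<And>g. g \<in> carrier G \<Longrightarrow> \<chi> g = mtrace (\<rho> g)"
      using IrrE[OF \<chi>] by metis
    note rep = irr_rep_is_rep[OF \<rho>(1)]
    note rc = is_rep_carrier[OF rep]
    have d: "(of_nat d :: complex) \<noteq> 0" using \<rho> by (simp add: irr_rep_def)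
    define M where "M = msum d d (\<lambda>x. u x \<cdot>\<^sub>m \<rho> (inv x)) (carrier G)"
    have M: "M \<in> carrier_mat d d" by (simp add: M_def)
    have "M * \<rho> g = \<rho> g * M" if g: "g \<in> carrier G" for g
    proof -
      have "M * \<rho> g = msum d d (\<lambda>x. (u x \<cdot>\<^sub>m \<rho> (inv x)) * \<rho> g) (carrier G)"
        unfolding M_def using rc by (intro msum_mult[OF rc[OF g]]) auto
      also have "\<dots> = msum d d (\<lambda>x. (u (g \<otimes> x \<otimes> inv g) \<cdot>\<^sub>m \<rho> (inv (g \<otimes> x \<otimes> inv g))) * \<rho> g) (carrier G)"
        by (rule msum_reindex_bij[OF bij_betw_conj[OF g]])
      also have "\<dots> = msum d d (\<lambda>x. \<rho> g * (u x \<cdot>\<^sub>m \<rho> (inv x))) (carrier G)"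
      proof (rule msum_cong)
        fix x assume x: "x \<in> carrier G"
        have "\<rho> (inv (g \<otimes> x \<otimes> inv g)) * \<rho> g = \<rho> g * \<rho> (inv x)"
          using g x by (simp add: is_rep_mult[OF rep, symmetric] inv_mult_group m_assoc)
        then show "(u (g \<otimes> x \<otimes> inv g) \<cdot>\<^sub>m \<rho> (inv (g \<otimes> x \<otimes> inv g))) * \<rho> g = \<rho> g * (u x \<cdot>\<^sub>m \<rho> (inv x))"
          using g x by (simp add: cls mult_smult_assoc_mat[OF rc rc] mult_smult_distrib[OF rc rc])
      qed
      also have "\<dots> = \<rho> g * M"
        unfolding M_def using rc by (intro mult_msum[OF rc[OF g], symmetric]) auto
      finally show ?thesis .
    qed
    then obtain c where c: "M = c \<cdot>\<^sub>m 1\<^sub>m d" using schur_scalar[OF \<rho>(1) M] by blast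
    have "c * of_nat d = mtrace M" unfolding c by (simp add: mtrace_smult[of _ d])
    also have "\<dots> = (\<Sum>x\<in>carrier G. mtrace (u x \<cdot>\<^sub>m \<rho> (inv x)))"
      unfolding M_def using rc by (intro mtrace_msum) auto
    also have "\<dots> = (\<Sum>x\<in>carrier G. u x * \<chi> (inv x))"
      by (intro sum.cong refl) (simp add: mtrace_smult[OF rc] \<rho>)
    also have "\<dots> = 0" by (rule orth[OF \<chi>])
    finally have c0: "c = 0" using d by simp
    have "(\<Sum>x\<in>carrier G. u x * \<chi> (inv x \<otimes> h)) = (\<Sum>x\<in>carrier G. mtrace ((u x \<cdot>\<^sub>m \<rho> (inv x)) * \<rho> h))"
      using h by (intro sum.cong refl)
        (simp add: \<rho> is_rep_mult[OF rep] mult_smult_assoc_mat[OF rc rc] mtrace_smult[OF mult_carrier_mat[OF rc rc]])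
    also have "\<dots> = mtrace (msum d d (\<lambda>x. (u x \<cdot>\<^sub>m \<rho> (inv x)) * \<rho> h) (carrier G))"
      using rc h by (intro mtrace_msum[symmetric]) (meson inv_closed mult_carrier_mat smult_carrier_mat)
    also have "\<dots> = mtrace (M * \<rho> h)"
      unfolding M_def using rc by (subst msum_mult[OF rc[OF h]]) auto
    also have "M * \<rho> h = 0 \<cdot>\<^sub>m (1\<^sub>m d * \<rho> h)" unfolding c c0 by (rule mult_smult_assoc_mat[OF one_carrier_mat rc[OF h]])
    also have "mtrace \<dots> = 0" using rc[OF h] by (simp add: mtrace_smult[of _ d])
    finally show ?thesis .
  qed
  have "of_nat (card (carrier G)) * u h = (\<Sum>x\<in>carrier G. if x = h then of_nat (card (carrier G)) * u h else 0)"
    using h finite_carrier by simp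
  also have "\<dots> = (\<Sum>x\<in>carrier G. u x * (\<Sum>\<chi>\<leftarrow>L. \<chi> (inv x \<otimes> h)))"
  proof (rule sum.cong[OF refl])
    fix x assume x: "x \<in> carrier G"
    have "inv x \<otimes> h = \<one> \<longleftrightarrow> x = h" using x h
      by (metis inv_closed inv_inv l_inv r_inv inv_equality inv_unique')
    then show "(if x = h then of_nat (card (carrier G)) * u h else 0) = u x * (\<Sum>\<chi>\<leftarrow>L. \<chi> (inv x \<otimes> h))"
      using x h L(2)[of "inv x \<otimes> h"] by auto
  qed
  also have "\<dots> = (\<Sum>\<chi>\<leftarrow>L. \<Sum>x\<in>carrier G. u x * \<chi> (inv x \<otimes> h))"
    by (simp add: sum_list_const_mult[symmetric] sum_sum_list)
  also have "\<dots> = (\<Sum>\<chi>\<leftarrow>L. 0)"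
    using L(1) vanish by (intro arg_cong[where f = sum_list] map_cong) auto
  finally show ?thesis using card_carrier_nz by simp
qed

lemma Irr_conj:
  assumes "\<chi> \<in> Irr G" "g \<in> carrier G" "h \<in> carrier G"
  shows "\<chi> (h \<otimes> g \<otimes> inv h) = \<chi> g"
proof -
  obtain d \<rho> where \<rho>: "irr_rep G d \<rho>" "\<And>g. g \<in> carrier G \<Longrightarrow> \<chi> g = mtrace (\<rho> g)"
    using IrrE[OF assms(1)] by metis
  then show ?thesis using mtrace_conj[OF irr_rep_is_rep[OF \<rho>(1)]] assms by simp
qed

end

section \<open>Twisted Frobenius-Schur indicators\<close>

text \<open>The relation says that \<open>\<rho> (\<phi> x)\<close> is the adjoint of
  \<open>\<rho> x\<close> for the bilinear form with Gram matrix \<open>S\<close>. Only the sign is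
  recorded; a nonzero \<open>S\<close> is supplied separately by
  \<open>exists_nonzero_form\<close>.\<close>

definition symmetric_forms :: "('a, 'b) monoid_scheme \<Rightarrow> ('a \<Rightarrow> 'a) \<Rightarrow> bool" where
  "symmetric_forms G \<phi> \<longleftrightarrow> (\<forall>d \<rho> S. irr_rep G d \<rho> \<longrightarrow> S \<in> carrier_mat d d \<longrightarrow>
     (\<forall>x\<in>carrier G. S * \<rho> (\<phi> x) = transpose_mat (\<rho> x) * S) \<longrightarrow> transpose_mat S = S)"

text \<open>With only the identity acting, the line through the first unit vector is invariant, so
  the degree is 1 and \<open>S\<close> has a single entry.\<close>

lemma symmetric_forms_trivial:
  assumes "carrier G = {\<one>\<^bsub>G\<^esub>}"
  shows "symmetric_forms G \<phi>"
  unfolding symmetric_forms_def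
proof (intro allI impI)
  fix d \<rho> S assume irr: "irr_rep G d \<rho>" and S: "S \<in> carrier_mat d d"
  define W where "W = {v \<in> carrier_vec d. \<forall>i. 0 < i \<longrightarrow> i < d \<longrightarrow> v $ i = (0::complex)}"
  have d: "d > 0" using irr by (simp add: irr_rep_def)
  have "invariant_subspace G d \<rho> W"
    using irr assms by (auto simp: invariant_subspace_def W_def irr_rep_def is_rep_one)
  moreover have "unit_vec d 0 \<in> W" "unit_vec d 0 \<noteq> (0\<^sub>v d :: complex vec)"
    using d by (auto simp: W_def unit_vec_def dest: arg_cong[where f = "\<lambda>v. v $ 0"])
  ultimately have "W = carrier_vec d" using irr by (auto simp: irr_rep_def)
  then have "unit_vec d 1 \<in> W" by simp
  then have "\<not> 1 < d" by (auto simp: W_def unit_vec_def)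
  with d have "d = 1" by simp
  then show "transpose_mat S = S" using S by (intro eq_matI) auto
qed

context fin_group
begin

text \<open>Fourier inversion on one irreducible representation: an arbitrary operator is the image
  of an explicit group algebra element, whose coefficients can then be compared under
  \<open>\<phi>\<close>.\<close>

lemma irr_rep_span:
  assumes \<rho>: "irr_rep G d \<rho>" and T: "T \<in> carrier_mat d d"
  shows "msum d d (\<lambda>x. mtrace (T * \<rho> (inv x)) \<cdot>\<^sub>m \<rho> x) (carrier G) =
    (of_nat (card (carrier G)) / of_nat d) \<cdot>\<^sub>m T"
proof (rule eq_matI_carrier[of _ d d])
  note rep = irr_rep_is_rep[OF \<rho>]
  note rc = is_rep_carrier[OF rep]
  fix i j assume ij: "i < d" "j < d"
  let ?N = "of_nat (card (carrier G)) / of_nat d :: complex"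
  have tr: "mtrace (T * \<rho> (inv x)) = (\<Sum>l<d. \<Sum>k<d. T $$ (l, k) * \<rho> (inv x) $$ (k, l))"
    if x: "x \<in> carrier G" for x
    using x rc[of "inv x"] T by (simp add: mtrace_carrier[of _ d] mult_mat_entry[OF T rc] del: index_mult_mat(1))
  have "msum d d (\<lambda>x. mtrace (T * \<rho> (inv x)) \<cdot>\<^sub>m \<rho> x) (carrier G) $$ (i, j) =
      (\<Sum>x\<in>carrier G. mtrace (T * \<rho> (inv x)) * \<rho> x $$ (i, j))"
    using ij by (simp add: is_rep_dim[OF rep])
  also have "\<dots> = (\<Sum>x\<in>carrier G. \<Sum>l<d. \<Sum>k<d. T $$ (l, k) * (\<rho> x $$ (i, j) * \<rho> (inv x) $$ (k, l)))"
    by (intro sum.cong refl) (simp add: tr sum_distrib_left sum_distrib_right mult_ac)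
  also have "\<dots> = (\<Sum>l<d. \<Sum>x\<in>carrier G. \<Sum>k<d. T $$ (l, k) * (\<rho> x $$ (i, j) * \<rho> (inv x) $$ (k, l)))"
    by (rule sum.swap)
  also have "\<dots> = (\<Sum>l<d. \<Sum>k<d. \<Sum>x\<in>carrier G. T $$ (l, k) * (\<rho> x $$ (i, j) * \<rho> (inv x) $$ (k, l)))"
    by (intro sum.cong refl sum.swap)
  also have "\<dots> = (\<Sum>l<d. \<Sum>k<d. if l = i then (if k = j then T $$ (i, j) * ?N else 0) else 0)"
    using ij by (intro sum.cong refl) (auto simp: sum_distrib_left[symmetric] coefficient_orthogonality[OF \<rho>])
  also have "\<dots> = (\<Sum>l<d. if l = i then T $$ (i, j) * ?N else 0)"
    using ij by (intro sum.cong refl) auto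
  also have "\<dots> = (?N \<cdot>\<^sub>m T) $$ (i, j)" using ij T by simp
  finally show "msum d d (\<lambda>x. mtrace (T * \<rho> (inv x)) \<cdot>\<^sub>m \<rho> x) (carrier G) $$ (i, j) = (?N \<cdot>\<^sub>m T) $$ (i, j)" .
qed (use T in auto)

text \<open>Orthogonality pairs the indices crosswise, so the average is a multiple of the transpose
  of \<open>R\<close> rather than of \<open>R\<close>. Through this transposition the sign of a form
  enters the indicator.\<close>

lemma irr_rep_transpose_average:
  assumes \<rho>: "irr_rep G d \<rho>" and R: "R \<in> carrier_mat d d"
  shows "msum d d (\<lambda>x. \<rho> x * (R * transpose_mat (\<rho> (inv x)))) (carrier G) =
    (of_nat (card (carrier G)) / of_nat d) \<cdot>\<^sub>m transpose_mat R"
proof (rule eq_matI_carrier[of _ d d])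
  note rep = irr_rep_is_rep[OF \<rho>]
  note rc = is_rep_carrier[OF rep]
  fix i l assume il: "i < d" "l < d"
  let ?N = "of_nat (card (carrier G)) / of_nat d :: complex"
  have tr: "(\<rho> x * (R * transpose_mat (\<rho> (inv x)))) $$ (i, l) =
      (\<Sum>j<d. \<Sum>k<d. R $$ (j, k) * (\<rho> x $$ (i, j) * \<rho> (inv x) $$ (l, k)))"
    if x: "x \<in> carrier G" for x
  proof -
    have t: "transpose_mat (\<rho> (inv x)) \<in> carrier_mat d d" using rc[of "inv x"] x by simp
    have "(\<rho> x * (R * transpose_mat (\<rho> (inv x)))) $$ (i, l) =
      (\<Sum>j<d. \<rho> x $$ (i, j) * (\<Sum>k<d. R $$ (j, k) * transpose_mat (\<rho> (inv x)) $$ (k, l)))"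
      using il by (simp add: mult_mat_entry[OF rc[OF x] mult_carrier_mat[OF R t]] mult_mat_entry[OF R t] del: index_mult_mat(1))
    also have "\<dots> = (\<Sum>j<d. \<rho> x $$ (i, j) * (\<Sum>k<d. R $$ (j, k) * \<rho> (inv x) $$ (l, k)))"
      using il x by (intro sum.cong refl arg_cong2[where f = "(*)"]) (simp add: is_rep_dim[OF rep])
    finally show ?thesis by (simp add: sum_distrib_left mult_ac)
  qed
  have "msum d d (\<lambda>x. \<rho> x * (R * transpose_mat (\<rho> (inv x)))) (carrier G) $$ (i, l) =
      (\<Sum>x\<in>carrier G. \<Sum>j<d. \<Sum>k<d. R $$ (j, k) * (\<rho> x $$ (i, j) * \<rho> (inv x) $$ (l, k)))"
    using il by (simp add: tr del: index_mult_mat(1))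
  also have "\<dots> = (\<Sum>j<d. \<Sum>x\<in>carrier G. \<Sum>k<d. R $$ (j, k) * (\<rho> x $$ (i, j) * \<rho> (inv x) $$ (l, k)))"
    by (rule sum.swap)
  also have "\<dots> = (\<Sum>j<d. \<Sum>k<d. \<Sum>x\<in>carrier G. R $$ (j, k) * (\<rho> x $$ (i, j) * \<rho> (inv x) $$ (l, k)))"
    by (intro sum.cong refl sum.swap)
  also have "\<dots> = (\<Sum>j<d. \<Sum>k<d. if j = l then (if k = i then R $$ (l, i) * ?N else 0) else 0)"
    using il by (intro sum.cong refl) (auto simp: sum_distrib_left[symmetric] coefficient_orthogonality[OF \<rho>])
  also have "\<dots> = (\<Sum>j<d. if j = l then R $$ (l, i) * ?N else 0)"
    using il by (intro sum.cong refl) auto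
  also have "\<dots> = (?N \<cdot>\<^sub>m transpose_mat R) $$ (i, l)" using il R by simp
  finally show "msum d d (\<lambda>x. \<rho> x * (R * transpose_mat (\<rho> (inv x)))) (carrier G) $$ (i, l) =
    (?N \<cdot>\<^sub>m transpose_mat R) $$ (i, l)" .
qed (use R in auto)

end

section \<open>Bilinear forms adapted to an anti-automorphism of order two\<close>

locale anti_involution = fin_group +
  fixes \<phi> :: "'a \<Rightarrow> 'a"
  assumes phi_closed: "x \<in> carrier G \<Longrightarrow> \<phi> x \<in> carrier G"
    and phi_mult: "x \<in> carrier G \<Longrightarrow> y \<in> carrier G \<Longrightarrow> \<phi> (x \<otimes> y) = \<phi> y \<otimes> \<phi> x"
    and phi_phi: "x \<in> carrier G \<Longrightarrow> \<phi> (\<phi> x) = x"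
begin

lemma phi_one: "\<phi> \<one> = \<one>"
  by (metis phi_closed phi_mult one_closed r_one r_cancel_one)

lemma phi_inv: "x \<in> carrier G \<Longrightarrow> \<phi> (inv x) = inv (\<phi> x)"
  by (metis phi_closed phi_mult phi_one inv_closed inv_equality r_inv)

lemma bij_betw_phi: "bij_betw \<phi> (carrier G) (carrier G)"
  by (intro bij_betw_byWitness[where f' = \<phi>]) (auto simp: phi_closed phi_phi)

text \<open>The relation read at \<open>\<phi> g\<close> has the shape
  \<open>S * \<rho> g = B * S\<close>, so \<open>S\<close> is injective by
  \<open>irr_rep_intertwiner_inj\<close>.\<close>

lemma form_invertible:
  assumes \<rho>: "irr_rep G d \<rho>" and S: "S \<in> carrier_mat d d" "S \<noteq> 0\<^sub>m d d"
    and int: "\<And>x. x \<in> carrier G \<Longrightarrow> S * \<rho> (\<phi> x) = transpose_mat (\<rho> x) * S"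
  obtains R where "R \<in> carrier_mat d d" "R * S = 1\<^sub>m d" "S * R = 1\<^sub>m d"
proof -
  note rc = is_rep_carrier[OF irr_rep_is_rep[OF \<rho>]]
  have "\<exists>B\<in>carrier_mat d d. S * \<rho> g = B * S" if g: "g \<in> carrier G" for g
    using int[OF phi_closed[OF g]] rc[OF phi_closed[OF g]] phi_phi[OF g] by (metis transpose_carrier_mat)
  then have inj: "\<And>v. v \<in> carrier_vec d \<Longrightarrow> S *\<^sub>v v = 0\<^sub>v d \<Longrightarrow> v = 0\<^sub>v d"
    using irr_rep_intertwiner_inj[OF \<rho> S(1) _ S(2)] by blast
  then have "det S \<noteq> 0" using det_0_iff_vec_prod_zero_field[OF S(1)] by blast
  from det_non_zero_imp_unit[OF S(1) this, of "()"] obtain R where "R \<in> carrier_mat d d" "R * S = 1\<^sub>m d"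
    by (auto simp: Units_def ring_mat_def)
  then show ?thesis using that mat_mult_left_right_inverse[OF _ S(1)] by blast
qed

text \<open>Transposing the relation at \<open>\<phi> x\<close> shows that
  \<open>transpose_mat S\<close> is again an adapted form. By Schur's lemma it is then a multiple of
  \<open>S\<close>, and transposing twice shows that the factor squares to 1.\<close>

lemma form_symmetric_or_skew:
  assumes \<rho>: "irr_rep G d \<rho>" and S: "S \<in> carrier_mat d d"
    and int: "\<And>x. x \<in> carrier G \<Longrightarrow> S * \<rho> (\<phi> x) = transpose_mat (\<rho> x) * S"
  shows "transpose_mat S = S \<or> transpose_mat S = (-1) \<cdot>\<^sub>m S"
proof (cases "S = 0\<^sub>m d d")
  case True
  then show ?thesis by (auto intro!: eq_matI)
next
  case False
  obtain R where R: "R \<in> carrier_mat d d" "R * S = 1\<^sub>m d" "S * R = 1\<^sub>m d"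
    using form_invertible[OF \<rho> S False int] by blast
  note rep = irr_rep_is_rep[OF \<rho>]
  note rc = is_rep_carrier[OF rep]
  note dims = is_rep_dim[OF rep] S[THEN carrier_matD(1)] S[THEN carrier_matD(2)]
    R(1)[THEN carrier_matD(1)] R(1)[THEN carrier_matD(2)]
  let ?T = "transpose_mat S"
  have int': "?T * \<rho> (\<phi> x) = transpose_mat (\<rho> x) * ?T" if x: "x \<in> carrier G" for x
  proof -
    have "transpose_mat (S * \<rho> x) = transpose_mat (transpose_mat (\<rho> (\<phi> x)) * S)"
      using int[OF phi_closed[OF x]] phi_phi[OF x] by simp
    then have "transpose_mat (\<rho> x) * ?T = ?T * transpose_mat (transpose_mat (\<rho> (\<phi> x)))"
      using transpose_mult[OF S rc[OF x]] transpose_mult[OF _ S, of "transpose_mat (\<rho> (\<phi> x))" d]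
        rc[OF phi_closed[OF x]] by simp
    then show ?thesis by simp
  qed
  have "(R * ?T) * \<rho> g = \<rho> g * (R * ?T)" if g: "g \<in> carrier G" for g
  proof -
    let ?h = "\<phi> g"
    have h: "?h \<in> carrier G" "\<phi> ?h = g" using g by (auto simp: phi_closed phi_phi)
    have "(R * ?T) * \<rho> g = R * (?T * \<rho> (\<phi> ?h))" using g h by (simp add: mult_assoc_dim dims)
    also have "\<dots> = (R * transpose_mat (\<rho> ?h)) * ?T" using int'[OF h(1)] h by (simp add: mult_assoc_dim dims)
    also have "R * transpose_mat (\<rho> ?h) = R * (transpose_mat (\<rho> ?h) * (S * R))"
      using R rc[OF h(1)] by simp
    also have "\<dots> = R * ((S * \<rho> (\<phi> ?h)) * R)" using h int[OF h(1)] by (simp add: mult_assoc_dim dims)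
    also have "\<dots> = (R * S) * (\<rho> (\<phi> ?h) * R)" using h g by (simp add: mult_assoc_dim dims)
    also have "\<dots> = \<rho> g * R"
      using R rc[OF g] by (simp add: h(2) left_mult_one_mat[OF mult_carrier_mat[OF rc[OF g] R(1)]])
    finally show ?thesis using g by (simp add: mult_assoc_dim dims)
  qed
  then obtain c where c: "R * ?T = c \<cdot>\<^sub>m 1\<^sub>m d"
    using schur_scalar[OF \<rho>, of "R * ?T"] R S by (metis mult_carrier_mat transpose_carrier_mat)
  have "?T = (S * R) * ?T" using R S by simp
  also have "\<dots> = S * (c \<cdot>\<^sub>m 1\<^sub>m d)" by (simp add: mult_assoc_dim dims c)
  also have "\<dots> = c \<cdot>\<^sub>m S" using S mult_smult_distrib[OF S one_carrier_mat] by simp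
  finally have T: "?T = c \<cdot>\<^sub>m S" .
  have ent: "S $$ (j, i) = c * S $$ (i, j)" if "i < d" "j < d" for i j
    using arg_cong[OF T, of "\<lambda>M. M $$ (i, j)"] that S by simp
  obtain i j where ij: "i < d" "j < d" "S $$ (i, j) \<noteq> 0"
    using False S by (metis eq_matI_carrier index_zero_mat(1) zero_carrier_mat)
  have "S $$ (i, j) = c * (c * S $$ (i, j))" using ent ij by metis
  then have "c * c = 1" using ij by simp
  then have "c = 1 \<or> c = -1" by (simp add: square_eq_1_iff)
  then show ?thesis using T S by (auto intro!: eq_matI)
qed

text \<open>The centralizer of a subgroup \<open>K\<close> in the group algebra is fixed pointwise by \<open>\<phi>\<close>, so a
  \<open>K\<close>-equivariant projection onto a \<open>K\<close>-irreducible subspace is self-adjoint for the form \<open>S\<close>;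
  hence \<open>S\<close> restricts to a nonzero form there, and a skew \<open>S\<close> would restrict to a skew form.\<close>

lemma symmetric_forms_extend:
  assumes K: "subgroup K G" and phiK: "\<And>x. x \<in> K \<Longrightarrow> \<phi> x \<in> K"
    and conj: "\<And>x. x \<in> carrier G \<Longrightarrow> \<exists>h\<in>K. \<phi> x = h \<otimes> x \<otimes> inv h"
    and sym: "symmetric_forms (G\<lparr>carrier := K\<rparr>) \<phi>"
  shows "symmetric_forms G \<phi>"
  unfolding symmetric_forms_def
proof (intro allI impI)
  fix d \<rho> S assume \<rho>: "irr_rep G d \<rho>" and S: "S \<in> carrier_mat d d"
    and "\<forall>x\<in>carrier G. S * \<rho> (\<phi> x) = transpose_mat (\<rho> x) * S"
  then have int: "\<And>x. x \<in> carrier G \<Longrightarrow> S * \<rho> (\<phi> x) = transpose_mat (\<rho> x) * S" by blast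
  let ?K = "G\<lparr>carrier := K\<rparr>"
  have KG: "K \<subseteq> carrier G" using K by (rule subgroup.subset)
  have finK: "finite K" using KG finite_carrier finite_subset by blast
  interpret K: fin_group ?K
    using subgroup_imp_group[OF K] finK by (simp add: fin_group_def fin_group_axioms_def)
  note rep = irr_rep_is_rep[OF \<rho>]
  note rc = is_rep_carrier[OF rep]
  have d: "d > 0" using \<rho> by (simp add: irr_rep_def)
  have repK: "is_rep ?K d \<rho>" using rep KG by (auto simp: is_rep_def)
  obtain k P R \<alpha> where P: "P \<in> carrier_mat d k" and R: "R \<in> carrier_mat k d" and RP: "R * P = 1\<^sub>m k"
    and \<alpha>: "irr_rep ?K k \<alpha>" and \<rho>P: "\<And>g. g \<in> K \<Longrightarrow> \<rho> g * P = P * \<alpha> g"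
    using exists_irr_subrep[OF K.is_group repK d] by auto
  have k: "k > 0" using \<alpha> by (simp add: irr_rep_def)
  have repA: "is_rep ?K k \<alpha>" using \<alpha> by (rule irr_rep_is_rep)
  have ac: "\<alpha> h \<in> carrier_mat k k" if "h \<in> K" for h using is_rep_carrier[OF repA] that by simp
  \<comment> \<open>The linear left inverse \<open>R\<close> summed over \<open>K\<close>, hence
    equivariant. It is not normalised, which produces the factor \<open>card K\<close> in
    \<open>Y * P\<close>.\<close>
  define Y where "Y = msum k d (\<lambda>h. \<alpha> h * R * \<rho> (inv\<^bsub>?K\<^esub> h)) K"
  have Y: "Y \<in> carrier_mat k d" by (simp add: Y_def)
  note dims = is_rep_dim[OF rep] is_rep_dim[OF repA, simplified] S[THEN carrier_matD(1)] S[THEN carrier_matD(2)]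
    R[THEN carrier_matD(1)] R[THEN carrier_matD(2)] P[THEN carrier_matD(1)] P[THEN carrier_matD(2)]
    Y[THEN carrier_matD(1)] Y[THEN carrier_matD(2)]
  have \<alpha>Y: "\<alpha> h * Y = Y * \<rho> h" if "h \<in> K" for h
    using K.averaging_intertwines[OF repA repK R] that by (simp add: Y_def)
  have invK: "inv\<^bsub>?K\<^esub> h = inv h" "inv h \<in> K" if "h \<in> K" for h
    using that K m_inv_consistent[OF K that] subgroup.m_inv_closed[OF K that] by auto
  have YP: "Y * P = of_nat (card K) \<cdot>\<^sub>m 1\<^sub>m k"
  proof -
    have c: "\<alpha> h * R * \<rho> (inv\<^bsub>?K\<^esub> h) \<in> carrier_mat k d" if "h \<in> K" for h
      using that invK[OF that] KG by (intro carrier_matI) (auto simp: dims)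
    have "Y * P = msum k k (\<lambda>h. \<alpha> h * R * \<rho> (inv\<^bsub>?K\<^esub> h) * P) K"
      unfolding Y_def by (rule msum_mult[OF P c])
    also have "\<dots> = msum k k (\<lambda>h. 1\<^sub>m k) K"
    proof (rule msum_cong)
      fix h assume h: "h \<in> K"
      have hG: "h \<in> carrier G" "inv h \<in> carrier G" using h KG by auto
      have "\<alpha> h * R * \<rho> (inv\<^bsub>?K\<^esub> h) * P = \<alpha> h * (R * (\<rho> (inv h) * P))"
        using h hG invK[OF h] by (simp add: mult_assoc_dim dims)
      also have "\<rho> (inv h) * P = P * \<alpha> (inv h)" using \<rho>P invK[OF h] by simp
      also have "R * (P * \<alpha> (inv h)) = (R * P) * \<alpha> (inv h)"
        using invK[OF h] by (simp add: mult_assoc_dim dims)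
      also have "\<dots> = \<alpha> (inv h)" using RP ac[OF invK(2)[OF h]] by simp
      also have "\<alpha> h * \<alpha> (inv h) = \<alpha> (h \<otimes> inv h)"
        using is_rep_mult[OF repA, of h "inv h"] h invK[OF h] by simp
      also have "\<dots> = 1\<^sub>m k" using is_rep_one[OF repA] hG by simp
      finally show "\<alpha> h * R * \<rho> (inv\<^bsub>?K\<^esub> h) * P = 1\<^sub>m k" .
    qed
    also have "\<dots> = of_nat (card K) \<cdot>\<^sub>m 1\<^sub>m k" by (rule eq_matI_carrier[of _ k k]) auto
    finally show ?thesis .
  qed
  \<comment> \<open>Up to the factor \<open>card K\<close>, this is the equivariant projection onto
    the column space of \<open>P\<close>.\<close>
  define T where "T = P * Y"
  have T: "T \<in> carrier_mat d d" using P Y by (simp add: T_def)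
  note dims = dims T[THEN carrier_matD(1)] T[THEN carrier_matD(2)]
  have Tcomm: "\<rho> h * T = T * \<rho> h" if h: "h \<in> K" for h
  proof -
    have hG: "h \<in> carrier G" using h KG by auto
    have "\<rho> h * T = (\<rho> h * P) * Y" using hG by (simp add: T_def mult_assoc_dim dims)
    also have "\<dots> = P * (\<alpha> h * Y)" using h by (simp add: \<rho>P mult_assoc_dim dims)
    also have "\<dots> = T * \<rho> h" using h hG by (simp add: \<alpha>Y T_def mult_assoc_dim dims)
    finally show ?thesis .
  qed
  \<comment> \<open>The coefficients of \<open>T\<close> in \<open>irr_rep_span\<close>. Since
    \<open>T\<close> commutes with \<open>K\<close>, they are invariant under conjugation by
    \<open>K\<close> and hence under \<open>\<phi>\<close>; this is where the conjugating element
    has to come from \<open>K\<close>.\<close>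
  define c where "c = (\<lambda>x. mtrace (T * \<rho> (inv x)))"
  have c\<phi>: "c (\<phi> x) = c x" if x: "x \<in> carrier G" for x
  proof -
    obtain h where h: "h \<in> K" "\<phi> x = h \<otimes> x \<otimes> inv h" using conj[OF x] by blast
    have hG: "h \<in> carrier G" using h KG by auto
    have "inv (\<phi> x) = h \<otimes> (inv x \<otimes> inv h)" using h(2) x hG by (simp add: inv_mult_group m_assoc)
    then have "\<rho> (inv (\<phi> x)) = \<rho> h * (\<rho> (inv x) * \<rho> (inv h))"
      using x hG by (simp add: is_rep_mult[OF rep])
    then have "c (\<phi> x) = mtrace ((T * \<rho> h) * \<rho> (inv x) * \<rho> (inv h))"
      using x hG by (simp add: c_def mult_assoc_dim dims)
    also have "\<dots> = mtrace (\<rho> (inv h) * ((\<rho> h * T) * \<rho> (inv x)))"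
      using x hG by (simp add: Tcomm[OF h(1)])
        (intro mtrace_mult_comm[of _ d d] carrier_matI, simp_all add: dims)
    also have "\<rho> (inv h) * ((\<rho> h * T) * \<rho> (inv x)) = (\<rho> (inv h) * \<rho> h) * (T * \<rho> (inv x))"
      using x hG by (simp add: mult_assoc_dim dims)
    also have "\<rho> (inv h) * \<rho> h = 1\<^sub>m d"
      using hG by (simp add: is_rep_mult[OF rep, symmetric] is_rep_one[OF rep])
    also have "1\<^sub>m d * (T * \<rho> (inv x)) = T * \<rho> (inv x)"
      using left_mult_one_mat[OF mult_carrier_mat[OF T rc[of "inv x"]]] x by simp
    finally show ?thesis by (simp add: c_def)
  qed
  let ?N = "of_nat (card (carrier G)) / of_nat d :: complex"
  have N: "?N \<noteq> 0" using card_carrier_nz d by simp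
  have span: "msum d d (\<lambda>x. c x \<cdot>\<^sub>m \<rho> x) (carrier G) = ?N \<cdot>\<^sub>m T"
    unfolding c_def by (rule irr_rep_span[OF \<rho> T])
  \<comment> \<open>Moving \<open>S\<close> through the expansion turns each
    \<open>\<rho> (\<phi> x)\<close> into \<open>transpose_mat (\<rho> x)\<close>. As
    \<open>c\<close> is invariant under \<open>\<phi>\<close>, the result is the expansion of
    \<open>transpose_mat T\<close>.\<close>
  have "?N \<cdot>\<^sub>m (S * T) = S * (?N \<cdot>\<^sub>m T)" by (rule mult_smult_distrib[OF S T, symmetric])
  also have "\<dots> = msum d d (\<lambda>x. S * (c x \<cdot>\<^sub>m \<rho> x)) (carrier G)"
    unfolding span[symmetric] using rc by (intro mult_msum[OF S]) auto
  also have "\<dots> = msum d d (\<lambda>x. S * (c (\<phi> x) \<cdot>\<^sub>m \<rho> (\<phi> x))) (carrier G)"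
    by (rule msum_reindex_bij[OF bij_betw_phi])
  also have "\<dots> = msum d d (\<lambda>x. transpose_mat (c x \<cdot>\<^sub>m \<rho> x) * S) (carrier G)"
  proof (rule msum_cong)
    fix x assume x: "x \<in> carrier G"
    have t: "transpose_mat (\<rho> x) \<in> carrier_mat d d" using rc[OF x] by simp
    have "S * (c (\<phi> x) \<cdot>\<^sub>m \<rho> (\<phi> x)) = c x \<cdot>\<^sub>m (transpose_mat (\<rho> x) * S)"
      using mult_smult_distrib[OF S rc[OF phi_closed[OF x]]] int[OF x] c\<phi>[OF x] by simp
    also have "\<dots> = (c x \<cdot>\<^sub>m transpose_mat (\<rho> x)) * S"
      by (rule mult_smult_assoc_mat[OF t S, symmetric])
    also have "c x \<cdot>\<^sub>m transpose_mat (\<rho> x) = transpose_mat (c x \<cdot>\<^sub>m \<rho> x)" by (intro eq_matI) auto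
    finally show "S * (c (\<phi> x) \<cdot>\<^sub>m \<rho> (\<phi> x)) = transpose_mat (c x \<cdot>\<^sub>m \<rho> x) * S" .
  qed
  also have "\<dots> = msum d d (\<lambda>x. transpose_mat (c x \<cdot>\<^sub>m \<rho> x)) (carrier G) * S"
    using rc by (intro msum_mult[OF S, symmetric]) auto
  also have "msum d d (\<lambda>x. transpose_mat (c x \<cdot>\<^sub>m \<rho> x)) (carrier G) = transpose_mat (?N \<cdot>\<^sub>m T)"
    unfolding span[symmetric] using rc by (intro msum_transpose[symmetric]) auto
  also have "transpose_mat (?N \<cdot>\<^sub>m T) = ?N \<cdot>\<^sub>m transpose_mat T" by (intro eq_matI) auto
  also have "(?N \<cdot>\<^sub>m transpose_mat T) * S = ?N \<cdot>\<^sub>m (transpose_mat T * S)"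
    using T S by (intro mult_smult_assoc_mat[of _ d d _ d]) auto
  finally have NST: "?N \<cdot>\<^sub>m (S * T) = ?N \<cdot>\<^sub>m (transpose_mat T * S)" .
  have ST: "S * T = transpose_mat T * S"
  proof (rule eq_matI_carrier[of _ d d])
    fix i j assume ij: "i < d" "j < d"
    have "?N * (S * T) $$ (i, j) = ?N * (transpose_mat T * S) $$ (i, j)"
      using arg_cong[OF NST, of "\<lambda>M. M $$ (i, j)"] ij by (simp add: dims del: index_mult_mat(1))
    then show "(S * T) $$ (i, j) = (transpose_mat T * S) $$ (i, j)" using N by simp
  qed (use S T in auto)
  \<comment> \<open>Gram matrix of the form restricted to the subspace that is irreducible under
    \<open>K\<close>.\<close>
  define S1 where "S1 = transpose_mat P * (S * P)"
  have S1: "S1 \<in> carrier_mat k k" by (intro carrier_matI) (simp_all add: S1_def dims)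
  have tP: "transpose_mat P \<in> carrier_mat k d" and SP: "S * P \<in> carrier_mat d k" using P S by auto
  have "S1 * \<alpha> (\<phi> h) = transpose_mat (\<alpha> h) * S1" if h: "h \<in> K" for h
  proof -
    have hG: "h \<in> carrier G" "\<phi> h \<in> carrier G" using h KG by (auto simp: phi_closed)
    have "S1 * \<alpha> (\<phi> h) = transpose_mat P * ((S * \<rho> (\<phi> h)) * P)"
      using \<rho>P[OF phiK[OF h]] hG phiK[OF h] by (simp add: S1_def mult_assoc_dim dims)
    also have "\<dots> = (transpose_mat P * transpose_mat (\<rho> h)) * (S * P)"
      using int[OF hG(1)] hG by (simp add: mult_assoc_dim dims)
    also have "transpose_mat P * transpose_mat (\<rho> h) = transpose_mat (\<rho> h * P)"
      by (rule transpose_mult[OF rc[OF hG(1)] P, symmetric])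
    also have "\<dots> = transpose_mat (\<alpha> h) * transpose_mat P"
      unfolding \<rho>P[OF h] by (rule transpose_mult[OF P ac[OF h]])
    finally show ?thesis using h by (simp add: S1_def mult_assoc_dim dims)
  qed
  then have S1sym: "transpose_mat S1 = S1" using sym \<alpha> S1 by (simp add: symmetric_forms_def)
  show "transpose_mat S = S"
  proof (cases "S = 0\<^sub>m d d")
    case True
    then show ?thesis by (auto intro!: eq_matI)
  next
    case False
    obtain Q where Q: "Q \<in> carrier_mat d d" "Q * S = 1\<^sub>m d"
      using form_invertible[OF \<rho> S False int] by blast
    \<comment> \<open>For skew \<open>S\<close> the matrix \<open>S1\<close> is both skew and
      symmetric, so it is 0. Multiplying \<open>S * T = transpose_mat T * S\<close> by
      \<open>P\<close> gives \<open>card K\<close> times \<open>S * P\<close> on the left and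
      \<open>transpose_mat Y * S1 = 0\<close> on the right. Hence \<open>P\<close> vanishes,
      although it has a left inverse.\<close>
    have "transpose_mat S \<noteq> (-1) \<cdot>\<^sub>m S"
    proof
      assume skew: "transpose_mat S = (-1) \<cdot>\<^sub>m S"
      have "transpose_mat S1 = transpose_mat (S * P) * P"
        unfolding S1_def using transpose_mult[OF tP SP] by simp
      also have "transpose_mat (S * P) = transpose_mat P * ((-1) \<cdot>\<^sub>m S)"
        using transpose_mult[OF S P] skew by simp
      also have "\<dots> * P = transpose_mat P * (((-1) \<cdot>\<^sub>m S) * P)" by (simp add: mult_assoc_dim dims)
      also have "((-1) \<cdot>\<^sub>m S) * P = (-1) \<cdot>\<^sub>m (S * P)" by (rule mult_smult_assoc_mat[OF S P])
      also have "transpose_mat P * \<dots> = (-1) \<cdot>\<^sub>m S1"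
        unfolding S1_def by (rule mult_smult_distrib[OF tP SP])
      finally have neg: "S1 = (-1) \<cdot>\<^sub>m S1" using S1sym by simp
      have S10: "S1 = 0\<^sub>m k k"
      proof (rule eq_matI_carrier[OF S1])
        fix i j assume ij: "i < k" "j < k"
        have "S1 $$ (i, j) = - S1 $$ (i, j)"
          using arg_cong[OF neg, of "\<lambda>M. M $$ (i, j)"] ij S1 by simp
        then show "S1 $$ (i, j) = 0\<^sub>m k k $$ (i, j)" using ij by simp
      qed simp
      have "(S * T) * P = of_nat (card K) \<cdot>\<^sub>m (S * P)"
      proof -
        have "(S * T) * P = (S * P) * (Y * P)" by (simp add: T_def mult_assoc_dim dims)
        also have "\<dots> = of_nat (card K) \<cdot>\<^sub>m (S * P)"
          unfolding YP using mult_smult_distrib[OF SP one_carrier_mat] right_mult_one_mat[OF SP] by simp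
        finally show ?thesis .
      qed
      moreover have "(transpose_mat T * S) * P = 0\<^sub>m d k"
      proof -
        have "transpose_mat T = transpose_mat Y * transpose_mat P"
          unfolding T_def by (rule transpose_mult[OF P Y])
        then have "(transpose_mat T * S) * P = transpose_mat Y * S1"
          by (simp add: S1_def mult_assoc_dim dims)
        then show ?thesis unfolding S10 using Y by simp
      qed
      ultimately have z: "of_nat (card K) \<cdot>\<^sub>m (S * P) = 0\<^sub>m d k" using ST by simp
      have cK: "(of_nat (card K) :: complex) \<noteq> 0" using K.card_carrier_nz by simp
      have SP0: "S * P = 0\<^sub>m d k"
      proof (rule eq_matI_carrier[OF SP])
        fix i j assume ij: "i < d" "j < k"
        have "of_nat (card K) * (S * P) $$ (i, j) = 0"
          using arg_cong[OF z, of "\<lambda>M. M $$ (i, j)"] ij by (simp add: dims del: index_mult_mat(1))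
        then show "(S * P) $$ (i, j) = 0\<^sub>m d k $$ (i, j)" using ij cK by simp
      qed simp
      have "P = (Q * S) * P" using Q P by simp
      also have "\<dots> = Q * (S * P)" using Q(1) by (simp add: mult_assoc_dim dims)
      also have "\<dots> = 0\<^sub>m d k" unfolding SP0 using Q by simp
      finally have "R * P = 0\<^sub>m k k" using R by simp
      then have "1\<^sub>m k $$ (0, 0) = (0\<^sub>m k k $$ (0, 0) :: complex)" using RP by simp
      then show False using k by simp
    qed
    then show ?thesis using form_symmetric_or_skew[OF \<rho> S int] by blast
  qed
qed

text \<open>Averaging a matrix \<open>X\<close> between \<open>transpose_mat (\<rho> x)\<close> and
  \<open>\<rho> (inv (\<phi> x))\<close> always yields an adapted form. If all matrix units gave 0,
  the sum of \<open>mtrace (\<rho> x) * mtrace (\<rho> (inv (\<phi> x)))\<close> would be 0; but by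
  conjugacy it is the sum in \<open>mtrace_orthogonality_eq\<close>.\<close>

lemma exists_nonzero_form:
  assumes \<rho>: "irr_rep G d \<rho>"
    and conj: "\<And>x. x \<in> carrier G \<Longrightarrow> \<exists>h\<in>carrier G. \<phi> x = h \<otimes> x \<otimes> inv h"
  obtains S where "S \<in> carrier_mat d d" "S \<noteq> 0\<^sub>m d d"
    "\<And>x. x \<in> carrier G \<Longrightarrow> S * \<rho> (\<phi> x) = transpose_mat (\<rho> x) * S"
proof -
  note rep = irr_rep_is_rep[OF \<rho>]
  note rc = is_rep_carrier[OF rep]
  note dims = is_rep_dim[OF rep]
  let ?X = "\<lambda>j k. mat d d (\<lambda>(a, b). if a = j \<and> b = k then 1 else 0 :: complex)"
  define S where "S = (\<lambda>j k. msum d d (\<lambda>x. transpose_mat (\<rho> x) * ?X j k * \<rho> (inv (\<phi> x))) (carrier G))"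
  have Sc: "S j k \<in> carrier_mat d d" for j k by (simp add: S_def)
  have c: "transpose_mat (\<rho> x) * ?X j k * \<rho> (inv (\<phi> x)) \<in> carrier_mat d d" if "x \<in> carrier G" for x j k
    using that by (intro carrier_matI) (simp_all add: dims phi_closed)
  have int: "S j k * \<rho> (\<phi> y) = transpose_mat (\<rho> y) * S j k" if y: "y \<in> carrier G" for y j k
  proof -
    have t: "transpose_mat (\<rho> y) \<in> carrier_mat d d" using rc[OF y] by simp
    have "transpose_mat (\<rho> y) * S j k =
        msum d d (\<lambda>x. transpose_mat (\<rho> y) * (transpose_mat (\<rho> x) * ?X j k * \<rho> (inv (\<phi> x)))) (carrier G)"
      unfolding S_def by (rule mult_msum[OF t c])
    also have "\<dots> = msum d d (\<lambda>x. transpose_mat (\<rho> (x \<otimes> y)) * ?X j k * \<rho> (inv (\<phi> (x \<otimes> y))) * \<rho> (\<phi> y)) (carrier G)"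
    proof (rule msum_cong)
      fix x assume x: "x \<in> carrier G"
      have "\<rho> (inv (\<phi> x)) = \<rho> (inv (\<phi> (x \<otimes> y))) * \<rho> (\<phi> y)"
        using x y by (simp add: is_rep_mult[OF rep, symmetric] phi_mult phi_closed inv_mult_group m_assoc)
      moreover have "transpose_mat (\<rho> (x \<otimes> y)) = transpose_mat (\<rho> y) * transpose_mat (\<rho> x)"
        using transpose_mult[OF rc[OF x] rc[OF y]] x y by (simp add: is_rep_mult[OF rep])
      ultimately show "transpose_mat (\<rho> y) * (transpose_mat (\<rho> x) * ?X j k * \<rho> (inv (\<phi> x))) =
          transpose_mat (\<rho> (x \<otimes> y)) * ?X j k * \<rho> (inv (\<phi> (x \<otimes> y))) * \<rho> (\<phi> y)"
        using x y by (simp add: mult_assoc_dim dims phi_closed)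
    qed
    also have "\<dots> = msum d d (\<lambda>x. transpose_mat (\<rho> x) * ?X j k * \<rho> (inv (\<phi> x)) * \<rho> (\<phi> y)) (carrier G)"
      by (rule msum_reindex_bij[OF bij_betw_mult_right[OF y], symmetric])
    also have "\<dots> = S j k * \<rho> (\<phi> y)"
      unfolding S_def by (rule msum_mult[OF rc[OF phi_closed[OF y]] c, symmetric])
    finally show ?thesis by simp
  qed
  have entry: "S j k $$ (i, l) = (\<Sum>x\<in>carrier G. \<rho> x $$ (j, i) * \<rho> (inv (\<phi> x)) $$ (k, l))"
    if "i < d" "j < d" "k < d" "l < d" for i j k l
  proof -
    have "S j k $$ (i, l) = (\<Sum>x\<in>carrier G. (transpose_mat (\<rho> x) * ?X j k * \<rho> (inv (\<phi> x))) $$ (i, l))"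
      using that by (simp add: S_def)
    also have "\<dots> = (\<Sum>x\<in>carrier G. \<rho> x $$ (j, i) * \<rho> (inv (\<phi> x)) $$ (k, l))"
    proof (rule sum.cong[OF refl])
      fix x assume x: "x \<in> carrier G"
      have "(transpose_mat (\<rho> x) * ?X j k * \<rho> (inv (\<phi> x))) $$ (i, l) =
          transpose_mat (\<rho> x) $$ (i, j) * \<rho> (inv (\<phi> x)) $$ (k, l)"
        using that x rc[OF x] rc[of "inv (\<phi> x)"] phi_closed[OF x] by (intro elementary_sandwich) auto
      then show "(transpose_mat (\<rho> x) * ?X j k * \<rho> (inv (\<phi> x))) $$ (i, l) =
          \<rho> x $$ (j, i) * \<rho> (inv (\<phi> x)) $$ (k, l)" using that x by (simp add: dims)
    qed
    finally show ?thesis .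
  qed
  have "\<exists>j k. S j k \<noteq> 0\<^sub>m d d"
  proof (rule ccontr)
    assume "\<nexists>j k. S j k \<noteq> 0\<^sub>m d d"
    then have S0: "S j k = 0\<^sub>m d d" for j k by blast
    have tr: "mtrace (\<rho> (inv (\<phi> x))) = mtrace (\<rho> (inv x))" if x: "x \<in> carrier G" for x
    proof -
      obtain h where h: "h \<in> carrier G" "\<phi> x = h \<otimes> x \<otimes> inv h" using conj[OF x] by blast
      then have "inv (\<phi> x) = h \<otimes> inv x \<otimes> inv h" using x by (simp add: inv_mult_group m_assoc)
      then show ?thesis using mtrace_conj[OF rep, of "inv x" h] h x by simp
    qed
    have "of_nat (card (carrier G)) = (\<Sum>x\<in>carrier G. mtrace (\<rho> x) * mtrace (\<rho> (inv (\<phi> x))))"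
      using mtrace_orthogonality_eq[OF \<rho>] by (simp add: tr)
    also have "\<dots> = (\<Sum>x\<in>carrier G. \<Sum>i<d. \<Sum>k<d. \<rho> x $$ (i, i) * \<rho> (inv (\<phi> x)) $$ (k, k))"
      by (intro sum.cong refl)
        (simp add: mtrace_carrier[OF rc] phi_closed sum_product)
    also have "\<dots> = (\<Sum>i<d. \<Sum>x\<in>carrier G. \<Sum>k<d. \<rho> x $$ (i, i) * \<rho> (inv (\<phi> x)) $$ (k, k))"
      by (rule sum.swap)
    also have "\<dots> = (\<Sum>i<d. \<Sum>k<d. \<Sum>x\<in>carrier G. \<rho> x $$ (i, i) * \<rho> (inv (\<phi> x)) $$ (k, k))"
      by (intro sum.cong refl sum.swap)
    also have "\<dots> = (\<Sum>i<d. \<Sum>k<d. S i k $$ (i, k))" by (simp add: entry)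
    also have "\<dots> = 0" by (simp add: S0)
    finally show False using card_carrier_nz by simp
  qed
  then show ?thesis using that Sc int by blast
qed

text \<open>The form rewrites \<open>\<rho> (inv (\<phi> x))\<close> as
  \<open>R * (transpose_mat (\<rho> (inv x)) * S)\<close>, so the matrices sum to a multiple of
  \<open>transpose_mat R * S\<close>. For symmetric \<open>S\<close> this product is the identity; a
  skew \<open>S\<close> would give its negative.\<close>

lemma twisted_indicator:
  assumes \<rho>: "irr_rep G d \<rho>" and sym: "symmetric_forms G \<phi>"
    and conj: "\<And>x. x \<in> carrier G \<Longrightarrow> \<exists>h\<in>carrier G. \<phi> x = h \<otimes> x \<otimes> inv h"
  shows "(\<Sum>x\<in>carrier G. mtrace (\<rho> (x \<otimes> inv (\<phi> x)))) = of_nat (card (carrier G))"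
proof -
  note rep = irr_rep_is_rep[OF \<rho>]
  note rc = is_rep_carrier[OF rep]
  have d: "(of_nat d :: complex) \<noteq> 0" using \<rho> by (simp add: irr_rep_def)
  obtain S where S: "S \<in> carrier_mat d d" "S \<noteq> 0\<^sub>m d d"
    and int: "\<And>x. x \<in> carrier G \<Longrightarrow> S * \<rho> (\<phi> x) = transpose_mat (\<rho> x) * S"
    using exists_nonzero_form[OF \<rho> conj] by blast
  have Ssym: "transpose_mat S = S" using sym \<rho> S(1) int by (simp add: symmetric_forms_def)
  obtain R where R: "R \<in> carrier_mat d d" "R * S = 1\<^sub>m d" "S * R = 1\<^sub>m d"
    using form_invertible[OF \<rho> S int] by blast
  note dims = is_rep_dim[OF rep] S(1)[THEN carrier_matD(1)] S(1)[THEN carrier_matD(2)]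
    R(1)[THEN carrier_matD(1)] R(1)[THEN carrier_matD(2)]
  let ?N = "of_nat (card (carrier G)) / of_nat d :: complex"
  let ?F = "\<lambda>x. \<rho> x * (R * transpose_mat (\<rho> (inv x)))"
  have F: "?F x \<in> carrier_mat d d" if "x \<in> carrier G" for x
    using that by (intro carrier_matI) (simp_all add: dims)
  have "(\<Sum>x\<in>carrier G. mtrace (\<rho> (x \<otimes> inv (\<phi> x)))) = (\<Sum>x\<in>carrier G. mtrace (?F x * S))"
  proof (rule sum.cong[OF refl])
    fix x assume x: "x \<in> carrier G"
    have "\<rho> (\<phi> (inv x)) = (R * S) * \<rho> (\<phi> (inv x))" using R rc[of "\<phi> (inv x)"] x by (simp add: phi_closed)
    also have "\<dots> = R * (transpose_mat (\<rho> (inv x)) * S)"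
      using int[of "inv x"] x by (simp add: mult_assoc_dim dims phi_closed)
    finally have "\<rho> (inv (\<phi> x)) = R * (transpose_mat (\<rho> (inv x)) * S)" using x by (simp add: phi_inv)
    then have "\<rho> (x \<otimes> inv (\<phi> x)) = ?F x * S"
      using x by (simp add: is_rep_mult[OF rep] phi_closed mult_assoc_dim dims)
    then show "mtrace (\<rho> (x \<otimes> inv (\<phi> x))) = mtrace (?F x * S)" by simp
  qed
  also have "\<dots> = mtrace (msum d d (\<lambda>x. ?F x * S) (carrier G))"
    using F S(1) by (intro mtrace_msum[symmetric]) (metis mult_carrier_mat)
  also have "\<dots> = mtrace (msum d d ?F (carrier G) * S)" using msum_mult[OF S(1), of "carrier G" ?F] F by simp
  also have "msum d d ?F (carrier G) * S = (?N \<cdot>\<^sub>m transpose_mat R) * transpose_mat S"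
    unfolding Ssym by (subst irr_rep_transpose_average[OF \<rho> R(1)]) simp
  also have "\<dots> = ?N \<cdot>\<^sub>m (transpose_mat R * transpose_mat S)"
    using R(1) S(1) by (intro mult_smult_assoc_mat[of _ d d _ d]) auto
  also have "transpose_mat R * transpose_mat S = 1\<^sub>m d"
    using transpose_mult[OF S(1) R(1)] R(3) by simp
  finally show ?thesis using d by (simp add: mtrace_smult[of _ d])
qed

section \<open>Counting twisted roots\<close>

definition twisted_roots :: "'a \<Rightarrow> 'a set" where
  "twisted_roots g = {x \<in> carrier G. x \<otimes> inv (\<phi> x) = g}"

text \<open>The bijection is twisted conjugation of \<open>x\<close> into
  \<open>h \<otimes> x \<otimes> \<phi> h\<close>: applying \<open>\<phi>\<close> to this gives
  \<open>h \<otimes> \<phi> x \<otimes> \<phi> h\<close>, and the factor \<open>\<phi> h\<close>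
  cancels in the quotient.\<close>

lemma card_twisted_roots_conj:
  assumes g: "g \<in> carrier G" and h: "h \<in> carrier G"
  shows "card (twisted_roots (h \<otimes> g \<otimes> inv h)) = card (twisted_roots g)"
proof -
  have "bij_betw (\<lambda>x. h \<otimes> x \<otimes> \<phi> h) (twisted_roots g) (twisted_roots (h \<otimes> g \<otimes> inv h))"
  proof (rule bij_betw_byWitness[where f' = "\<lambda>x. inv h \<otimes> x \<otimes> inv (\<phi> h)"])
    note c = h phi_closed[OF h] inv_closed[OF h] inv_closed[OF phi_closed[OF h]]
    have can: "inv h \<otimes> (h \<otimes> y) = y" "h \<otimes> (inv h \<otimes> y) = y"
      "inv (\<phi> h) \<otimes> (\<phi> h \<otimes> y) = y" "\<phi> h \<otimes> (inv (\<phi> h) \<otimes> y) = y" if "y \<in> carrier G" for y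
      using that c by (simp_all add: m_assoc[symmetric])
    show "\<forall>x\<in>twisted_roots g. inv h \<otimes> (h \<otimes> x \<otimes> \<phi> h) \<otimes> inv (\<phi> h) = x"
      using c by (auto simp: twisted_roots_def m_assoc can)
    show "\<forall>x\<in>twisted_roots (h \<otimes> g \<otimes> inv h). h \<otimes> (inv h \<otimes> x \<otimes> inv (\<phi> h)) \<otimes> \<phi> h = x"
      using c by (auto simp: twisted_roots_def m_assoc can)
    show "(\<lambda>x. h \<otimes> x \<otimes> \<phi> h) ` twisted_roots g \<subseteq> twisted_roots (h \<otimes> g \<otimes> inv h)"
    proof safe
      fix x assume "x \<in> twisted_roots g"
      then have x: "x \<in> carrier G" "x \<otimes> inv (\<phi> x) = g" by (auto simp: twisted_roots_def)
      have "\<phi> (h \<otimes> x \<otimes> \<phi> h) = h \<otimes> (\<phi> x \<otimes> \<phi> h)"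
        using x c by (simp add: phi_mult phi_phi phi_closed)
      then have "(h \<otimes> x \<otimes> \<phi> h) \<otimes> inv (\<phi> (h \<otimes> x \<otimes> \<phi> h)) = h \<otimes> (x \<otimes> inv (\<phi> x)) \<otimes> inv h"
        using x(1) c by (simp add: inv_mult_group m_assoc phi_closed can)
      then show "h \<otimes> x \<otimes> \<phi> h \<in> twisted_roots (h \<otimes> g \<otimes> inv h)"
        using x c by (simp add: twisted_roots_def)
    qed
    show "(\<lambda>x. inv h \<otimes> x \<otimes> inv (\<phi> h)) ` twisted_roots (h \<otimes> g \<otimes> inv h) \<subseteq> twisted_roots g"
    proof safe
      fix x assume "x \<in> twisted_roots (h \<otimes> g \<otimes> inv h)"
      then have x: "x \<in> carrier G" "x \<otimes> inv (\<phi> x) = h \<otimes> g \<otimes> inv h" by (auto simp: twisted_roots_def)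
      have "\<phi> (inv h \<otimes> x \<otimes> inv (\<phi> h)) = inv h \<otimes> (\<phi> x \<otimes> inv (\<phi> h))"
        using x c by (simp add: phi_mult phi_phi phi_closed phi_inv)
      then have "(inv h \<otimes> x \<otimes> inv (\<phi> h)) \<otimes> inv (\<phi> (inv h \<otimes> x \<otimes> inv (\<phi> h)))
          = inv h \<otimes> (x \<otimes> inv (\<phi> x)) \<otimes> h"
        using x(1) c by (simp add: inv_mult_group m_assoc phi_closed can)
      also have "\<dots> = g" unfolding x(2) using g c by (simp add: m_assoc can)
      finally show "inv h \<otimes> x \<otimes> inv (\<phi> h) \<in> twisted_roots g"
        using x c by (simp add: twisted_roots_def)
    qed
  qed
  then show ?thesis by (simp add: bij_betw_same_card)
qed

text \<open>Both sides are class functions with the same pairing against each irreducible character: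
  by orthogonality for the sum of characters, by the twisted indicator for the number of
  roots.\<close>

theorem sum_Irr_eq_card_twisted_roots:
  assumes sym: "symmetric_forms G \<phi>"
    and conj: "\<And>x. x \<in> carrier G \<Longrightarrow> \<exists>h\<in>carrier G. \<phi> x = h \<otimes> x \<otimes> inv h"
    and g: "g \<in> carrier G"
  shows "(\<Sum>\<chi>\<in>Irr G. \<chi> g) = of_nat (card (twisted_roots g))"
proof -
  define u where "u = (\<lambda>g. of_nat (card (twisted_roots g)) - (\<Sum>\<chi>\<in>Irr G. \<chi> g))"
  have "u g = 0"
  proof (rule class_function_eq_zero[OF _ _ g])
    show "u (h \<otimes> g \<otimes> inv h) = u g" if "g \<in> carrier G" "h \<in> carrier G" for g h
      using that by (simp add: u_def card_twisted_roots_conj Irr_conj)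
  next
    fix \<chi> assume \<chi>: "\<chi> \<in> Irr G"
    obtain d \<rho> where \<rho>: "irr_rep G d \<rho>" "\<And>g. g \<in> carrier G \<Longrightarrow> \<chi> g = mtrace (\<rho> g)"
      using IrrE[OF \<chi>] by metis
    note rep = irr_rep_is_rep[OF \<rho>(1)]
    have "(\<Sum>y\<in>carrier G. of_nat (card (twisted_roots y)) * \<chi> (inv y)) =
        (\<Sum>y\<in>carrier G. \<Sum>x\<in>{x \<in> carrier G. x \<otimes> inv (\<phi> x) = y}. \<chi> (inv (x \<otimes> inv (\<phi> x))))"
      by (intro sum.cong refl) (simp add: twisted_roots_def)
    also have "\<dots> = (\<Sum>x\<in>carrier G. \<chi> (inv (x \<otimes> inv (\<phi> x))))"
      using finite_carrier by (intro sum.group) (auto simp: phi_closed)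
    \<comment> \<open>Replacing \<open>x\<close> by its inverse turns the argument into
      \<open>inv (\<phi> x) \<otimes> x\<close>, which has the same trace as
      \<open>x \<otimes> inv (\<phi> x)\<close>.\<close>
    also have "\<dots> = (\<Sum>x\<in>carrier G. \<chi> (inv (inv x \<otimes> inv (\<phi> (inv x)))))"
      by (rule sum.reindex_bij_betw[OF bij_betw_inv, symmetric])
    also have "\<dots> = (\<Sum>x\<in>carrier G. mtrace (\<rho> (x \<otimes> inv (\<phi> x))))"
    proof (rule sum.cong[OF refl])
      fix x assume x: "x \<in> carrier G"
      have "inv (inv x \<otimes> inv (\<phi> (inv x))) = inv (\<phi> x) \<otimes> x"
        using x by (simp add: phi_inv phi_closed inv_mult_group)
      then have "\<chi> (inv (inv x \<otimes> inv (\<phi> (inv x)))) = mtrace (\<rho> (inv (\<phi> x)) * \<rho> x)"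
        using x by (simp add: \<rho>(2) phi_closed is_rep_mult[OF rep])
      also have "\<dots> = mtrace (\<rho> x * \<rho> (inv (\<phi> x)))"
        using x by (intro mtrace_mult_comm[of _ d d] is_rep_carrier[OF rep]) (auto simp: phi_closed)
      finally show "\<chi> (inv (inv x \<otimes> inv (\<phi> (inv x)))) = mtrace (\<rho> (x \<otimes> inv (\<phi> x)))"
        using x by (simp add: phi_closed is_rep_mult[OF rep])
    qed
    also have "\<dots> = of_nat (card (carrier G))" by (rule twisted_indicator[OF \<rho>(1) sym conj])
    finally have 1: "(\<Sum>y\<in>carrier G. of_nat (card (twisted_roots y)) * \<chi> (inv y)) = of_nat (card (carrier G))" .
    have "(\<Sum>y\<in>carrier G. (\<Sum>\<psi>\<in>Irr G. \<psi> y) * \<chi> (inv y)) = (\<Sum>\<psi>\<in>Irr G. \<Sum>y\<in>carrier G. \<psi> y * \<chi> (inv y))"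
      unfolding sum_distrib_right by (rule sum.swap)
    also have "\<dots> = (\<Sum>\<psi>\<in>Irr G. if \<psi> = \<chi> then of_nat (card (carrier G)) else 0)"
      using \<chi> by (intro sum.cong refl) (simp add: Irr_orthogonality)
    also have "\<dots> = of_nat (card (carrier G))" using \<chi> finite_Irr by simp
    finally show "(\<Sum>y\<in>carrier G. u y * \<chi> (inv y)) = 0"
      using 1 by (simp add: u_def left_diff_distrib sum_subtractf)
  qed
  then show ?thesis by (simp add: u_def)
qed

text \<open>If \<open>\<phi>\<close> moves some \<open>x\<close>, then
  \<open>x \<otimes> inv (\<phi> x)\<close> is a nonidentity element with a twisted root, so its
  class contributes. If \<open>\<phi>\<close> is the identity, the group is commutative because
  \<open>\<phi>\<close> reverses products; conversely, conjugates in a commutative group are equal,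
  so \<open>\<phi> x = x\<close>.\<close>

theorem s_char_ge_Gamma_e:
  assumes sym: "symmetric_forms G \<phi>"
    and conj: "\<And>x. x \<in> carrier G \<Longrightarrow> \<exists>h\<in>carrier G. \<phi> x = h \<otimes> x \<otimes> inv h"
  shows "s_char G \<in> \<real> \<and> Re (Gamma_e G) \<le> Re (s_char G) \<and> (s_char G = Gamma_e G \<longleftrightarrow> comm_group G)"
proof -
  define N where "N = (\<lambda>g. card (twisted_roots g))"
  define cls where "cls = (\<lambda>g. {h \<otimes> g \<otimes> inv h | h. h \<in> carrier G})"
  have classes: "conj_classes G = cls ` carrier G" by (auto simp: conj_classes_def cls_def)
  have fin: "finite (conj_classes G)" using finite_carrier by (simp add: classes)
  have self: "g \<in> cls g" if "g \<in> carrier G" for g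
    using that unfolding cls_def by (intro CollectI exI[of _ \<one>]) simp
  define rep where "rep = (\<lambda>C :: 'a set. SOME g. g \<in> C)"
  have rep: "\<exists>h\<in>carrier G. rep (cls g) = h \<otimes> g \<otimes> inv h" if "g \<in> carrier G" for g
  proof -
    have "rep (cls g) \<in> cls g" unfolding rep_def using self[OF that] by (rule someI)
    then show ?thesis by (auto simp: cls_def)
  qed
  have repN: "N (rep (cls g)) = N g" "rep (cls g) \<in> carrier G" if "g \<in> carrier G" for g
    using rep[OF that] that by (auto simp: N_def card_twisted_roots_conj)
  have one: "cls \<one> = {\<one>}" using self[OF one_closed] by (auto simp: cls_def)
  have oneC: "{\<one>} \<in> conj_classes G" unfolding classes using one by (metis image_eqI one_closed)
  have rep1: "rep {\<one>} = \<one>" by (simp add: rep_def)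
  have \<Gamma>: "Gamma_e G = of_nat (N \<one>)"
    using sum_Irr_eq_card_twisted_roots[OF sym conj one_closed] by (simp add: Gamma_e_def N_def)
  have "s_char G = (\<Sum>C\<in>conj_classes G. \<Sum>\<chi>\<in>Irr G. \<chi> (rep C))"
    unfolding s_char_def rep_def by (rule sum.swap)
  also have "\<dots> = (\<Sum>C\<in>conj_classes G. of_nat (N (rep C)))"
    using repN(2) sum_Irr_eq_card_twisted_roots[OF sym conj]
    by (intro sum.cong refl) (auto simp: classes N_def)
  also have "\<dots> = of_nat (N \<one>) + (\<Sum>C\<in>conj_classes G - {{\<one>}}. of_nat (N (rep C)))"
    by (subst sum.remove[OF fin oneC]) (simp add: rep1)
  finally have s: "s_char G = of_nat (N \<one> + (\<Sum>C\<in>conj_classes G - {{\<one>}}. N (rep C)))" by simp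
  have "s_char G = Gamma_e G \<longleftrightarrow> (\<Sum>C\<in>conj_classes G - {{\<one>}}. N (rep C)) = 0"
    unfolding s \<Gamma> by (metis add_cancel_left_right of_nat_eq_iff)
  also have "\<dots> \<longleftrightarrow> (\<forall>C\<in>conj_classes G - {{\<one>}}. N (rep C) = 0)" using fin by simp
  also have "\<dots> \<longleftrightarrow> (\<forall>x\<in>carrier G. \<phi> x = x)"
  proof
    assume L: "\<forall>C\<in>conj_classes G - {{\<one>}}. N (rep C) = 0"
    show "\<forall>x\<in>carrier G. \<phi> x = x"
    proof (rule ballI, rule ccontr)
      fix x assume x: "x \<in> carrier G" "\<phi> x \<noteq> x"
      define g where "g = x \<otimes> inv (\<phi> x)"
      have g: "g \<in> carrier G" using x by (simp add: g_def phi_closed)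
      have "g \<noteq> \<one>" using x phi_closed[OF x(1)] unfolding g_def
        by (metis inv_closed inv_equality inv_inv)
      then have "cls g \<in> conj_classes G - {{\<one>}}" using g self[OF g] by (auto simp: classes)
      then have "N g = 0" using L repN(1)[OF g] by metis
      moreover have "x \<in> twisted_roots g" "finite (twisted_roots g)"
        using x finite_carrier by (auto simp: twisted_roots_def g_def)
      ultimately show False by (auto simp: N_def)
    qed
  next
    assume R: "\<forall>x\<in>carrier G. \<phi> x = x"
    have "twisted_roots g = {}" if "g \<noteq> \<one>" for g using that R by (auto simp: twisted_roots_def)
    then have N0: "N g = 0" if "g \<noteq> \<one>" for g using that by (simp add: N_def)
    show "\<forall>C\<in>conj_classes G - {{\<one>}}. N (rep C) = 0"
    proof
      fix C assume C: "C \<in> conj_classes G - {{\<one>}}"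
      then obtain g where g: "g \<in> carrier G" "C = cls g" by (auto simp: classes)
      then have "g \<noteq> \<one>" using C one by auto
      then show "N (rep C) = 0" using N0 repN(1)[OF g(1)] g by simp
    qed
  qed
  also have "\<dots> \<longleftrightarrow> comm_group G"
  proof
    assume R: "\<forall>x\<in>carrier G. \<phi> x = x"
    show "comm_group G"
    proof (rule group_comm_groupI)
      fix x y assume "x \<in> carrier G" "y \<in> carrier G"
      then show "x \<otimes> y = y \<otimes> x" using R phi_mult[of x y] by simp
    qed
  next
    assume "comm_group G"
    then interpret c: comm_group G .
    show "\<forall>x\<in>carrier G. \<phi> x = x"
    proof
      fix x assume x: "x \<in> carrier G"
      obtain h where h: "h \<in> carrier G" "\<phi> x = h \<otimes> x \<otimes> inv h" using conj[OF x] by blast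
      have "\<phi> x = x \<otimes> h \<otimes> inv h" using h c.m_comm[OF h(1) x] by simp
      then show "\<phi> x = x" using x h by (simp add: m_assoc)
    qed
  qed
  finally show ?thesis by (simp add: s \<Gamma> sum_nonneg)
qed

end

section \<open>Reversing weighted permutations\<close>

lemma sum_lessThan_add:
  fixes f :: "nat \<Rightarrow> int"
  shows "(\<Sum>t<p + m. f t) = (\<Sum>t<p. f t) + (\<Sum>t<m. f (p + t))"
  by (induction m) auto

lemma funpow_fixpoint_mult: "(s ^^ p) b = b \<Longrightarrow> (s ^^ (c * p)) b = b"
  by (induction c) (auto simp: funpow_add)

lemma funpow_add_apply: "(s ^^ (m + p)) b = (s ^^ m) ((s ^^ p) b)"
  by (simp add: funpow_add)

text \<open>Since \<open>s ^^ N = id\<close>, the exponent \<open>N * m - m\<close> undoes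
  \<open>m\<close> steps, so forward orbits partition the points. The point \<open>k\<close> is made
  the base point of its own orbit so that reflection at base points fixes it. The value
  \<open>idx i\<close> is merely some distance from the base point, determined up to return
  times.\<close>

lemma orbit_base_points:
  assumes N: "s ^^ N = id" "0 < N"
  obtains base idx where "\<And>i. (s ^^ idx i) (base i) = i" "\<And>i m. base ((s ^^ m) (base i)) = base i"
    "\<And>i. base i = (s ^^ (N * idx i - idx i)) i" "base k = k"
proof -
  have loop: "(s ^^ (N * m - m)) ((s ^^ m) y) = y" "(s ^^ m) ((s ^^ (N * m - m)) y) = y" for m y
  proof -
    have "m \<le> N * m" using N by simp
    then have "(s ^^ (N * m - m)) ((s ^^ m) y) = (s ^^ (m * N)) y"
      and "(s ^^ m) ((s ^^ (N * m - m)) y) = (s ^^ (m * N)) y"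
      by (simp_all add: funpow_add_apply[symmetric] mult.commute)
    moreover have "(s ^^ (m * N)) y = y" using N by (intro funpow_fixpoint_mult) simp
    ultimately show "(s ^^ (N * m - m)) ((s ^^ m) y) = y" "(s ^^ m) ((s ^^ (N * m - m)) y) = y" by simp_all
  qed
  define orb where "orb = (\<lambda>i. {y. \<exists>m. y = (s ^^ m) i})"
  have sub: "orb ((s ^^ m) i) \<subseteq> orb i" for m i
    by (auto simp: orb_def funpow_add_apply[symmetric])
  have orb_eq: "orb ((s ^^ m) i) = orb i" for m i
    using sub[of m i] sub[of "N * m - m" "(s ^^ m) i"] loop by auto
  define base where "base = (\<lambda>i. if k \<in> orb i then k else (SOME y. y \<in> orb i))"
  have "i \<in> orb i" for i unfolding orb_def by (intro CollectI exI[of _ 0]) simp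
  then have base_in: "base i \<in> orb i" for i unfolding base_def by (metis someI)
  have "\<exists>m. (s ^^ m) (base i) = i" for i
  proof -
    obtain m where "base i = (s ^^ m) i" using base_in[of i] by (auto simp: orb_def)
    then have "(s ^^ (N * m - m)) (base i) = i" using loop by simp
    then show ?thesis by blast
  qed
  then obtain idx where idx: "\<And>i. (s ^^ idx i) (base i) = i" by metis
  have orb_base: "orb (base i) = orb i" for i using orb_eq[of "idx i" "base i"] idx by simp
  show ?thesis
  proof (rule that[of idx base])
    show "(s ^^ idx i) (base i) = i" for i by (rule idx)
    have "orb ((s ^^ m) (base i)) = orb i" for m i using orb_eq orb_base by simp
    then show "base ((s ^^ m) (base i)) = base i" for m i unfolding base_def by metis
    show "base i = (s ^^ (N * idx i - idx i)) i" for i using loop(1)[of "idx i" "base i"] idx by simp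
    show "base k = k" using \<open>\<And>i. i \<in> orb i\<close> by (simp add: base_def)
  qed
qed

text \<open>Every cycle is reflected at a base point, \<open>\<pi> (s\<^sup>m b) = s\<^sup>-\<^sup>m b\<close>, and \<open>w\<close> is the potential that
  conjugates the reflected weights into the given ones.\<close>

lemma reversing_involution:
  fixes z :: "'a \<Rightarrow> int"
  assumes N: "s ^^ N = id" "0 < N" and inj: "inj s" and cl: "\<forall>i\<in>A. \<forall>m. (s ^^ m) i \<in> A"
  shows "\<exists>\<pi> w. (\<forall>i. s (\<pi> (s i)) = \<pi> i) \<and> (\<forall>i. \<pi> (\<pi> i) = i) \<and> (\<forall>i. s i = i \<longrightarrow> \<pi> i = i) \<and> \<pi> k = k \<and>
    (\<forall>i. w (s i) = w i + z (\<pi> i) - z (s i)) \<and>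
    ((\<forall>b\<in>A. \<forall>p. (s ^^ p) b = b \<longrightarrow> even p) \<longrightarrow>
       (\<exists>\<epsilon>. \<forall>i\<in>A. \<epsilon> (s i) = (\<not> \<epsilon> i) \<and> \<epsilon> (\<pi> i) = \<epsilon> i))"
proof -
  obtain base idx where idx: "\<And>i. (s ^^ idx i) (base i) = i"
    and base: "\<And>i m. base ((s ^^ m) (base i)) = base i"
    and base_pow: "\<And>i. base i = (s ^^ (N * idx i - idx i)) i" and basek: "base k = k"
    using orbit_base_points[OF N] by metis
  have injp: "(s ^^ m) x = (s ^^ m) y \<longleftrightarrow> x = y" for m x y
    using inj_fn[OF inj, of m] by (auto dest: injD)
  have diff: "(s ^^ p) b = b" if "(s ^^ m) b = (s ^^ (m + p)) b" for m p b
    using that injp[of m "(s ^^ p) b" b] by (simp add: funpow_add_apply)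
  \<comment> \<open>Well-definedness: the choice made by \<open>idx\<close> does not affect a
    quantity that is unchanged when a return time of the base point is added.\<close>
  have val: "F (base i) (idx ((s ^^ m) (base i))) = F (base i) m"
    if per: "\<And>m p. (s ^^ p) (base i) = base i \<Longrightarrow> F (base i) (m + p) = F (base i) m"
    for F :: "'a \<Rightarrow> nat \<Rightarrow> 'c" and i m
  proof -
    let ?m = "idx ((s ^^ m) (base i))"
    have eq: "(s ^^ ?m) (base i) = (s ^^ m) (base i)" using idx[of "(s ^^ m) (base i)"] base by simp
    show ?thesis
    proof (cases "m \<le> ?m")
      case True
      then show ?thesis using per[OF diff[of m _ "?m - m"], of m] eq by simp
    next
      case False
      then show ?thesis using per[OF diff[of ?m _ "m - ?m"], of ?m] eq by simp
    qed
  qed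
  \<comment> \<open>The power \<open>s ^^ M\<close> is the inverse of \<open>s\<close>, so
    \<open>s ^^ (M * m)\<close> goes back \<open>m\<close> steps.\<close>
  define M where "M = N - 1"
  have NM: "N = Suc M" using N by (simp add: M_def)
  define F where "F = (\<lambda>b m. (s ^^ (M * m)) b)"
  define \<pi> where "\<pi> = (\<lambda>i. F (base i) (idx i))"
  have Fper: "F b (m + p) = F b m" if "(s ^^ p) b = b" for b m p
    using funpow_fixpoint_mult[OF that, of M]
    by (simp add: F_def distrib_left funpow_add_apply)
  have \<pi>: "\<pi> ((s ^^ m) (base i)) = (s ^^ (M * m)) (base i)" for i m
  proof -
    have "F (base i) (idx ((s ^^ m) (base i))) = F (base i) m" by (rule val) (rule Fper)
    then show ?thesis by (simp add: \<pi>_def base F_def)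
  qed
  have full: "(s ^^ (M * m + m)) b = b" for m b
  proof -
    have "(s ^^ (m * N)) b = b" using N by (intro funpow_fixpoint_mult) simp
    then show ?thesis by (simp add: NM algebra_simps)
  qed
  \<comment> \<open>The increment that the recursion forces on the potential between steps
    \<open>t\<close> and \<open>t + 1\<close> along the orbit of \<open>b\<close>.\<close>
  define H where "H = (\<lambda>b t. z ((s ^^ (M * t)) b) - z ((s ^^ Suc t) b))"
  define W where "W = (\<lambda>b m. \<Sum>t<m. H b t)"
  have Wper: "W b (m + p) = W b m" if p: "(s ^^ p) b = b" for b m p
  proof -
    \<comment> \<open>On a closed walk of length \<open>p\<close>, going back \<open>t\<close> steps
      is going forward \<open>p - t\<close> steps. Hence both parts of \<open>H\<close> sum over the
      same points and the potential closes up.\<close>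
    have rev: "(s ^^ (M * t)) b = (s ^^ (p - t)) b" if "t < p" for t
    proof -
      have "(s ^^ t) ((s ^^ (M * t)) b) = b" using full[of t b] by (simp add: funpow_add_apply[symmetric] add.commute)
      moreover have "(s ^^ t) ((s ^^ (p - t)) b) = b" using that p by (simp add: funpow_add_apply[symmetric])
      ultimately show ?thesis using injp by metis
    qed
    have "(\<Sum>t<p. z ((s ^^ (M * t)) b)) = (\<Sum>t<p. z ((s ^^ (p - t)) b))" using rev by simp
    also have "\<dots> = (\<Sum>t<p. z ((s ^^ Suc (p - Suc t)) b))"
      by (intro sum.cong refl) (simp add: Suc_diff_Suc del: funpow.simps)
    also have "\<dots> = (\<Sum>t<p. z ((s ^^ Suc t) b))" by (rule sum.nat_diff_reindex)
    finally have "W b p = 0" by (simp add: W_def H_def sum_subtractf)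
    moreover have "H b (p + t) = H b t" for t
    proof -
      have "(s ^^ (M * (t + p))) b = (s ^^ (M * t)) b" using Fper[OF p, of t] by (simp add: F_def)
      moreover have "(s ^^ Suc (t + p)) b = (s ^^ Suc t) b" using p funpow_add_apply[of "Suc t" p s b] by simp
      ultimately show ?thesis by (simp add: H_def add.commute del: funpow.simps)
    qed
    ultimately show ?thesis
      using sum_lessThan_add[of "H b" p m] by (simp add: W_def add.commute)
  qed
  define w where "w = (\<lambda>i. W (base i) (idx i))"
  have w: "w ((s ^^ m) (base i)) = W (base i) m" for i m
  proof -
    have "W (base i) (idx ((s ^^ m) (base i))) = W (base i) m" by (rule val) (rule Wper)
    then show ?thesis by (simp add: w_def base)
  qed
  have s_i: "s i = (s ^^ Suc (idx i)) (base i)" for i using idx[of i] by simp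
  have \<pi>_i: "\<pi> i = (s ^^ (M * idx i)) (base i)" for i using \<pi>[of "idx i" i] idx[of i] by simp
  show ?thesis
  proof (intro exI[of _ \<pi>] exI[of _ w] conjI allI impI)
    fix i
    have "s (\<pi> (s i)) = (s ^^ Suc (M * Suc (idx i))) (base i)"
      using \<pi>[of "Suc (idx i)" i] s_i[of i] by simp
    also have "Suc (M * Suc (idx i)) = M * idx i + (M * 1 + 1)" by simp
    also have "(s ^^ \<dots>) (base i) = \<pi> i" by (simp only: funpow_add_apply[of "M * idx i"] full \<pi>_i)
    finally show "s (\<pi> (s i)) = \<pi> i" .
    show "\<pi> (\<pi> i) = i"
    proof -
      let ?m = "M * idx i"
      have "(s ^^ ?m) (\<pi> (\<pi> i)) = (s ^^ (M * ?m + ?m)) (base i)"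
        using \<pi>[of ?m i] \<pi>_i[of i] by (simp add: funpow_add_apply[symmetric] add.commute)
      also have "\<dots> = base i" by (rule full)
      also have "\<dots> = (s ^^ (M * idx i + idx i)) (base i)" by (rule full[symmetric])
      also have "\<dots> = (s ^^ ?m) i" using idx[of i] by (simp add: funpow_add_apply)
      finally show ?thesis using injp by metis
    qed
    show "w (s i) = w i + z (\<pi> i) - z (s i)"
    proof -
      have "w (s i) = W (base i) (Suc (idx i))" using w[of "Suc (idx i)" i] s_i[of i] by simp
      also have "\<dots> = W (base i) (idx i) + H (base i) (idx i)" by (simp add: W_def)
      also have "W (base i) (idx i) = w i" by (simp add: w_def)
      finally show ?thesis using s_i[of i] \<pi>_i[of i] by (simp add: H_def)
    qed
  next
    fix i assume i: "s i = i"
    have fp: "(s ^^ m) i = i" for m using i by (induction m) auto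
    have "base i = i" using base_pow fp by simp
    then show "\<pi> i = i" using \<pi>_i[of i] fp by simp
  next
    show "\<pi> k = k" using \<pi>[of 0 k] basek by simp
  next
    assume "\<forall>b\<in>A. \<forall>p. (s ^^ p) b = b \<longrightarrow> even p"
    then have ev: "\<And>b p. b \<in> A \<Longrightarrow> (s ^^ p) b = b \<Longrightarrow> even p" by blast
    \<comment> \<open>Colouring by the parity of the distance from the base point, consistent
      because all return times are even.\<close>
    define E where "E = (\<lambda>(b :: 'a) m. even (m :: nat))"
    define \<epsilon> where "\<epsilon> = (\<lambda>i. E (base i) (idx i))"
    have \<epsilon>: "\<epsilon> ((s ^^ m) (base i)) = even m" if i: "i \<in> A" for i m
    proof -
      have bA: "base i \<in> A" using cl i base_pow by metis
      have "E (base i) (idx ((s ^^ m) (base i))) = E (base i) m"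
        by (rule val) (use ev[OF bA] in \<open>auto simp: E_def\<close>)
      then show ?thesis by (simp add: \<epsilon>_def E_def)
    qed
    show "\<exists>\<epsilon>. \<forall>i\<in>A. \<epsilon> (s i) = (\<not> \<epsilon> i) \<and> \<epsilon> (\<pi> i) = \<epsilon> i"
    proof (intro exI[of _ \<epsilon>] ballI conjI)
      fix i assume i: "i \<in> A"
      have e: "\<epsilon> i = even (idx i)" using \<epsilon>[OF i, of "idx i"] idx by simp
      show "\<epsilon> (s i) = (\<not> \<epsilon> i)" using \<epsilon>[OF i, of "Suc (idx i)"] s_i[of i] e by simp
      \<comment> \<open>As \<open>N\<close> is a return time, \<open>M\<close> is odd, so going back
        \<open>idx i\<close> steps from the base point gives the colour of \<open>i\<close>.\<close>
      have "even N" using ev[OF i, of N] N by simp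
      then show "\<epsilon> (\<pi> i) = \<epsilon> i" using \<epsilon>[OF i, of "M * idx i"] \<pi>_i[of i] e NM by simp
    qed
  qed
qed

text \<open>The permutation \<open>s\<close> exchanges the two colour classes \<open>B\<close> and
  \<open>C\<close>, while \<open>\<pi>\<close> preserves them. Summing the recursion over
  \<open>B\<close> gives \<open>sum w C - sum w B = sum z B - sum z C\<close>, and modulo 2 the
  signs do not matter.\<close>

lemma parity_of_potential:
  fixes z w :: "'a \<Rightarrow> int"
  assumes A: "finite A" and s: "s permutes A" and \<pi>: "\<pi> permutes A"
    and w: "\<And>i. i \<in> A \<Longrightarrow> w (s i) = w i + z (\<pi> i) - z (s i)"
    and \<epsilon>: "\<And>i. i \<in> A \<Longrightarrow> \<epsilon> (s i) = (\<not> \<epsilon> i)" "\<And>i. i \<in> A \<Longrightarrow> \<epsilon> (\<pi> i) = \<epsilon> i"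
  shows "even (sum w A) = even (sum z A)"
proof -
  let ?B = "{i \<in> A. \<epsilon> i}" and ?C = "{i \<in> A. \<not> \<epsilon> i}"
  have split: "sum f A = sum f ?B + sum f ?C" for f :: "'a \<Rightarrow> int"
  proof -
    have "A = ?B \<union> ?C" by auto
    then have "sum f A = sum f (?B \<union> ?C)" by simp
    also have "\<dots> = sum f ?B + sum f ?C" using A by (intro sum.union_disjoint) auto
    finally show ?thesis .
  qed
  have "s ` ?B = ?C"
  proof
    show "s ` ?B \<subseteq> ?C" using \<epsilon> permutes_in_image[OF s] by auto
    show "?C \<subseteq> s ` ?B"
    proof
      fix y assume y: "y \<in> ?C"
      then obtain x where x: "x \<in> A" "y = s x" using permutes_image[OF s] by blast
      then show "y \<in> s ` ?B" using y \<epsilon>(1)[OF x(1)] by auto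
    qed
  qed
  then have bs: "bij_betw s ?B ?C" using permutes_inj_on[OF s] by (auto simp: bij_betw_def)
  have "\<pi> ` ?B = ?B"
  proof
    show "\<pi> ` ?B \<subseteq> ?B" using \<epsilon> permutes_in_image[OF \<pi>] by auto
    show "?B \<subseteq> \<pi> ` ?B"
    proof
      fix y assume y: "y \<in> ?B"
      then obtain x where x: "x \<in> A" "y = \<pi> x" using permutes_image[OF \<pi>] by blast
      then show "y \<in> \<pi> ` ?B" using y \<epsilon>(2)[OF x(1)] by auto
    qed
  qed
  then have bp: "bij_betw \<pi> ?B ?B" using permutes_inj_on[OF \<pi>] by (auto simp: bij_betw_def)
  have "sum w ?C = (\<Sum>i\<in>?B. w (s i))" by (rule sum.reindex_bij_betw[OF bs, symmetric])
  also have "\<dots> = (\<Sum>i\<in>?B. w i + z (\<pi> i) - z (s i))" using w by (intro sum.cong) auto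
  also have "\<dots> = sum w ?B + (\<Sum>i\<in>?B. z (\<pi> i)) - (\<Sum>i\<in>?B. z (s i))"
    by (simp add: sum.distrib sum_subtractf)
  also have "(\<Sum>i\<in>?B. z (\<pi> i)) = sum z ?B" by (rule sum.reindex_bij_betw[OF bp])
  also have "(\<Sum>i\<in>?B. z (s i)) = sum z ?C" by (rule sum.reindex_bij_betw[OF bs])
  finally have "sum w ?C = sum w ?B + sum z ?B - sum z ?C" .
  then show ?thesis unfolding split[of w] split[of z] by presburger
qed

text \<open>The value \<open>c i\<close> counts the visits to \<open>i\<close> during the first
  \<open>p\<close> steps of the walk from \<open>b\<close>; as the walk is closed, shifting it by
  \<open>s\<close> does not change the counts.\<close>

lemma invariant_function_with_sum:
  assumes A: "finite A" and s: "s permutes A" and b: "b \<in> A" and p: "(s ^^ p) b = b"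
  obtains c :: "'a \<Rightarrow> int" where "\<And>i. c (s i) = c i" "sum c A = int p"
proof
  define c where "c = (\<lambda>i. \<Sum>t<p. if (s ^^ t) b = i then 1 else 0 :: int)"
  show "c (s i) = c i" for i
  proof -
    have inj: "s x = s y \<longleftrightarrow> x = y" for x y using permutes_inj[OF s] by (auto dest: injD)
    have "c i = (\<Sum>t<p. if (s ^^ Suc t) b = s i then 1 else 0)" by (simp add: c_def inj)
    also have "\<dots> + (if (s ^^ 0) b = s i then 1 else 0) = (\<Sum>t<Suc p. if (s ^^ t) b = s i then 1 else 0)"
      by (subst sum.lessThan_Suc_shift) simp
    also have "\<dots> = c (s i) + (if (s ^^ 0) b = s i then 1 else 0)" using p by (simp add: c_def)
    finally show ?thesis by simp
  qed
  have "(s ^^ t) b \<in> A" for t using b permutes_in_funpow_image[OF s] by blast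
  then have "(\<Sum>i\<in>A. if (s ^^ t) b = i then 1 else 0 :: int) = 1" for t using A by simp
  then show "sum c A = int p" unfolding c_def by (subst sum.swap) simp
qed

text \<open>Adding an \<open>s\<close>-invariant function to the potential preserves its recursion.
  Modulo \<open>q\<close>, constants change its sum by all multiples of
  \<open>gcd q (card A)\<close>, and a closed walk of odd length supplies the odd changes. Without
  such a walk the points are two-coloured, and \<open>sum w A\<close> has the parity of
  \<open>sum z A\<close>, which is even when the gcd is 2.\<close>

lemma twisted_reversal:
  fixes z :: "'a \<Rightarrow> int" and q :: nat
  assumes A: "finite A" and s: "s permutes A" and "0 < q" and z: "int q dvd sum z A"
    and g2: "gcd q (card A) \<le> 2"
  shows "\<exists>\<pi> w. \<pi> permutes A \<and> (\<forall>i. s (\<pi> (s i)) = \<pi> i) \<and> (\<forall>i. \<pi> (\<pi> i) = i) \<and>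
    (\<forall>i. s i = i \<longrightarrow> \<pi> i = i) \<and> \<pi> k = k \<and>
    (\<forall>i. w (s i) = w i + z (\<pi> i) - z (s i)) \<and> int q dvd sum w A"
proof -
  have cl: "\<forall>i\<in>A. \<forall>m. (s ^^ m) i \<in> A" using permutes_in_funpow_image[OF s] by blast
  have "permutation s" using A s permutation_permutes by blast
  then obtain N where N: "s ^^ N = id" "0 < N" by (rule permutation_is_nilpotent)
  obtain \<pi> w where "\<forall>i. s (\<pi> (s i)) = \<pi> i" "\<forall>i. \<pi> (\<pi> i) = i" "\<forall>i. s i = i \<longrightarrow> \<pi> i = i" "\<pi> k = k"
    "\<forall>i. w (s i) = w i + z (\<pi> i) - z (s i)"
    and col: "(\<forall>b\<in>A. \<forall>p. (s ^^ p) b = b \<longrightarrow> even p) \<longrightarrow>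
       (\<exists>\<epsilon>. \<forall>i\<in>A. \<epsilon> (s i) = (\<not> \<epsilon> i) \<and> \<epsilon> (\<pi> i) = \<epsilon> i)"
    using reversing_involution[OF N permutes_inj[OF s] cl, of k z] by (elim exE conjE)
  then have \<pi>: "\<And>i. s (\<pi> (s i)) = \<pi> i" "\<And>i. \<pi> (\<pi> i) = i" "\<And>i. s i = i \<Longrightarrow> \<pi> i = i" "\<pi> k = k"
    and w: "\<And>i. w (s i) = w i + z (\<pi> i) - z (s i)" by blast+
  have \<pi>A: "\<pi> permutes A" unfolding permutes_def
  proof (intro conjI allI impI)
    show "\<pi> x = x" if "x \<notin> A" for x using \<pi>(3) s that by (simp add: permutes_def)
    show "\<exists>!x. \<pi> x = y" for y using \<pi>(2) by metis
  qed
  let ?n = "int (card A)" and ?g = "gcd q (card A)"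
  obtain x v where xv: "x * ?n + v * int q = int ?g"
    using bezout_int[of ?n "int q"] by (metis gcd.commute gcd_int_int_eq)
  have "\<exists>c. (\<forall>i. c (s i) = c i) \<and> int q dvd sum w A + sum c A"
  proof (cases "\<exists>b\<in>A. \<exists>p. (s ^^ p) b = b \<and> odd p")
    case True
    then obtain b p where b: "b \<in> A" "(s ^^ p) b = b" "odd p" by blast
    obtain c :: "'a \<Rightarrow> int" where c: "\<And>i. c (s i) = c i" "sum c A = int p"
      using invariant_function_with_sum[OF A s b(1,2)] by blast
    have "?g \<noteq> 0" using \<open>0 < q\<close> by simp
    then have "?g = 1 \<or> ?g = 2" using g2 by linarith
    then have "coprime ?g p" using b(3) by auto
    then have "gcd (int ?g) (int p) = 1" by (simp only: gcd_int_int_eq coprime_iff_gcd_eq_1)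
    then obtain a e where ae: "a * int ?g + e * int p = 1" using bezout_int[of "int ?g" "int p"] by metis
    \<comment> \<open>Modulo \<open>q\<close> the constant \<open>x\<close> has sum
      \<open>?g\<close>, so \<open>a * x + e * c i\<close> has sum
      \<open>a * ?g + e * p = 1\<close>; the factor \<open>- sum w A\<close> makes it cancel the sum
      of the potential.\<close>
    define c' where "c' = (\<lambda>i. - sum w A * (a * x + e * c i))"
    have "sum c' A = - sum w A * (a * (x * ?n) + e * int p)"
    proof -
      have "(\<Sum>i\<in>A. a * x + e * c i) = a * (x * ?n) + e * int p"
        by (simp add: sum.distrib sum_distrib_left[symmetric] c(2))
      then show ?thesis by (simp only: c'_def sum_distrib_left[symmetric])
    qed
    also have "x * ?n = int ?g - v * int q" using xv by simp
    also have "- sum w A * (a * (int ?g - v * int q) + e * int p) =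
        - sum w A * (a * int ?g + e * int p) + int q * (sum w A * a * v)" by (simp add: algebra_simps)
    finally have "sum w A + sum c' A = int q * (sum w A * a * v)" using ae by simp
    then show ?thesis using c by (intro exI[of _ c']) (simp add: c'_def)
  next
    case False
    then have "\<forall>b\<in>A. \<forall>p. (s ^^ p) b = b \<longrightarrow> even p" by blast
    with col have "\<exists>\<epsilon>. \<forall>i\<in>A. \<epsilon> (s i) = (\<not> \<epsilon> i) \<and> \<epsilon> (\<pi> i) = \<epsilon> i" by (rule mp)
    then obtain \<epsilon> where \<epsilon>: "\<forall>i\<in>A. \<epsilon> (s i) = (\<not> \<epsilon> i) \<and> \<epsilon> (\<pi> i) = \<epsilon> i" by (rule exE)
    have par: "even (sum w A) = even (sum z A)"
      by (rule parity_of_potential[OF A s \<pi>A, where \<epsilon> = \<epsilon>]) (rule w, use \<epsilon> in blast, use \<epsilon> in blast)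
    have "?g \<noteq> 0" using \<open>0 < q\<close> by simp
    then consider "?g = 1" | "?g = 2" using g2 by linarith
    then have "int ?g dvd sum w A"
    proof cases
      case 2
      then have "even q" by (metis gcd_dvd1)
      then have "even (int q)" by simp
      then have "even (sum z A)" using z by (rule dvd_trans)
      then show ?thesis using par 2 by simp
    qed simp
    then obtain u where u: "sum w A = int ?g * u" by blast
    \<comment> \<open>A constant is enough here: modulo \<open>q\<close> its sum is
      \<open>- (u * ?g)\<close>, the negative of \<open>sum w A\<close>.\<close>
    define c' where "c' = (\<lambda>i :: 'a. - (u * x))"
    have "sum w A + sum c' A = int q * (u * v)"
      using xv by (simp add: c'_def u) (simp add: algebra_simps flip: xv)
    then show ?thesis by (intro exI[of _ c']) (simp add: c'_def)
  qed
  then obtain c where c: "\<And>i. c (s i) = c i" "int q dvd sum w A + sum c A" by blast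
  show ?thesis
    by (intro exI[of _ \<pi>] exI[of _ "\<lambda>i. w i + c i"] conjI) (use \<pi>A \<pi> w c in \<open>auto simp: sum.distrib\<close>)
qed

section \<open>The groups G(r,q,n)\<close>

context
  fixes r q n :: nat
  assumes r: "0 < r" and q: "0 < q" and qr: "q dvd r"
begin

abbreviation (input) "GG \<equiv> G_rqn r q n"

lemma G_rqn_carrier_iff:
  "(z, \<sigma>) \<in> carrier GG \<longleftrightarrow> (\<forall>i\<in>{1..n}. z i < r) \<and> (\<forall>i. i \<notin> {1..n} \<longrightarrow> z i = 0) \<and>
      \<sigma> permutes {1..n} \<and> q dvd (\<Sum>i=1..n. z i)"
  by (simp add: G_rqn_def Grqn_carrier_def)

lemma G_rqn_mult:
  "(z, \<sigma>) \<otimes>\<^bsub>GG\<^esub> (z', \<sigma>') =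
    ((\<lambda>i. if i \<in> {1..n} then (z i + z' (inv_into UNIV \<sigma> i)) mod r else 0), \<sigma> \<circ> \<sigma>')"
  by (simp add: G_rqn_def Grqn_mult_def)

lemma G_rqn_one: "\<one>\<^bsub>GG\<^esub> = (\<lambda>_. 0, id)"
  by (simp add: G_rqn_def)

lemma dvd_sum_mod_iff: "q dvd (\<Sum>i=1..n. f i mod r) \<longleftrightarrow> q dvd (\<Sum>i=1..n. f i)"
proof -
  have "(\<Sum>i=1..n. f i mod r) mod q = (\<Sum>i=1..n. (f i mod r) mod q) mod q" by (simp add: mod_sum_eq)
  also have "\<dots> = (\<Sum>i=1..n. f i mod q) mod q" using qr by (simp add: mod_mod_cancel)
  also have "\<dots> = (\<Sum>i=1..n. f i) mod q" by (rule mod_sum_eq)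
  finally show ?thesis by (simp add: dvd_eq_mod_eq_0)
qed

lemma finite_carrier_G_rqn: "finite (carrier GG)"
proof (rule finite_subset)
  show "carrier GG \<subseteq> {z. \<forall>i. (i \<in> {1..n} \<longrightarrow> z i \<in> {..<r}) \<and> (i \<notin> {1..n} \<longrightarrow> z i = 0)} \<times> {\<sigma>. \<sigma> permutes {1..n}}"
    by (auto simp: G_rqn_carrier_iff)
  show "finite ({z. \<forall>i. (i \<in> {1..n} \<longrightarrow> z i \<in> {..<r}) \<and> (i \<notin> {1..n} \<longrightarrow> z i = 0)} \<times> {\<sigma>. \<sigma> permutes {1..n}})"
    by (intro finite_cartesian_product finite_permutations finite_set_of_finite_funs)
      (rule finite_atLeastAtMost finite_lessThan)+
qed

lemma group_G_rqn: "group GG"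
proof (rule groupI)
  fix x y assume "x \<in> carrier GG" "y \<in> carrier GG"
  moreover obtain z \<sigma> z' \<sigma>' where xy: "x = (z, \<sigma>)" "y = (z', \<sigma>')" by fastforce
  ultimately have x: "\<sigma> permutes {1..n}" "q dvd (\<Sum>i=1..n. z i)"
    and y: "\<sigma>' permutes {1..n}" "q dvd (\<Sum>i=1..n. z' i)"
    by (auto simp: G_rqn_carrier_iff)
  have "(\<Sum>i=1..n. z' (inv_into UNIV \<sigma> i)) = (\<Sum>i=1..n. z' i)"
    by (rule sum.permute[OF permutes_inv[OF x(1)], unfolded comp_def, symmetric])
  then have "q dvd (\<Sum>i=1..n. z i + z' (inv_into UNIV \<sigma> i))" using x y by (simp add: sum.distrib)
  then have "q dvd (\<Sum>i=1..n. (z i + z' (inv_into UNIV \<sigma> i)) mod r)" by (simp only: dvd_sum_mod_iff)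
  then show "x \<otimes>\<^bsub>GG\<^esub> y \<in> carrier GG"
    using x y r permutes_compose[OF y(1) x(1)] sum.cong[OF refl, of "{1..n}"
        "\<lambda>i. if i \<in> {1..n} then (z i + z' (inv_into UNIV \<sigma> i)) mod r else 0"
        "\<lambda>i. (z i + z' (inv_into UNIV \<sigma> i)) mod r"]
    unfolding xy G_rqn_mult G_rqn_carrier_iff by simp
next
  show "\<one>\<^bsub>GG\<^esub> \<in> carrier GG" using r by (simp add: G_rqn_one G_rqn_carrier_iff permutes_id)
next
  fix x y u assume "x \<in> carrier GG" "y \<in> carrier GG" "u \<in> carrier GG"
  moreover obtain z \<sigma> z' \<sigma>' z'' \<sigma>'' where xy: "x = (z, \<sigma>)" "y = (z', \<sigma>')" "u = (z'', \<sigma>'')" by (metis surj_pair)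
  ultimately have p: "\<sigma> permutes {1..n}" "\<sigma>' permutes {1..n}" by (auto simp: G_rqn_carrier_iff)
  have inv: "inv_into UNIV (\<sigma> \<circ> \<sigma>') i = inv_into UNIV \<sigma>' (inv_into UNIV \<sigma> i)" for i
    using o_inv_distrib[OF permutes_bij[OF p(1)] permutes_bij[OF p(2)]] by simp
  have inA: "inv_into UNIV \<sigma> i \<in> {1..n} \<longleftrightarrow> i \<in> {1..n}" for i
    using permutes_in_image[OF permutes_inv[OF p(1)]] .
  show "x \<otimes>\<^bsub>GG\<^esub> y \<otimes>\<^bsub>GG\<^esub> u = x \<otimes>\<^bsub>GG\<^esub> (y \<otimes>\<^bsub>GG\<^esub> u)"
    unfolding xy G_rqn_mult inv inA by (auto simp: fun_eq_iff mod_simps add.assoc)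
next
  fix x assume "x \<in> carrier GG"
  moreover obtain z \<sigma> where xy: "x = (z, \<sigma>)" by fastforce
  ultimately have z: "\<forall>i. i \<notin> {1..n} \<longrightarrow> z i = 0" "\<forall>i\<in>{1..n}. z i < r" by (auto simp: G_rqn_carrier_iff)
  have "inv_into UNIV (id :: nat \<Rightarrow> nat) = id" by simp
  then show "\<one>\<^bsub>GG\<^esub> \<otimes>\<^bsub>GG\<^esub> x = x"
    using z by (auto simp: xy G_rqn_one G_rqn_mult fun_eq_iff)
next
  fix x assume "x \<in> carrier GG"
  moreover obtain z \<sigma> where xy: "x = (z, \<sigma>)" by fastforce
  ultimately have x: "\<forall>i\<in>{1..n}. z i < r" "\<forall>i. i \<notin> {1..n} \<longrightarrow> z i = 0" "\<sigma> permutes {1..n}"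
    "q dvd (\<Sum>i=1..n. z i)" by (auto simp: G_rqn_carrier_iff)
  \<comment> \<open>The outer \<open>mod r\<close> matters where \<open>z (\<sigma> i) = 0\<close>,
    since \<open>r\<close> itself is not a residue.\<close>
  define y where "y = ((\<lambda>i. if i \<in> {1..n} then (r - z (\<sigma> i)) mod r else 0), inv_into UNIV \<sigma>)"
  have im: "\<sigma> i \<in> {1..n} \<longleftrightarrow> i \<in> {1..n}" for i using permutes_in_image[OF x(3)] .
  have "(\<Sum>i=1..n. r - z (\<sigma> i)) = (\<Sum>i=1..n. r - z i)"
    by (rule sum.permute[OF x(3), unfolded comp_def, symmetric])
  moreover have "(\<Sum>i=1..n. r - z i) + (\<Sum>i=1..n. z i) = n * r"
  proof -
    have "(\<Sum>i=1..n. r - z i) + (\<Sum>i=1..n. z i) = (\<Sum>i=1..n. (r - z i) + z i)" by (simp only: sum.distrib)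
    also have "\<dots> = (\<Sum>i=1..n. r)" using x(1) by (intro sum.cong) (auto simp: less_imp_le)
    finally show ?thesis by simp
  qed
  then have "q dvd (\<Sum>i=1..n. r - z i)" using qr x(4) by (metis dvd_add_left_iff dvd_mult)
  ultimately have "q dvd (\<Sum>i=1..n. (r - z (\<sigma> i)) mod r)" by (simp only: dvd_sum_mod_iff)
  then have "y \<in> carrier GG"
    using x r permutes_inv[OF x(3)] sum.cong[OF refl, of "{1..n}"
        "\<lambda>i. if i \<in> {1..n} then (r - z (\<sigma> i)) mod r else 0" "\<lambda>i. (r - z (\<sigma> i)) mod r"]
    unfolding y_def G_rqn_carrier_iff by simp
  moreover have "y \<otimes>\<^bsub>GG\<^esub> x = \<one>\<^bsub>GG\<^esub>"
  proof -
    have "inv_into UNIV (inv_into UNIV \<sigma>) = \<sigma>" by (rule permutes_inv_inv[OF x(3)])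
    moreover have "inv_into UNIV \<sigma> \<circ> \<sigma> = id" by (rule permutes_inv_o(2)[OF x(3)])
    moreover have "((r - z (\<sigma> i)) mod r + z (\<sigma> i)) mod r = 0" if "i \<in> {1..n}" for i
    proof -
      have "((r - z (\<sigma> i)) mod r + z (\<sigma> i)) mod r = (r - z (\<sigma> i) + z (\<sigma> i)) mod r" by (rule mod_add_left_eq)
      also have "r - z (\<sigma> i) + z (\<sigma> i) = r" using x(1) im that by (intro le_add_diff_inverse2) (simp add: less_imp_le)
      finally show ?thesis by simp
    qed
    ultimately show ?thesis by (simp add: y_def xy G_rqn_mult G_rqn_one fun_eq_iff)
  qed
  ultimately show "\<exists>y\<in>carrier GG. y \<otimes>\<^bsub>GG\<^esub> x = \<one>\<^bsub>GG\<^esub>" by blast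
qed

text \<open>Viewing \<open>(z, \<sigma>)\<close> as a monomial matrix whose nonzero entries are powers of a primitive
  \<open>r\<close>-th root of unity, this is matrix transposition.\<close>

definition mtransp :: "gelem \<Rightarrow> gelem" where
  "mtransp x = (\<lambda>i. fst x (snd x i), inv_into UNIV (snd x))"

lemma mtransp_closed: "x \<in> carrier GG \<Longrightarrow> mtransp x \<in> carrier GG"
proof -
  assume "x \<in> carrier GG"
  moreover obtain z \<sigma> where xy: "x = (z, \<sigma>)" by fastforce
  ultimately have x: "\<forall>i\<in>{1..n}. z i < r" "\<forall>i. i \<notin> {1..n} \<longrightarrow> z i = 0" "\<sigma> permutes {1..n}"
    "q dvd (\<Sum>i=1..n. z i)" by (auto simp: G_rqn_carrier_iff)
  have im: "\<sigma> i \<in> {1..n} \<longleftrightarrow> i \<in> {1..n}" for i using permutes_in_image[OF x(3)] .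
  have "(\<Sum>i=1..n. z (\<sigma> i)) = (\<Sum>i=1..n. z i)"
    by (rule sum.permute[OF x(3), unfolded comp_def, symmetric])
  then show ?thesis using x im permutes_inv[OF x(3)]
    unfolding xy mtransp_def G_rqn_carrier_iff fst_conv snd_conv by metis
qed

lemma anti_involution_mtransp: "anti_involution GG mtransp"
proof -
  interpret group GG by (rule group_G_rqn)
  show ?thesis
  proof unfold_locales
    show "finite (carrier GG)" by (rule finite_carrier_G_rqn)
    show "mtransp x \<in> carrier GG" if "x \<in> carrier GG" for x using that by (rule mtransp_closed)
  next
    fix x y assume "x \<in> carrier GG" "y \<in> carrier GG"
    moreover obtain z \<sigma> z' \<sigma>' where xy: "x = (z, \<sigma>)" "y = (z', \<sigma>')" by fastforce
    ultimately have p: "\<sigma> permutes {1..n}" "\<sigma>' permutes {1..n}"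
      and z: "\<forall>i. i \<notin> {1..n} \<longrightarrow> z i = 0" "\<forall>i. i \<notin> {1..n} \<longrightarrow> z' i = 0" by (auto simp: G_rqn_carrier_iff)
    have "inv_into UNIV (\<sigma> \<circ> \<sigma>') = inv_into UNIV \<sigma>' \<circ> inv_into UNIV \<sigma>"
      by (rule o_inv_distrib[OF permutes_bij[OF p(1)] permutes_bij[OF p(2)]])
    moreover have "\<sigma> (\<sigma>' i) \<in> {1..n} \<longleftrightarrow> i \<in> {1..n}" for i
      using permutes_in_image[OF p(1)] permutes_in_image[OF p(2)] by metis
    moreover have "inv_into UNIV \<sigma> (\<sigma> i) = i" for i using permutes_inverses(2)[OF p(1)] .
    moreover have "inv_into UNIV (inv_into UNIV \<sigma>') = \<sigma>'" by (rule permutes_inv_inv[OF p(2)])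
    ultimately show "mtransp (x \<otimes>\<^bsub>GG\<^esub> y) = mtransp y \<otimes>\<^bsub>GG\<^esub> mtransp x"
      by (simp add: xy mtransp_def G_rqn_mult fun_eq_iff add.commute del: atLeastAtMost_iff)
  next
    fix x assume "x \<in> carrier GG"
    moreover obtain z \<sigma> where xy: "x = (z, \<sigma>)" by fastforce
    ultimately have p: "\<sigma> permutes {1..n}" by (auto simp: G_rqn_carrier_iff)
    show "mtransp (mtransp x) = x"
      by (simp add: xy mtransp_def permutes_inverses[OF p] permutes_inv_inv[OF p])
  qed
qed

text \<open>In matrix terms, the indices from \<open>k\<close> on form a diagonal block and all
  weights remain, so \<open>flag 1\<close> is the diagonal subgroup. The general formula would give
  the same group at 0, since the permutations fix 0 anyway; the trivial group is put there instead,
  as the start of the induction.\<close>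

definition flag :: "nat \<Rightarrow> gelem set" where
  "flag k = (if k = 0 then {\<one>\<^bsub>GG\<^esub>} else {x \<in> carrier GG. \<forall>i\<ge>k. snd x i = i})"

lemma snd_G_rqn_mult: "snd (x \<otimes>\<^bsub>GG\<^esub> y) = snd x \<circ> snd y"
  by (cases x; cases y) (simp add: G_rqn_mult)

lemma flag_subgroup: "subgroup (flag k) GG"
proof -
  interpret group GG by (rule group_G_rqn)
  show ?thesis
  proof (cases "k = 0")
    case True
    then show ?thesis by (simp add: flag_def triv_subgroup)
  next
    case False
    show ?thesis
    proof (rule subgroupI)
      show "flag k \<subseteq> carrier GG" using False by (auto simp: flag_def)
      have "\<one>\<^bsub>GG\<^esub> \<in> flag k" using False by (simp add: flag_def) (simp add: G_rqn_one)
      then show "flag k \<noteq> {}" by blast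
    next
      fix a assume "a \<in> flag k"
      then have a: "a \<in> carrier GG" "\<forall>i\<ge>k. snd a i = i" using False by (auto simp: flag_def)
      have "snd (inv\<^bsub>GG\<^esub> a) \<circ> snd a = id" using snd_G_rqn_mult[of "inv\<^bsub>GG\<^esub> a" a] a(1) by (simp add: G_rqn_one)
      then have "snd (inv\<^bsub>GG\<^esub> a) (snd a i) = i" for i by (simp add: fun_eq_iff)
      then have "\<forall>i\<ge>k. snd (inv\<^bsub>GG\<^esub> a) i = i" using a(2) by metis
      then show "inv\<^bsub>GG\<^esub> a \<in> flag k" using a(1) False by (simp add: flag_def)
    next
      fix a b assume "a \<in> flag k" "b \<in> flag k"
      then show "a \<otimes>\<^bsub>GG\<^esub> b \<in> flag k" using False by (auto simp: flag_def snd_G_rqn_mult)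
    qed
  qed
qed

lemma flag_mono: "flag k \<subseteq> flag (Suc k)"
  by (auto simp: flag_def) (auto simp: G_rqn_one G_rqn_carrier_iff permutes_id r)

lemma mtransp_flag: "x \<in> flag k \<Longrightarrow> mtransp x \<in> flag k"
proof (cases "k = 0")
  case True
  then show "x \<in> flag k \<Longrightarrow> mtransp x \<in> flag k" by (simp add: flag_def G_rqn_one mtransp_def)
next
  case False
  assume "x \<in> flag k"
  then have x: "x \<in> carrier GG" "\<forall>i\<ge>k. snd x i = i" using False by (auto simp: flag_def)
  obtain z \<sigma> where "x = (z, \<sigma>)" by fastforce
  then have "snd x permutes {1..n}" using x(1) by (simp add: G_rqn_carrier_iff)
  then have "\<forall>i\<ge>k. inv_into UNIV (snd x) i = i" using x(2) by (metis permutes_inverses(2))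
  then show ?thesis using mtransp_closed[OF x(1)] False by (simp add: flag_def) (simp add: mtransp_def)
qed

text \<open>The conjugating element is built from \<open>twisted_reversal\<close>. Its permutation
  \<open>\<pi>\<close> fixes the points above \<open>k\<close> because \<open>\<sigma>\<close> does,
  and \<open>k\<close> itself because \<open>k\<close> was prescribed as a base point; so it lies
  one step lower in the chain than \<open>x\<close>.\<close>

lemma mtransp_conj:
  assumes g2: "gcd q n \<le> 2" and x: "x \<in> flag (Suc k)"
  shows "\<exists>h\<in>flag k. mtransp x = h \<otimes>\<^bsub>GG\<^esub> x \<otimes>\<^bsub>GG\<^esub> inv\<^bsub>GG\<^esub> h"
proof -
  interpret group GG by (rule group_G_rqn)
  obtain z \<sigma> where xz: "x = (z, \<sigma>)" by fastforce
  have xG: "x \<in> carrier GG" and fixed: "\<forall>i\<ge>Suc k. \<sigma> i = i" using x by (auto simp: flag_def xz)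
  have z: "\<forall>i\<in>{1..n}. z i < r" "\<forall>i. i \<notin> {1..n} \<longrightarrow> z i = 0" "q dvd (\<Sum>i=1..n. z i)"
    and \<sigma>: "\<sigma> permutes {1..n}" using xG by (auto simp: xz G_rqn_carrier_iff)
  show ?thesis
  proof (cases "k = 0")
    \<comment> \<open>Here \<open>x\<close> is diagonal, hence equal to its transpose, and the
      identity conjugates.\<close>
    case True
    have "\<sigma> i = i" for i
    proof (cases "i \<ge> Suc k")
      case False
      then have "i \<notin> {1..n}" using True by simp
      then show ?thesis using \<sigma> by (simp add: permutes_def)
    qed (use fixed in auto)
    then have "\<sigma> = id" by auto
    then have "mtransp x = x" by (simp add: xz mtransp_def)
    then show ?thesis using True xG by (simp add: flag_def)
  next
    case False
    have card: "gcd q (card {1..n}) \<le> 2" using g2 by simp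
    have zq: "int q dvd (\<Sum>i\<in>{1..n}. int (z i))" using z(3) by (metis int_dvd_int_iff of_nat_sum)
    obtain \<pi> w where "\<pi> permutes {1..n}" "\<forall>i. \<sigma> (\<pi> (\<sigma> i)) = \<pi> i" "\<forall>i. \<pi> (\<pi> i) = i"
      "\<forall>i. \<sigma> i = i \<longrightarrow> \<pi> i = i" "\<pi> k = k"
      "\<forall>i. w (\<sigma> i) = w i + int (z (\<pi> i)) - int (z (\<sigma> i))" and wq: "int q dvd sum w {1..n}"
      using twisted_reversal[OF finite_atLeastAtMost \<sigma> q zq card, of k] by (elim exE conjE)
    then have \<pi>: "\<pi> permutes {1..n}" "\<And>i. \<sigma> (\<pi> (\<sigma> i)) = \<pi> i" "\<And>i. \<pi> (\<pi> i) = i"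
      "\<And>i. \<sigma> i = i \<Longrightarrow> \<pi> i = i" "\<pi> k = k"
      and w: "\<And>i. w (\<sigma> i) = w i + int (z (\<pi> i)) - int (z (\<sigma> i))" by blast+
    \<comment> \<open>The integer potential becomes residues modulo \<open>r\<close>; as
      \<open>q\<close> divides \<open>r\<close>, its sum stays 0 modulo \<open>q\<close>.\<close>
    define w' where "w' = (\<lambda>i. if i \<in> {1..n} then nat (w i mod int r) else 0)"
    have w': "int (w' i) = w i mod int r" if "i \<in> {1..n}" for i using that r by (simp add: w'_def)
    define h where "h = (w', \<pi>)"
    have "int (\<Sum>i=1..n. w' i) = (\<Sum>i=1..n. w i mod int r)"
      unfolding of_nat_sum by (intro sum.cong refl w')
    moreover have "int q dvd (\<Sum>i=1..n. w i mod int r)"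
    proof -
      have "(\<Sum>i=1..n. w i mod int r) mod int q = (\<Sum>i=1..n. (w i mod int r) mod int q) mod int q"
        by (simp add: mod_sum_eq)
      also have "\<dots> = (\<Sum>i=1..n. w i mod int q) mod int q" using qr by (simp add: mod_mod_cancel)
      also have "\<dots> = (\<Sum>i=1..n. w i) mod int q" by (rule mod_sum_eq)
      finally show ?thesis using wq unfolding dvd_eq_mod_eq_0 by (rule trans)
    qed
    ultimately have "q dvd (\<Sum>i=1..n. w' i)" by (metis int_dvd_int_iff)
    moreover have "w' i < r" if "i \<in> {1..n}" for i
      using r that by (simp add: w'_def nat_less_iff)
    ultimately have hG: "h \<in> carrier GG" using \<pi>(1) by (simp add: h_def G_rqn_carrier_iff) (simp add: w'_def)
    have "\<pi> i = i" if "i \<ge> k" for i using that \<pi>(4,5) fixed by (cases "i = k") auto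
    then have hk: "h \<in> flag k" using hG False by (simp add: flag_def) (simp add: h_def)
    have inv\<pi>: "inv_into UNIV \<pi> = \<pi>" using \<pi>(3) by (intro inv_unique_comp) (auto simp: fun_eq_iff)
    \<comment> \<open>On permutations this says that \<open>\<pi>\<close> reverses
      \<open>\<sigma>\<close>; on weights at \<open>i\<close> it is the recursion for
      \<open>w\<close>, read modulo \<open>r\<close>.\<close>
    have "h \<otimes>\<^bsub>GG\<^esub> x = mtransp x \<otimes>\<^bsub>GG\<^esub> h"
    proof -
      have "\<pi> \<circ> \<sigma> = inv_into UNIV \<sigma> \<circ> \<pi>"
      proof
        fix i
        have "inv_into UNIV \<sigma> (\<sigma> (\<pi> (\<sigma> i))) = \<pi> (\<sigma> i)" by (rule permutes_inverses(2)[OF \<sigma>])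
        then show "(\<pi> \<circ> \<sigma>) i = (inv_into UNIV \<sigma> \<circ> \<pi>) i" using \<pi>(2) by simp
      qed
      moreover have "(w' i + z (\<pi> i)) mod r = (z (\<sigma> i) + w' (\<sigma> i)) mod r" if i: "i \<in> {1..n}" for i
      proof -
        have si: "\<sigma> i \<in> {1..n}" using permutes_in_image[OF \<sigma>] i by metis
        have "int ((w' i + z (\<pi> i)) mod r) = (w i mod int r + int (z (\<pi> i))) mod int r"
          using w'[OF i] by (simp add: zmod_int)
        also have "\<dots> = (w i + int (z (\<pi> i))) mod int r" by (simp add: mod_simps)
        also have "w i + int (z (\<pi> i)) = int (z (\<sigma> i)) + w (\<sigma> i)" using w by simp
        also have "\<dots> mod int r = (int (z (\<sigma> i)) + w (\<sigma> i) mod int r) mod int r" by (simp add: mod_simps)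
        also have "\<dots> = int ((z (\<sigma> i) + w' (\<sigma> i)) mod r)" using w'[OF si] by (simp add: zmod_int)
        finally show ?thesis by (simp only: of_nat_eq_iff)
      qed
      ultimately show ?thesis
        by (simp add: h_def xz mtransp_def G_rqn_mult inv\<pi> permutes_inv_inv[OF \<sigma>] fun_eq_iff del: atLeastAtMost_iff)
    qed
    then have "h \<otimes>\<^bsub>GG\<^esub> x \<otimes>\<^bsub>GG\<^esub> inv\<^bsub>GG\<^esub> h = mtransp x"
      using hG xG mtransp_closed[OF xG] by (simp add: m_assoc)
    then show ?thesis using hk by metis
  qed
qed

text \<open>Each extension step takes place inside \<open>flag (Suc k)\<close>, the group for whose
  elements \<open>mtransp_conj\<close> provides conjugating elements in
  \<open>flag k\<close>.\<close>

lemma symmetric_forms_flag: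
  assumes g2: "gcd q n \<le> 2"
  shows "symmetric_forms (GG\<lparr>carrier := flag k\<rparr>) mtransp"
proof (induction k)
  case 0
  show ?case by (rule symmetric_forms_trivial) (simp add: flag_def)
next
  case (Suc k)
  interpret G: anti_involution GG mtransp by (rule anti_involution_mtransp)
  let ?H = "GG\<lparr>carrier := flag (Suc k)\<rparr>"
  have sub: "flag (Suc k) \<subseteq> carrier GG" by (rule subgroup.subset[OF flag_subgroup])
  interpret H: group ?H by (rule G.subgroup_imp_group[OF flag_subgroup])
  interpret H: anti_involution ?H mtransp
    by unfold_locales
      (use sub finite_subset[OF sub G.finite_carrier] mtransp_flag G.phi_mult[OF subsetD[OF sub] subsetD[OF sub]]
        G.phi_phi[OF subsetD[OF sub]] in \<open>simp_all del: split_paired_All\<close>)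
  have subK: "subgroup (flag k) ?H"
    by (rule G.subgroup_incl[OF flag_subgroup flag_subgroup flag_mono])
  show ?case
  proof (rule H.symmetric_forms_extend[OF subK mtransp_flag])
    fix x assume x: "x \<in> carrier ?H"
    then obtain h where h: "h \<in> flag k" "mtransp x = h \<otimes>\<^bsub>GG\<^esub> x \<otimes>\<^bsub>GG\<^esub> inv\<^bsub>GG\<^esub> h"
      using mtransp_conj[OF g2, of x k] by auto
    have "inv\<^bsub>?H\<^esub> h = inv\<^bsub>GG\<^esub> h"
      by (rule G.m_inv_consistent[OF flag_subgroup]) (use h flag_mono in blast)
    then show "\<exists>h\<in>flag k. mtransp x = h \<otimes>\<^bsub>?H\<^esub> x \<otimes>\<^bsub>?H\<^esub> inv\<^bsub>?H\<^esub> h" using h by (intro bexI[of _ h]) auto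
  qed (use Suc in simp_all)
qed

lemma flag_top: "flag (Suc n) = carrier GG"
  by (auto simp: flag_def G_rqn_carrier_iff permutes_def)

theorem G_rqn_s_char_ge_Gamma_e:
  assumes g2: "gcd q n \<le> 2"
  shows "s_char GG \<in> \<real> \<and> Re (Gamma_e GG) \<le> Re (s_char GG) \<and> (s_char GG = Gamma_e GG \<longleftrightarrow> comm_group GG)"
proof -
  interpret anti_involution GG mtransp by (rule anti_involution_mtransp)
  show ?thesis
  proof (rule s_char_ge_Gamma_e)
    show "symmetric_forms GG mtransp"
      using symmetric_forms_flag[OF g2, of "Suc n"] by (simp add: flag_top)
    show "\<exists>h\<in>carrier GG. mtransp x = h \<otimes>\<^bsub>GG\<^esub> x \<otimes>\<^bsub>GG\<^esub> inv\<^bsub>GG\<^esub> h" if "x \<in> carrier GG" for x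
      using mtransp_conj[OF g2, of x n] that flag_top subgroup.subset[OF flag_subgroup, of n] by blast
  qed
qed

end

theorem theorem6p9:
  fixes r q n :: nat
  assumes "0 < r" and "0 < q" and "0 < n" and "q dvd r" and "gcd q n \<le> 2"
  shows "s_char (G_rqn r q n) \<in> \<real> \<and> Re (Gamma_e (G_rqn r q n)) \<le> Re (s_char (G_rqn r q n))
         \<and> (s_char (G_rqn r q n) = Gamma_e (G_rqn r q n) \<longleftrightarrow> comm_group (G_rqn r q n))"
  using G_rqn_s_char_ge_Gamma_e[OF assms(1,2,4,5)] .

end
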